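(* There exist constants $0<\rho_2<1$ and $C_2>0$ such that for all $\mathcal{T}\in\mathbb{T}(\mathcal{T}_0)$ and all $\hat{\mathcal{T}}\in\mathbb{T}(\mathcal{T})$, $$\sum_{\hat T\in\hat{\mathcal{T}}\setminus\mathcal{T}}\eta_{\hat T}(\hat{\mathcal{T}};U(\hat{\mathcal{T}}))^2\le\rho_2\sum_{T\in\mathcal{T}\setminus\hat{\mathcal{T}}}\eta_T(\mathcal{T};U(\mathcal{T}))^2+C_2\,\mathrm{d}[U(\hat{\mathcal{T}}),U(\mathcal{T})]^2.$$
   Context: For an element $T$, $|T|$ is its measure; for a matrix $q$, $|q|$ is the Frobenius norm and $\tau:\mu$ the Frobenius inner product. **Setting.** Let $d\in\{2,3\}$ and let $\Omega\subset\mathbb{R}^d$ be a domain with Lipschitz boundary $\partial\Omega$, which is split into a closed non-empty part $\Gamma_D\subset\partial\Omega$ of positive surface measure and an open part $\Gamma_N:=\partial\Omega\setminus\Gamma_D$ (possibly empty). Let $f\in L^2(\Omega;\mathbb{R}^d)$, $g\in L^2(\Gamma_N;\mathbb{R}^d)$. Put $\mathbb{S}_d:=\{q\in\mathbb{R}^{d\times d}\mid q_{ji}=q_{ij}\}$, $\mathbb{S}_{d,0}:=\{q\in\mathbb{S}_d\mid \sum_{j=1}^d q_{jj}=0\}$, $V:=\{v\in H^1(\Omega;\mathbb{R}^d)\mid v=0\text{ on }\Gamma_D\}$, $Q:=L^2(\Omega;\mathbb{S}_{d,0})$, $M:=L^2(\Omega)$, $X:=V\times Q\times M$. For $w\in V$,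 $\varepsilon(w):=\frac12(\nabla w+(\nabla w)^T)$. Let $\mathbb{C}$ be the isotropic elasticity tensor, symmetric and constant, with $\kappa_{\mathbb{C}}|\tau|^2\le\mathbb{C}\tau:\tau$ for all $\tau\in L^2(\Omega;\mathbb{S}_d)$, and $\mathbb{H}$ the hardening tensor, symmetric with $\kappa_{\mathbb{H}}|\tau|^2\le\mathbb{H}\tau:\tau$ for all $\tau\in L^2(\Omega;\mathbb{S}_d)$, where $\kappa_{\mathbb{C}},\kappa_{\mathbb{H}}>0$ are constants. Let $H>0$ be the isotropic hardening modulus and $\sigma_y>0$ the constant yield stress. The stress is $\sigma(w,p):=\mathbb{C}(\varepsilon(w)-p)$. Let $j(q,\beta):=\sigma_y|q|$ if $|q|\le\beta$ and $j(q,\beta):=\infty$ otherwise. For $u=(w,p,\alpha)$, $z=(v,q,\beta)\in X$ let $$a(u,z):=(\sigma(w,p),\varepsilon(v)-q)_{L^2(\Omega)}+(\mathbb{H}p,q)_{L^2(\Omega)}+(H\alpha,\beta)_{L^2(\Omega)},$$ $$\psi(z):=\int_\Omega j(q,\beta)\,dx,\qquad b(z):=(f,v)_{L^2(\Omega)}+(g,v)_{L^2(\Gamma_N)}.$$ **Meshes and refinement.** A mesh $\mathcal{T}$ is a finite decomposition of $\Omega$, $\overline\Omega=\bigcup_{T\in\mathcal{T}}T$, into closed triangles ($d=2$) or tetrahedra ($d=3$), which is conforming, i.e. the intersection of two elements is either empty or a common face, edge or vertex. Each $T\in\mathcal{T}$ has a fixed edge $E_T$ (the reference edge). For a set $\mathcal{M}\subset\mathcal{T}$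 of elements to be refined, newest vertex bisection (for dimension $d\ge2$ in the generalization of Maubach, Traxler and Stevenson) generates the new mesh $\operatorname{NVB}(\mathcal{T},\mathcal{M})$ as follows. First, each $T\in\mathcal{M}$ is bisected into two triangles or tetrahedra, where the midpoint of $E_T$ (the newest vertex) is connected to the vertex opposite to $E_T$; the edges opposite to the newest vertex are the reference edges of the new triangles or tetrahedra. Second, in the same way all elements of the resulting mesh which have a hanging node (a vertex of the mesh in the interior of an edge of the element) are bisected, until there are no hanging nodes. $\mathbb{T}(\mathcal{T})$ is the set of all meshes created from $\mathcal{T}$ by finitely many successive applications of newest vertex bisection. $\mathcal{T}_0$ is a fixed initial mesh. The meshes in $\mathbb{T}(\mathcal{T}_0)$ are uniformly shape regular: there is $c>0$ with $h_T\le c\,\rho_T$ for all elements $T$ of all these meshes, where $h_T$ is the diameter and $\rho_T$ the inradius of $T$. **Discrete problem.** $X(\mathcal{T}):=V(\mathcal{T})\times Q(\mathcal{T})\times M(\mathcal{T})$, where $V(\mathcal{T})$ consists of the functions in $V$ that are affine on every element, and $Q(\mathcal{T})$, $M(\mathcal{T})$ consist of the functions with values in $\mathbb{S}_{d,0}$, resp. $\mathbb{R}$, that are constant on every element. $U(\mathcal{T})\in X(\mathcal{T})$ is the unique solution of $b(z-U(\mathcal{T}))\le a(U(\mathcal{T}),z-U(\mathcal{T}))+\psi(z)-\psi(U(\mathcal{T}))$ for all $z\in X(\mathcal{T})$. **Error measure and indicators.** For $z=(v,q,\beta)$, $\hat z=(\hat v,\hat q,\hat\beta)\in X$: $\mathrm{d}[z,\hat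 z]:=\|\sigma(v,q)-\sigma(\hat v,\hat q)\|_{L^2(\Omega;\mathbb{R}^{d\times d})}$. For $T\in\mathcal{T}$ and $z=(v,q,\beta)\in X(\mathcal{T})$ (for both $d=2$ and $d=3$), $$\eta_T(\mathcal{T};z)^2:=|T|\,\|f\|_{L^2(T;\mathbb{R}^d)}^2+|T|^{1/2}\sum_{E\in\mathcal{E}(T)}R_E(z)^2,$$ where $\mathcal{E}(T)$ is the set of edges ($d=2$) or faces ($d=3$) of $T$, and, with $\nu_E$ the fixed unit normal corresponding to $E$, $R_E(z):=\|[\sigma(v,q)]\nu_E\|_{L^2(E;\mathbb{R}^d)}$ for interior $E$ ($[\cdot]$ the jump along $E$), $R_E(z):=\|g-\sigma(v,q)\nu_E\|_{L^2(E;\mathbb{R}^d)}$ for $E$ on $\Gamma_N$, $R_E(z):=0$ for $E$ on $\Gamma_D$. *)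

theory Defs
  imports "HOL-Analysis.Analysis"
begin

section \<open>Surface measure\<close>

definition hausdorff_pre :: "nat \<Rightarrow> real \<Rightarrow> 'a::metric_space set \<Rightarrow> ennreal" where
  "hausdorff_pre s \<delta> A =
     (INF C \<in> {C :: nat \<Rightarrow> 'a set. A \<subseteq> (\<Union>i. C i) \<and> (\<forall>i. bounded (C i) \<and> diameter (C i) \<le> \<delta>)}.
        \<Sum>i. if C i = {} then 0 else ennreal (unit_ball_vol (real s) * (diameter (C i) / 2) ^ s))"

definition hausdorff_outer :: "nat \<Rightarrow> 'a::metric_space set \<Rightarrow> ennreal" where
  "hausdorff_outer s A = (SUP \<delta> \<in> {0<..}. hausdorff_pre s \<delta> A)"

definition hausdorff_measure :: "nat \<Rightarrow> 'a::metric_space measure" where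
  "hausdorff_measure s = measure_of UNIV (sets borel) (hausdorff_outer s)"

text \<open>The outer measure is countably additive on the Borel sets, so \<^term>\<open>hausdorff_measure s\<close>
  agrees with it there (lemma \<open>emeasure_hausdorff_measure\<close>). The normalization is the one
  for which the \<open>s\<close>-dimensional unit ball has measure \<^term>\<open>unit_ball_vol (real s)\<close>.\<close>

lemma hausdorff_pre_mono: "A \<subseteq> B \<Longrightarrow> hausdorff_pre s \<delta> A \<le> hausdorff_pre s \<delta> B"
  unfolding hausdorff_pre_def by (rule INF_superset_mono) auto

lemma hausdorff_pre_anti: "\<delta> \<le> \<delta>' \<Longrightarrow> hausdorff_pre s \<delta>' A \<le> hausdorff_pre s \<delta> A"
  unfolding hausdorff_pre_def by (rule INF_superset_mono) (auto intro: order_trans)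

lemma hausdorff_pre_UN: "hausdorff_pre s \<delta> (\<Union>i. A i) \<le> (\<Sum>i. hausdorff_pre s \<delta> (A i))"
proof (rule ennreal_le_epsilon)
  fix e :: real assume fin: "(\<Sum>i. hausdorff_pre s \<delta> (A i)) < top" and e: "0 < e"
  define w where "w = (\<lambda>C::'a set. if C = {} then 0 else ennreal (unit_ball_vol (real s) * (diameter C / 2) ^ s))"
  define adm where "adm = (\<lambda>B (C::nat \<Rightarrow> 'a set). B \<subseteq> (\<Union>i. C i) \<and> (\<forall>i. bounded (C i) \<and> diameter (C i) \<le> \<delta>))"
  have pre: "hausdorff_pre s \<delta> B = (INF C \<in> {C. adm B C}. \<Sum>i. w (C i))" for B
    by (simp add: hausdorff_pre_def w_def adm_def)
  have "\<exists>C. adm (A i) C \<and> (\<Sum>j. w (C j)) \<le> hausdorff_pre s \<delta> (A i) + ennreal (e * (1/2) ^ Suc i)" for i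
  proof -
    have "hausdorff_pre s \<delta> (A i) < top"
      using fin ennreal_suminf_lessD by blast
    then have "hausdorff_pre s \<delta> (A i) < hausdorff_pre s \<delta> (A i) + ennreal (e * (1/2) ^ Suc i)"
      using e by (simp add: ennreal_zero_less_mult_iff less_top ennreal_add_left_cancel_less)
    then show ?thesis
      unfolding pre INF_less_iff by (auto intro: less_imp_le)
  qed
  then obtain C where C: "\<And>i. adm (A i) (C i)"
    "\<And>i. (\<Sum>j. w (C i j)) \<le> hausdorff_pre s \<delta> (A i) + ennreal (e * (1/2) ^ Suc i)"
    by metis
  define D where "D = (\<lambda>n. case prod_decode n of (i, j) \<Rightarrow> C i j)"
  have D: "adm (\<Union>i. A i) D"
    unfolding adm_def
  proof (intro conjI allI)
    show "(\<Union>i. A i) \<subseteq> (\<Union>n. D n)"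
    proof
      fix x assume "x \<in> (\<Union>i. A i)"
      then obtain i where "x \<in> A i" by auto
      then obtain j where "x \<in> C i j" using C(1)[of i] by (auto simp: adm_def)
      then have "x \<in> D (prod_encode (i, j))" by (simp add: D_def)
      then show "x \<in> (\<Union>n. D n)" by blast
    qed
    show "bounded (D n)" "diameter (D n) \<le> \<delta>" for n
      using C(1) by (auto simp: D_def adm_def split: prod.split)
  qed
  have "hausdorff_pre s \<delta> (\<Union>i. A i) \<le> (\<Sum>n. w (D n))"
    unfolding pre using D by (intro INF_lower) auto
  also have "\<dots> = (\<Sum>n. (\<lambda>(i, j). w (C i j)) (prod_decode n))"
    by (simp add: D_def split_beta)
  also have "\<dots> = (\<Sum>i. \<Sum>j. w (C i j))"
    using suminf_ennreal_2dimen[of "\<lambda>i. \<Sum>j. w (C i j)" "\<lambda>(i, j). w (C i j)"] by (simp add: o_def)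
  also have "\<dots> \<le> (\<Sum>i. hausdorff_pre s \<delta> (A i) + ennreal (e * (1/2) ^ Suc i))"
    by (intro suminf_le C(2)) auto
  also have "\<dots> = (\<Sum>i. hausdorff_pre s \<delta> (A i)) + (\<Sum>i. ennreal (e * (1/2) ^ Suc i))"
    by (rule suminf_add[symmetric]) auto
  also have "(\<Sum>i. ennreal (e * (1/2) ^ Suc i)) = ennreal e"
  proof -
    have "(\<lambda>i. e * (1/2) ^ Suc i) sums e"
      using sums_mult[OF power_half_series, of e] by simp
    then show ?thesis
      using e by (intro suminf_ennreal_eq) auto
  qed
  finally show "hausdorff_pre s \<delta> (\<Union>i. A i) \<le> (\<Sum>i. hausdorff_pre s \<delta> (A i)) + ennreal e" .
qed

lemma hausdorff_outer_mono: "A \<subseteq> B \<Longrightarrow> hausdorff_outer s A \<le> hausdorff_outer s B"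
  unfolding hausdorff_outer_def by (rule SUP_mono') (rule hausdorff_pre_mono)

lemma hausdorff_outer_empty: "hausdorff_outer s ({} :: 'a::metric_space set) = 0"
proof -
  have "hausdorff_pre s \<delta> ({}::'a set) = 0" if "\<delta> > 0" for \<delta>
  proof -
    have "hausdorff_pre s \<delta> ({}::'a set) \<le> (\<Sum>i::nat. 0)"
      unfolding hausdorff_pre_def
      by (rule INF_lower2[of "\<lambda>i. {}"]) (use that in auto)
    then show ?thesis by simp
  qed
  then show ?thesis by (simp add: hausdorff_outer_def)
qed

lemma hausdorff_outer_UN: "hausdorff_outer s (\<Union>i. A i) \<le> (\<Sum>i. hausdorff_outer s (A i))"
  unfolding hausdorff_outer_def[of s "\<Union>i. A i"]
proof (rule SUP_least)
  fix \<delta> :: real assume "\<delta> \<in> {0<..}"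
  then have "hausdorff_pre s \<delta> (A i) \<le> hausdorff_outer s (A i)" for i
    unfolding hausdorff_outer_def by (rule SUP_upper)
  then have "(\<Sum>i. hausdorff_pre s \<delta> (A i)) \<le> (\<Sum>i. hausdorff_outer s (A i))"
    by (intro suminf_le) auto
  with hausdorff_pre_UN show "hausdorff_pre s \<delta> (\<Union>i. A i) \<le> (\<Sum>i. hausdorff_outer s (A i))"
    by (rule order_trans)
qed

lemma outer_measure_space_hausdorff: "outer_measure_space UNIV (hausdorff_outer s)"
  by (auto simp: outer_measure_space_def positive_def increasing_def countably_subadditive_def
      hausdorff_outer_empty hausdorff_outer_mono hausdorff_outer_UN)

lemma hausdorff_outer_Un: "hausdorff_outer s (A \<union> B) \<le> hausdorff_outer s A + hausdorff_outer s B"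
proof -
  have "hausdorff_outer s (\<Union>i. binaryset A B i) \<le> (\<Sum>i. hausdorff_outer s (binaryset A B i))"
    by (rule hausdorff_outer_UN)
  then show ?thesis
    by (simp add: UN_binaryset_eq suminf_binaryset_eq hausdorff_outer_empty)
qed

lemma hausdorff_outer_separated:
  assumes r: "0 < r" and sep: "\<And>x y. x \<in> A \<Longrightarrow> y \<in> B \<Longrightarrow> r \<le> dist x y"
  shows "hausdorff_outer s A + hausdorff_outer s B \<le> hausdorff_outer s (A \<union> B)"
proof -
  have pre: "hausdorff_pre s \<delta> A + hausdorff_pre s \<delta> B \<le> hausdorff_pre s \<delta> (A \<union> B)"
    if \<delta>: "0 < \<delta>" "\<delta> < r" for \<delta>
    unfolding hausdorff_pre_def[of s \<delta> "A \<union> B"]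
  proof (rule INF_greatest)
    fix C :: "nat \<Rightarrow> 'a set" assume "C \<in> {C. A \<union> B \<subseteq> (\<Union>i. C i) \<and> (\<forall>i. bounded (C i) \<and> diameter (C i) \<le> \<delta>)}"
    then have C: "A \<union> B \<subseteq> (\<Union>i. C i)" "\<And>i. bounded (C i)" "\<And>i. diameter (C i) \<le> \<delta>" by auto
    define w where "w = (\<lambda>C::'a set. if C = {} then 0 else ennreal (unit_ball_vol (real s) * (diameter C / 2) ^ s))"
    define CA where "CA = (\<lambda>i. if C i \<inter> A \<noteq> {} then C i else {})"
    define CB where "CB = (\<lambda>i. if C i \<inter> B \<noteq> {} then C i else {})"
    have disj: "CA i = {} \<or> CB i = {}" for i
    proof (rule ccontr)
      assume "\<not> ?thesis"
      then obtain x y where "x \<in> C i" "x \<in> A" "y \<in> C i" "y \<in> B"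
        by (auto simp: CA_def CB_def split: if_splits)
      with sep[of x y] diameter_bounded_bound[OF C(2), of x i y] C(3)[of i] \<delta> show False by auto
    qed
    have le: "w (CA i) + w (CB i) \<le> w (C i)" for i
    proof -
      have "w {} = 0" "CA i = {} \<or> CA i = C i" "CB i = {} \<or> CB i = C i"
        by (auto simp: w_def CA_def CB_def)
      with disj[of i] show ?thesis by auto
    qed
    have "hausdorff_pre s \<delta> A \<le> (\<Sum>i. w (CA i))"
      unfolding hausdorff_pre_def w_def
    proof (rule INF_lower, safe)
      fix x assume "x \<in> A"
      moreover from this obtain i where "x \<in> C i" using C(1) by blast
      ultimately have "x \<in> CA i" by (auto simp: CA_def)
      then show "x \<in> (\<Union>i. CA i)" by blast
    qed (use C \<delta> in \<open>auto simp: CA_def\<close>)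
    moreover have "hausdorff_pre s \<delta> B \<le> (\<Sum>i. w (CB i))"
      unfolding hausdorff_pre_def w_def
    proof (rule INF_lower, safe)
      fix x assume "x \<in> B"
      moreover from this obtain i where "x \<in> C i" using C(1) by blast
      ultimately have "x \<in> CB i" by (auto simp: CB_def)
      then show "x \<in> (\<Union>i. CB i)" by blast
    qed (use C \<delta> in \<open>auto simp: CB_def\<close>)
    ultimately have "hausdorff_pre s \<delta> A + hausdorff_pre s \<delta> B \<le> (\<Sum>i. w (CA i)) + (\<Sum>i. w (CB i))"
      by (rule add_mono)
    also have "\<dots> = (\<Sum>i. w (CA i) + w (CB i))" by (rule suminf_add) auto
    also have "\<dots> \<le> (\<Sum>i. w (C i))" by (intro suminf_le le) auto
    finally show "hausdorff_pre s \<delta> A + hausdorff_pre s \<delta> B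
      \<le> (\<Sum>i. if C i = {} then 0 else ennreal (unit_ball_vol (real s) * (diameter (C i) / 2) ^ s))"
      by (simp add: w_def)
  qed
  have "hausdorff_pre s \<delta> A + hausdorff_pre s \<delta>' B \<le> hausdorff_outer s (A \<union> B)"
    if "0 < \<delta>" "0 < \<delta>'" for \<delta> \<delta>'
  proof -
    define d where "d = min (min \<delta> \<delta>') (r / 2)"
    have d: "0 < d" "d < r" "d \<le> \<delta>" "d \<le> \<delta>'" using that r by (auto simp: d_def)
    have "hausdorff_pre s \<delta> A + hausdorff_pre s \<delta>' B \<le> hausdorff_pre s d A + hausdorff_pre s d B"
      using d by (intro add_mono hausdorff_pre_anti)
    also have "\<dots> \<le> hausdorff_pre s d (A \<union> B)" using d by (intro pre)
    also have "\<dots> \<le> hausdorff_outer s (A \<union> B)"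
      unfolding hausdorff_outer_def using d by (intro SUP_upper) auto
    finally show ?thesis .
  qed
  then have le: "hausdorff_pre s \<delta> A + hausdorff_outer s B \<le> hausdorff_outer s (A \<union> B)" if "0 < \<delta>" for \<delta>
    using that unfolding hausdorff_outer_def[of s B]
    by (subst ennreal_SUP_add_right) (auto intro!: SUP_least)
  have "hausdorff_outer s A + hausdorff_outer s B = (SUP \<delta>\<in>{0<..}. hausdorff_pre s \<delta> A + hausdorff_outer s B)"
    unfolding hausdorff_outer_def[of s A] by (rule ennreal_SUP_add_left[symmetric]) (simp add: greaterThan_non_empty)
  also have "\<dots> \<le> hausdorff_outer s (A \<union> B)"
    by (rule SUP_least) (simp add: le)
  finally show ?thesis .
qed

lemma hausdorff_outer_separated_sum:
  fixes R :: "nat \<Rightarrow> 'a::metric_space set"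
  assumes "\<And>k. 0 < r k" and "\<And>j k x y. j < k \<Longrightarrow> x \<in> R j \<Longrightarrow> y \<in> R k \<Longrightarrow> r k \<le> dist x y"
  shows "(\<Sum>k<n. hausdorff_outer s (R k)) \<le> hausdorff_outer s (\<Union>k<n. R k)"
proof (induction n)
  case (Suc n)
  have "(\<Sum>k<Suc n. hausdorff_outer s (R k)) \<le> hausdorff_outer s (\<Union>k<n. R k) + hausdorff_outer s (R n)"
    using Suc by (simp add: add_right_mono)
  also have "\<dots> \<le> hausdorff_outer s ((\<Union>k<n. R k) \<union> R n)"
    by (rule hausdorff_outer_separated[of "r n"]) (use assms in auto)
  also have "(\<Union>k<n. R k) \<union> R n = (\<Union>k<Suc n. R k)" by (auto simp: lessThan_Suc)
  finally show ?case .
qed simp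

lemma hausdorff_outer_closed:
  fixes F X :: "'a::metric_space set"
  assumes F: "closed F" "F \<noteq> {}"
  shows "hausdorff_outer s (X \<inter> F) + hausdorff_outer s (X - F) \<le> hausdorff_outer s X"
proof (cases "hausdorff_outer s X = top")
  case False
  let ?H = "hausdorff_outer s :: 'a set \<Rightarrow> ennreal"
  define R where "R = (\<lambda>k::nat. {x \<in> X. 1 / (real k + 2) \<le> infdist x F \<and> infdist x F < 1 / (real k + 1)})"
  define Y where "Y = (\<lambda>k::nat. {x \<in> X. 1 / (real k + 1) \<le> infdist x F})"
  have parity: "(\<Sum>k<n. ?H (R (2 * k + p))) \<le> ?H X" for n p
  proof -
    have "(\<Sum>k<n. ?H (R (2 * k + p))) \<le> ?H (\<Union>k<n. R (2 * k + p))"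
    proof (rule hausdorff_outer_separated_sum[where r = "\<lambda>k. 1 / (real (2*k+p) + 1/2) - 1 / (real (2*k+p) + 1)"])
      show "0 < 1 / (real (2*k+p) + 1/2) - 1 / (real (2*k+p) + 1)" for k
        by (simp add: field_simps add_pos_nonneg)
      fix j k x y assume jk: "j < k" "x \<in> R (2 * j + p)" "y \<in> R (2 * k + p)"
      have "real j + 1 \<le> real k" using jk by linarith
      then have "1 / (real (2*k+p) + 1/2) \<le> 1 / (real (2*j+p) + 2)"
        by (intro divide_left_mono) (auto intro!: mult_pos_pos add_nonneg_pos)
      moreover have "infdist x F \<le> infdist y F + dist x y" by (rule infdist_triangle)
      ultimately show "1 / (real (2*k+p) + 1/2) - 1 / (real (2*k+p) + 1) \<le> dist x y"
        using jk by (auto simp: R_def)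
    qed
    also have "\<dots> \<le> ?H X" by (rule hausdorff_outer_mono) (auto simp: R_def)
    finally show ?thesis .
  qed
  have split: "(\<Sum>k<2 * n. ?H (R k)) = (\<Sum>k<n. ?H (R (2 * k + 0))) + (\<Sum>k<n. ?H (R (2 * k + 1)))" for n
    by (induction n) (auto simp: ac_simps)
  define S where "S = (\<Sum>k. ?H (R k))"
  have "(\<Sum>k<n. ?H (R k)) \<le> ?H X + ?H X" for n
  proof -
    have "(\<Sum>k<n. ?H (R k)) \<le> (\<Sum>k<2 * n. ?H (R k))" by (rule sum_mono2) auto
    also have "\<dots> \<le> ?H X + ?H X" unfolding split by (intro add_mono parity)
    finally show ?thesis .
  qed
  then have "S \<le> ?H X + ?H X"
    unfolding S_def by (intro suminf_le_const summableI)
  with False have S: "S \<noteq> top" by (auto simp: top_unique)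
  have le: "?H (X \<inter> F) + ?H (X - F) + (\<Sum>k<n. ?H (R k)) \<le> ?H X + S" for n
  proof -
    have "X - F \<subseteq> Y n \<union> (\<Union>k. R (k + n))"
    proof
      fix x assume x: "x \<in> X - F"
      then have pos: "0 < infdist x F"
        using F by (simp add: infdist_pos_not_in_closed)
      show "x \<in> Y n \<union> (\<Union>k. R (k + n))"
      proof (rule ccontr)
        assume "x \<notin> Y n \<union> (\<Union>k. R (k + n))"
        then have n: "infdist x F < 1 / (real n + 1)" and
          R: "infdist x F < 1 / (real (k+n) + 1) \<Longrightarrow> infdist x F < 1 / (real (k+n) + 2)" for k
          using x by (auto simp: Y_def R_def not_le)
        have small: "infdist x F < 1 / (real (k + n) + 1)" for k
        proof (induction k)
          case (Suc k) then show ?case using R[of k] by (simp add: ac_simps)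
        qed (use n in simp)
        obtain k :: nat where k: "1 / infdist x F < real k" using reals_Archimedean2 by blast
        have kn: "0 < real (k + n) + 1" by linarith
        have "1 < infdist x F * real k" using k pos by (simp add: field_simps)
        also have "\<dots> \<le> infdist x F * (real (k + n) + 1)" using pos by (intro mult_left_mono) auto
        finally have "1 < infdist x F * (real (k + n) + 1)" .
        moreover have "infdist x F * (real (k + n) + 1) < 1"
          using small[of k] kn by (simp add: pos_less_divide_eq)
        ultimately show False by simp
      qed
    qed
    then have "?H (X - F) \<le> ?H (Y n \<union> (\<Union>k. R (k + n)))" by (rule hausdorff_outer_mono)
    also have "\<dots> \<le> ?H (Y n) + ?H (\<Union>k. R (k + n))" by (rule hausdorff_outer_Un)
    also have "\<dots> \<le> ?H (Y n) + (\<Sum>k. ?H (R (k + n)))" by (intro add_left_mono hausdorff_outer_UN)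
    finally have 1: "?H (X - F) \<le> ?H (Y n) + (\<Sum>k. ?H (R (k + n)))" .
    have "?H (X \<inter> F) + ?H (Y n) \<le> ?H (X \<inter> F \<union> Y n)"
    proof (rule hausdorff_outer_separated)
      fix x y assume "x \<in> X \<inter> F" "y \<in> Y n"
      then show "1 / (real n + 1) \<le> dist x y"
        using infdist_le[of x F y] by (auto simp: Y_def dist_commute)
    qed simp
    also have "\<dots> \<le> ?H X" by (rule hausdorff_outer_mono) (auto simp: Y_def)
    finally have 2: "?H (X \<inter> F) + ?H (Y n) \<le> ?H X" .
    have 3: "S = (\<Sum>k. ?H (R (k + n))) + (\<Sum>k<n. ?H (R k))"
      unfolding S_def by (rule suminf_offset) simp
    have "?H (X \<inter> F) + ?H (X - F) + (\<Sum>k<n. ?H (R k))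
        \<le> ?H (X \<inter> F) + (?H (Y n) + (\<Sum>k. ?H (R (k + n)))) + (\<Sum>k<n. ?H (R k))"
      by (intro add_mono 1 order_refl)
    also have "\<dots> = (?H (X \<inter> F) + ?H (Y n)) + S" by (simp add: 3 ac_simps)
    also have "\<dots> \<le> ?H X + S" by (intro add_right_mono 2)
    finally show ?thesis .
  qed
  have "(\<lambda>n. ?H (X \<inter> F) + ?H (X - F) + (\<Sum>k<n. ?H (R k))) \<longlonglongrightarrow> ?H (X \<inter> F) + ?H (X - F) + S"
    unfolding S_def by (intro tendsto_add tendsto_const summable_LIMSEQ summableI)
  then have "?H (X \<inter> F) + ?H (X - F) + S \<le> ?H X + S"
    using le by (intro LIMSEQ_le_const2) auto
  with S show ?thesis by (simp add: ennreal_add_left_cancel_le add.commute[of _ S])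
qed simp

lemma measure_space_hausdorff:
  "measure_space UNIV (sets borel) (hausdorff_outer s :: 'a::metric_space set \<Rightarrow> ennreal)"
proof -
  let ?H = "hausdorff_outer s :: 'a set \<Rightarrow> ennreal"
  interpret sigma_algebra "UNIV :: 'a set" UNIV
    using sigma_algebra_Pow[of "UNIV :: 'a set"] by simp
  have ms: "measure_space UNIV (lambda_system UNIV UNIV ?H) ?H"
    by (rule caratheodory_lemma) (rule outer_measure_space_hausdorff)
  then have sa: "sigma_algebra UNIV (lambda_system UNIV UNIV ?H)"
    by (simp add: measure_space_def)
  have "F \<in> lambda_system UNIV UNIV ?H" if F: "closed F" for F
  proof -
    have "?H (X \<inter> F) + ?H (X - F) = ?H X" for X
    proof (rule antisym)
      show "?H (X \<inter> F) + ?H (X - F) \<le> ?H X"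
        using hausdorff_outer_closed[OF F, of s X]
        by (cases "F = {}") (auto simp: hausdorff_outer_empty)
      show "?H X \<le> ?H (X \<inter> F) + ?H (X - F)"
        using hausdorff_outer_Un[of s "X \<inter> F" "X - F"] by (simp add: Int_Diff_Un)
    qed
    then show ?thesis by (simp add: lambda_system_eq)
  qed
  then have "sigma_sets UNIV (Collect closed) \<subseteq> lambda_system UNIV UNIV ?H"
    using sa by (intro sigma_algebra.sigma_sets_subset) auto
  then have "sets borel \<subseteq> lambda_system UNIV UNIV ?H"
    by (simp add: borel_eq_closed)
  moreover have "sigma_algebra (UNIV :: 'a set) (sets borel)"
    using sets.sigma_algebra_axioms[of "borel :: 'a measure"] by simp
  ultimately show ?thesis
    using measure_down[OF ms] by blast
qed

lemma sets_hausdorff_measure [simp, measurable_cong]: "sets (hausdorff_measure s) = sets borel"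
  and space_hausdorff_measure [simp]: "space (hausdorff_measure s) = UNIV"
  using sets.sigma_sets_eq[of borel] by (auto simp: hausdorff_measure_def)

lemma emeasure_hausdorff_measure:
  "A \<in> sets borel \<Longrightarrow> emeasure (hausdorff_measure s) A = hausdorff_outer s A"
  using measure_space_hausdorff[of s]
  by (intro emeasure_measure_of[OF hausdorff_measure_def]) (auto simp: measure_space_def)

definition surface_measure :: "(real^'n::finite) measure" where
  "surface_measure = hausdorff_measure (CARD('n) - 1)"


section \<open>Function spaces\<close>

text \<open>Functions are total; only their restriction to the space of the measure matters, and
  only up to null sets.\<close>

definition square_integrable :: "'a measure \<Rightarrow> ('a \<Rightarrow> 'b::euclidean_space) \<Rightarrow> bool" where
  "square_integrable M u \<longleftrightarrow> u \<in> borel_measurable M \<and> integrable M (\<lambda>x. (norm (u x))\<^sup>2)"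

definition L2_norm :: "'a measure \<Rightarrow> ('a \<Rightarrow> 'b::euclidean_space) \<Rightarrow> real" where
  "L2_norm M u = sqrt (\<integral>x. (norm (u x))\<^sup>2 \<partial>M)"

definition L2_inner :: "'a measure \<Rightarrow> ('a \<Rightarrow> 'b::euclidean_space) \<Rightarrow> ('a \<Rightarrow> 'b) \<Rightarrow> real" where
  "L2_inner M u v = (\<integral>x. u x \<bullet> v x \<partial>M)"

text \<open>On \<^typ>\<open>real^'n^'n\<close> the operations \<^term>\<open>norm\<close> and \<^term>\<open>inner\<close> are the Frobenius norm
  and the Frobenius inner product.\<close>

definition sym_mat :: "(real^'n::finite^'n) set" where
  "sym_mat = {q. \<forall>i j. q $ j $ i = q $ i $ j}"

definition sym_mat0 :: "(real^'n::finite^'n) set" where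
  "sym_mat0 = {q \<in> sym_mat. (\<Sum>j\<in>UNIV. q $ j $ j) = 0}"

definition L2_sym :: "(real^'n::finite) set \<Rightarrow> (real^'n \<Rightarrow> real^'n^'n) set" where
  "L2_sym \<Omega> = {\<tau>. square_integrable (lebesgue_on \<Omega>) \<tau> \<and> (AE x in lebesgue_on \<Omega>. \<tau> x \<in> sym_mat)}"

text \<open>Near every boundary point the domain is, after a rotation (\<open>e\<close> is the vertical direction
  and \<open>y - (y \<bullet> e) *\<^sub>R e\<close> the horizontal part of \<open>y\<close>), the set above the graph of a Lipschitz
  function.\<close>

definition lipschitz_domain :: "(real^'n::finite) set \<Rightarrow> bool" where
  "lipschitz_domain \<Omega> \<longleftrightarrow> open \<Omega> \<and> connected \<Omega> \<and> \<Omega> \<noteq> {} \<and>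
     (\<forall>x\<in>frontier \<Omega>. \<exists>U e L \<phi>.
        open U \<and> x \<in> U \<and> norm e = 1 \<and> L-lipschitz_on {y. y \<bullet> e = 0} \<phi> \<and>
        \<Omega> \<inter> U = {y \<in> U. \<phi> (y - (y \<bullet> e) *\<^sub>R e) < y \<bullet> e})"

text \<open>Weak gradients are tested with continuously differentiable functions of compact support in
  \<open>\<Omega>\<close>. The rows of \<open>G\<close> are the gradients of the components of \<open>v\<close>.\<close>

definition test_function :: "(real^'n::finite) set \<Rightarrow> (real^'n \<Rightarrow> real) \<Rightarrow> (real^'n \<Rightarrow> real^'n) \<Rightarrow> bool" where
  "test_function \<Omega> \<phi> D \<longleftrightarrow> (\<forall>x. GDERIV \<phi> x :> D x) \<and> continuous_on UNIV D \<and>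
     (\<exists>K. compact K \<and> K \<subseteq> \<Omega> \<and> (\<forall>x. x \<notin> K \<longrightarrow> \<phi> x = 0))"

definition weak_gradient ::
  "(real^'n::finite) set \<Rightarrow> (real^'n \<Rightarrow> real^'n) \<Rightarrow> (real^'n \<Rightarrow> real^'n^'n) \<Rightarrow> bool" where
  "weak_gradient \<Omega> v G \<longleftrightarrow>
     (\<forall>\<phi> D. test_function \<Omega> \<phi> D \<longrightarrow>
        (\<forall>i j. (\<integral>x. v x $ i * D x $ j \<partial>lebesgue_on \<Omega>) = - (\<integral>x. G x $ i $ j * \<phi> x \<partial>lebesgue_on \<Omega>)))"

definition H1 :: "(real^'n::finite) set \<Rightarrow> (real^'n \<Rightarrow> real^'n) set" where
  "H1 \<Omega> = {v. square_integrable (lebesgue_on \<Omega>) v \<and>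
               (\<exists>G. square_integrable (lebesgue_on \<Omega>) G \<and> weak_gradient \<Omega> v G)}"

definition weak_grad :: "(real^'n::finite) set \<Rightarrow> (real^'n \<Rightarrow> real^'n) \<Rightarrow> real^'n \<Rightarrow> real^'n^'n" where
  "weak_grad \<Omega> v = (SOME G. square_integrable (lebesgue_on \<Omega>) G \<and> weak_gradient \<Omega> v G)"

text \<open>The trace operator is the continuous extension to \<^term>\<open>H1 \<Omega>\<close> of the restriction of
  continuously differentiable functions to the boundary.\<close>

definition has_trace ::
  "(real^'n::finite) set \<Rightarrow> (real^'n \<Rightarrow> real^'n) \<Rightarrow> (real^'n \<Rightarrow> real^'n) \<Rightarrow> bool" where
  "has_trace \<Omega> v h \<longleftrightarrow>
     square_integrable (restrict_space surface_measure (frontier \<Omega>)) h \<and>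
     (\<exists>\<phi> D. (\<forall>k x. (\<phi> k has_derivative (\<lambda>y. D k x *v y)) (at x)) \<and>
            (\<forall>k. continuous_on UNIV (D k)) \<and>
            (\<lambda>k::nat. L2_norm (lebesgue_on \<Omega>) (\<lambda>x. \<phi> k x - v x)) \<longlonglongrightarrow> 0 \<and>
            (\<lambda>k. L2_norm (lebesgue_on \<Omega>) (\<lambda>x. D k x - weak_grad \<Omega> v x)) \<longlonglongrightarrow> 0 \<and>
            (\<lambda>k. L2_norm (restrict_space surface_measure (frontier \<Omega>)) (\<lambda>x. \<phi> k x - h x)) \<longlonglongrightarrow> 0)"

definition trace_of :: "(real^'n::finite) set \<Rightarrow> (real^'n \<Rightarrow> real^'n) \<Rightarrow> real^'n \<Rightarrow> real^'n" where
  "trace_of \<Omega> v = (SOME h. has_trace \<Omega> v h)"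


section \<open>The variational inequality of elastoplasticity\<close>

text \<open>A triple consists of displacement, plastic strain and internal variable.\<close>

type_synonym 'n state = "(real^'n \<Rightarrow> real^'n) \<times> (real^'n \<Rightarrow> real^'n^'n) \<times> (real^'n \<Rightarrow> real)"

definition isotropic :: "(real^'n::finite^'n \<Rightarrow> real^'n^'n) \<Rightarrow> bool" where
  "isotropic \<C> \<longleftrightarrow> (\<forall>R. orthogonal_matrix R \<longrightarrow>
     (\<forall>\<tau>\<in>sym_mat. \<C> (R ** \<tau> ** transpose R) = R ** \<C> \<tau> ** transpose R))"

definition symmetric_tensor :: "(real^'n::finite^'n \<Rightarrow> real^'n^'n) \<Rightarrow> bool" where
  "symmetric_tensor \<C> \<longleftrightarrow> linear \<C> \<and> (\<forall>\<tau>\<in>sym_mat. \<C> \<tau> \<in> sym_mat) \<and>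
     (\<forall>\<tau>\<in>sym_mat. \<forall>\<mu>\<in>sym_mat. \<C> \<tau> \<bullet> \<mu> = \<tau> \<bullet> \<C> \<mu>)"

definition coercive_tensor ::
  "(real^'n::finite) set \<Rightarrow> real \<Rightarrow> (real^'n \<Rightarrow> real^'n^'n \<Rightarrow> real^'n^'n) \<Rightarrow> bool" where
  "coercive_tensor \<Omega> \<kappa> A \<longleftrightarrow>
     (\<forall>\<tau>\<in>L2_sym \<Omega>. AE x in lebesgue_on \<Omega>. \<kappa> * (norm (\<tau> x))\<^sup>2 \<le> A x (\<tau> x) \<bullet> \<tau> x)"

definition space_V :: "(real^'n::finite) set \<Rightarrow> (real^'n) set \<Rightarrow> (real^'n \<Rightarrow> real^'n) set" where
  "space_V \<Omega> \<Gamma>D = {v \<in> H1 \<Omega>. AE x in restrict_space surface_measure \<Gamma>D. trace_of \<Omega> v x = 0}"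

definition space_Q :: "(real^'n::finite) set \<Rightarrow> (real^'n \<Rightarrow> real^'n^'n) set" where
  "space_Q \<Omega> = {q. square_integrable (lebesgue_on \<Omega>) q \<and> (AE x in lebesgue_on \<Omega>. q x \<in> sym_mat0)}"

definition space_M :: "(real^'n::finite) set \<Rightarrow> (real^'n \<Rightarrow> real) set" where
  "space_M \<Omega> = {\<beta>. square_integrable (lebesgue_on \<Omega>) \<beta>}"

definition strain :: "(real^'n::finite) set \<Rightarrow> (real^'n \<Rightarrow> real^'n) \<Rightarrow> real^'n \<Rightarrow> real^'n^'n" where
  "strain \<Omega> v x = (1/2) *\<^sub>R (weak_grad \<Omega> v x + transpose (weak_grad \<Omega> v x))"

definition stress ::
  "(real^'n::finite) set \<Rightarrow> (real^'n^'n \<Rightarrow> real^'n^'n) \<Rightarrow> 'n state \<Rightarrow> real^'n \<Rightarrow> real^'n^'n" where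
  "stress \<Omega> \<C> = (\<lambda>(v, q, \<beta>) x. \<C> (strain \<Omega> v x - q x))"

definition form_a ::
  "(real^'n::finite) set \<Rightarrow> (real^'n^'n \<Rightarrow> real^'n^'n) \<Rightarrow> (real^'n \<Rightarrow> real^'n^'n \<Rightarrow> real^'n^'n) \<Rightarrow> real
    \<Rightarrow> 'n state \<Rightarrow> 'n state \<Rightarrow> real" where
  "form_a \<Omega> \<C> \<H> H = (\<lambda>(w, p, \<alpha>) (v, q, \<beta>).
     L2_inner (lebesgue_on \<Omega>) (stress \<Omega> \<C> (w, p, \<alpha>)) (\<lambda>x. strain \<Omega> v x - q x)
     + L2_inner (lebesgue_on \<Omega>) (\<lambda>x. \<H> x (p x)) q
     + L2_inner (lebesgue_on \<Omega>) (\<lambda>x. H * \<alpha> x) \<beta>)"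

definition load_b ::
  "(real^'n::finite) set \<Rightarrow> (real^'n) set \<Rightarrow> (real^'n \<Rightarrow> real^'n) \<Rightarrow> (real^'n \<Rightarrow> real^'n)
    \<Rightarrow> 'n state \<Rightarrow> real" where
  "load_b \<Omega> \<Gamma>D f g = (\<lambda>(v, q, \<beta>).
     L2_inner (lebesgue_on \<Omega>) f v
     + L2_inner (restrict_space surface_measure (frontier \<Omega> - \<Gamma>D)) g (trace_of \<Omega> v))"

definition dissipation :: "real \<Rightarrow> real^'n::finite^'n \<Rightarrow> real \<Rightarrow> ennreal" where
  "dissipation \<sigma>y q \<beta> = (if norm q \<le> \<beta> then ennreal (\<sigma>y * norm q) else \<infinity>)"

definition functional_psi :: "(real^'n::finite) set \<Rightarrow> real \<Rightarrow> 'n state \<Rightarrow> ennreal" where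
  "functional_psi \<Omega> \<sigma>y = (\<lambda>(v, q, \<beta>). \<integral>\<^sup>+x. dissipation \<sigma>y (q x) (\<beta> x) \<partial>lebesgue_on \<Omega>)"


section \<open>Meshes and newest vertex bisection\<close>

text \<open>A tagged simplex \<open>(xs, \<gamma>)\<close> is the list of the vertices of an element together with its
  type. The reference edge joins the first and the last vertex. The tags of the children
  are given by the rule of Maubach and Traxler in the formulation of Stevenson; in the plane
  the type and the order of the remaining vertices have no influence on the bisection.\<close>

type_synonym 'n tagged = "(real^'n) list \<times> nat"

definition element :: "'n::finite tagged \<Rightarrow> (real^'n) set" where
  "element t = convex hull (set (fst t))"

abbreviation elements :: "'n::finite tagged set \<Rightarrow> (real^'n) set set" where
  "elements \<T> \<equiv> element ` \<T>"

definition tagged_simplex :: "'n::finite tagged \<Rightarrow> bool" where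
  "tagged_simplex t \<longleftrightarrow> length (fst t) = CARD('n) + 1 \<and> distinct (fst t) \<and>
     \<not> affine_dependent (set (fst t)) \<and> snd t < CARD('n)"

definition mesh :: "(real^'n::finite) set \<Rightarrow> 'n tagged set \<Rightarrow> bool" where
  "mesh \<Omega> \<T> \<longleftrightarrow> (\<forall>t\<in>\<T>. tagged_simplex t) \<and> inj_on element \<T> \<and>
     triangulation (elements \<T>) \<and> \<Union>(elements \<T>) = closure \<Omega>"

definition children :: "'n::finite tagged \<Rightarrow> 'n tagged set" where
  "children = (\<lambda>(xs, \<gamma>).
     let a = hd xs; b = last xs; ys = butlast (tl xs); \<gamma>' = (\<gamma> + 1) mod CARD('n)
     in {(a # midpoint a b # ys, \<gamma>'),
         (b # midpoint a b # take \<gamma> ys @ rev (drop \<gamma> ys), \<gamma>')})"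

definition bisect :: "'n::finite tagged set \<Rightarrow> 'n tagged set \<Rightarrow> 'n tagged set" where
  "bisect \<M> \<T> = (\<T> - \<M>) \<union> \<Union>(children ` \<M>)"

definition with_hanging_node :: "'n::finite tagged set \<Rightarrow> 'n tagged set" where
  "with_hanging_node \<T> = {t \<in> \<T>. \<exists>s\<in>\<T>. \<exists>v\<in>set (fst s). \<exists>a\<in>set (fst t). \<exists>b\<in>set (fst t).
     v \<in> open_segment a b}"

text \<open>\<open>nvb \<Omega> \<T> \<M> \<T>'\<close>: the refinement procedure for \<open>\<T>\<close> and \<open>\<M>\<close> terminates and yields
  the mesh \<open>\<T>'\<close>. Once there are no hanging nodes the iterated map is the identity, so the number
  \<open>k\<close> of steps is immaterial. In the plane the absence of hanging nodes makes \<open>\<T>'\<close> conforming;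
  in space, for unsuitable tags of the initial mesh, two elements may cut a common face along
  crossing lines without a hanging node, and such a result is not a mesh.\<close>

definition nvb :: "(real^'n::finite) set \<Rightarrow> 'n tagged set \<Rightarrow> 'n tagged set \<Rightarrow> 'n tagged set \<Rightarrow> bool" where
  "nvb \<Omega> \<T> \<M> \<T>' \<longleftrightarrow>
     (\<exists>k::nat. \<T>' = ((\<lambda>\<S>. bisect (with_hanging_node \<S>) \<S>) ^^ k) (bisect \<M> \<T>)) \<and>
     with_hanging_node \<T>' = {} \<and> mesh \<Omega> \<T>'"

definition refinements :: "(real^'n::finite) set \<Rightarrow> 'n tagged set \<Rightarrow> 'n tagged set set" where
  "refinements \<Omega> \<T> = {\<T>'. (\<lambda>\<S> \<S>'. \<exists>\<M>\<subseteq>\<S>. nvb \<Omega> \<S> \<M> \<S>')\<^sup>*\<^sup>* \<T> \<T>'}"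

definition inradius :: "(real^'n::finite) set \<Rightarrow> real" where
  "inradius T = Sup {r. 0 \<le> r \<and> (\<exists>x. cball x r \<subseteq> T)}"


section \<open>The discrete problem\<close>

text \<open>Here and below a mesh enters only through its set \<open>\<K>\<close> of elements. Neighbouring elements
  overlap in a null set, so being affine or constant on an element is meant almost everywhere.\<close>

definition space_X :: "(real^'n::finite) set \<Rightarrow> (real^'n) set \<Rightarrow> (real^'n) set set \<Rightarrow> 'n state set" where
  "space_X \<Omega> \<Gamma>D \<K> =
     {v \<in> space_V \<Omega> \<Gamma>D. \<forall>T\<in>\<K>. \<exists>A b. AE x in lebesgue_on T. v x = A *v x + b} \<times>
     {q \<in> space_Q \<Omega>. \<forall>T\<in>\<K>. \<exists>c\<in>sym_mat0. AE x in lebesgue_on T. q x = c} \<times>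
     {\<beta> \<in> space_M \<Omega>. \<forall>T\<in>\<K>. \<exists>c. AE x in lebesgue_on T. \<beta> x = c}"

text \<open>The value \<open>\<infinity>\<close> of the functional is treated in \<^typ>\<open>ereal\<close>, where \<open>\<infinity> - \<infinity> = \<infinity>\<close>. The choice
  \<open>z = 0\<close> forces the functional to be finite at a solution, so the difference is then never
  of this form.\<close>

definition discrete_solution ::
  "(real^'n::finite) set \<Rightarrow> (real^'n) set \<Rightarrow> (real^'n \<Rightarrow> real^'n) \<Rightarrow> (real^'n \<Rightarrow> real^'n)
    \<Rightarrow> (real^'n^'n \<Rightarrow> real^'n^'n) \<Rightarrow> (real^'n \<Rightarrow> real^'n^'n \<Rightarrow> real^'n^'n) \<Rightarrow> real \<Rightarrow> real
    \<Rightarrow> (real^'n) set set \<Rightarrow> 'n state \<Rightarrow> bool" where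
  "discrete_solution \<Omega> \<Gamma>D f g \<C> \<H> H \<sigma>y \<K> U \<longleftrightarrow> U \<in> space_X \<Omega> \<Gamma>D \<K> \<and>
     (\<forall>z\<in>space_X \<Omega> \<Gamma>D \<K>.
        ereal (load_b \<Omega> \<Gamma>D f g (z - U))
        \<le> ereal (form_a \<Omega> \<C> \<H> H U (z - U))
            + enn2ereal (functional_psi \<Omega> \<sigma>y z) - enn2ereal (functional_psi \<Omega> \<sigma>y U))"


section \<open>Error measure and indicators\<close>

definition stress_dist ::
  "(real^'n::finite) set \<Rightarrow> (real^'n^'n \<Rightarrow> real^'n^'n) \<Rightarrow> 'n state \<Rightarrow> 'n state \<Rightarrow> real" where
  "stress_dist \<Omega> \<C> z z' = L2_norm (lebesgue_on \<Omega>) (\<lambda>x. stress \<Omega> \<C> z x - stress \<Omega> \<C> z' x)"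

definition outer_normal :: "(real^'n::finite) set \<Rightarrow> (real^'n) set \<Rightarrow> real^'n \<Rightarrow> bool" where
  "outer_normal T E \<nu> \<longleftrightarrow> norm \<nu> = 1 \<and> (\<forall>x\<in>E. \<forall>y\<in>T. \<nu> \<bullet> (y - x) \<le> 0)"

text \<open>On a boundary facet this is the outer unit normal, on an interior facet one of the two unit
  normals.\<close>

definition facet_normal :: "(real^'n::finite) set set \<Rightarrow> (real^'n) set \<Rightarrow> real^'n" where
  "facet_normal \<K> E = (SOME \<nu>. \<exists>T\<in>\<K>. E facet_of T \<and> outer_normal T E \<nu>)"

definition elem_value :: "(real^'n::finite) set \<Rightarrow> (real^'n \<Rightarrow> 'b) \<Rightarrow> 'b" where
  "elem_value T \<tau> = (THE c. AE x in lebesgue_on T. \<tau> x = c)"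

definition side :: "(real^'n::finite) set set \<Rightarrow> (real^'n) set \<Rightarrow> real^'n \<Rightarrow> (real^'n) set" where
  "side \<K> E \<nu> = (THE T. T \<in> \<K> \<and> E facet_of T \<and> outer_normal T E \<nu>)"

definition jump ::
  "(real^'n::finite) set set \<Rightarrow> (real^'n) set \<Rightarrow> (real^'n \<Rightarrow> real^'n^'n) \<Rightarrow> real^'n^'n" where
  "jump \<K> E \<tau> = elem_value (side \<K> E (facet_normal \<K> E)) \<tau>
              - elem_value (side \<K> E (- facet_normal \<K> E)) \<tau>"

text \<open>\<open>\<Gamma>\<^sub>N\<close> is \<open>frontier \<Omega> - \<Gamma>D\<close>, so for a boundary facet \<open>E\<close> the set \<open>E - \<Gamma>D\<close> is \<open>E \<inter> \<Gamma>\<^sub>N\<close>; it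
  differs from \<open>E\<close> by a null set if the mesh resolves the splitting of the boundary.\<close>

definition facet_residual ::
  "(real^'n::finite) set \<Rightarrow> (real^'n) set \<Rightarrow> (real^'n \<Rightarrow> real^'n) \<Rightarrow> (real^'n^'n \<Rightarrow> real^'n^'n)
    \<Rightarrow> (real^'n) set set \<Rightarrow> 'n state \<Rightarrow> (real^'n) set \<Rightarrow> real" where
  "facet_residual \<Omega> \<Gamma>D g \<C> \<K> z E =
     (if \<not> E \<subseteq> frontier \<Omega> then
        L2_norm (restrict_space surface_measure E)
          (\<lambda>x. jump \<K> E (stress \<Omega> \<C> z) *v facet_normal \<K> E)
      else if E \<subseteq> \<Gamma>D then 0
      else
        L2_norm (restrict_space surface_measure (E - \<Gamma>D))
          (\<lambda>x. g x - elem_value (side \<K> E (facet_normal \<K> E)) (stress \<Omega> \<C> z) *v facet_normal \<K> E))"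

definition eta ::
  "(real^'n::finite) set \<Rightarrow> (real^'n) set \<Rightarrow> (real^'n \<Rightarrow> real^'n) \<Rightarrow> (real^'n \<Rightarrow> real^'n)
    \<Rightarrow> (real^'n^'n \<Rightarrow> real^'n^'n) \<Rightarrow> (real^'n) set set \<Rightarrow> 'n state \<Rightarrow> (real^'n) set \<Rightarrow> real" where
  "eta \<Omega> \<Gamma>D f g \<C> \<K> z T = sqrt
     (measure lebesgue T * (L2_norm (lebesgue_on T) f)\<^sup>2
      + sqrt (measure lebesgue T) * (\<Sum>E | E facet_of T. (facet_residual \<Omega> \<Gamma>D g \<C> \<K> z E)\<^sup>2))"

end

theory Submission
  imports Defs
begin

text \<open>The sum over the new elements changes for two reasons, the refinement of the mesh and the change of
the discrete solution, and these are treated one after the other.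

Suppose first that the coarse solution \<open>U\<close> is kept. An element \<open>T'\<close> of the fine mesh that is not
in the coarse mesh comes from an element \<open>T\<close> that is not in the fine mesh, and its volume
is at most \<open>q\<close> times the volume of \<open>T\<close> with a fixed \<open>q < 1\<close> (\<open>bisected_simplex\<close>). The stress of
\<open>U\<close> is constant on \<open>T\<close>, so a facet of \<open>T'\<close> across which both neighbours stem from \<open>T\<close> carries no
jump. Every other facet of \<open>T'\<close> lies in a facet \<open>E\<close> of \<open>T\<close>, with the same normal and the same
integrand in the residual (\<open>descendant_facet_residual\<close>). As the pieces of \<open>E\<close> overlap only in sets of
surface measure zero (\<open>descendant_facets_overlap_null\<close>), the residuals of the descendants of \<open>T\<close> sum
to at most the residuals of \<open>T\<close>, and the same holds for the volume terms. Only the weights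
\<open>|T'| \<le> q |T|\<close> and \<open>sqrt |T'| \<le> sqrt q sqrt |T|\<close> remain, and they give the factor \<open>sqrt q\<close>
(\<open>eta_reduction_fixed_state\<close>).

On the fine mesh \<open>U\<close> is then replaced by the fine solution \<open>U'\<close>. Both stresses are constant on the
fine elements, and by the inequality of Young the squared residual on a facet grows at most by the factor
\<open>1 + \<delta>\<close> and by a multiple of the squared stress differences on the adjacent elements times the
surface measure of the facet. Shape regularity bounds \<open>sqrt |T|\<close> times that surface measure by the volume of
any element at the facet (\<open>facet_scaling\<close>), so that all these terms add up to a multiple of the squared
distance of the stresses (\<open>eta_perturbation\<close>). Taking \<open>\<delta>\<close> with \<open>(1 + \<delta>) sqrt q < 1\<close> ends the proof.

Two facts underlie these arguments. The stress of a discrete state is defined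
through a weak gradient, and it has to be shown that this gradient is almost everywhere the matrix of
the affine function on the element (\<open>weak_gradient_affine\<close>). And jumps and normals are defined by
choice and description, so they make sense only because an interior facet belongs to exactly two
elements, which lie on opposite sides, and a boundary facet to exactly one
(\<open>interior_facet_shared\<close>, \<open>shared_facet_normals\<close>, \<open>shared_facet_not_boundary\<close>); here it is used that a
Lipschitz domain is the interior of its closure.\<close>

abbreviation volume :: "'a::euclidean_space set \<Rightarrow> real" where
  "volume \<equiv> measure lebesgue"

abbreviation area :: "(real^'n::finite) set \<Rightarrow> real" where
  "area \<equiv> measure surface_measure"

section \<open>Simplices seen from a facet\<close>

text \<open>The position of a simplex \<open>T\<close> relative to its facet \<open>E\<close>: \<open>\<nu>\<close> is the outer unit normal, \<open>b\<close> the
height of the hyperplane of \<open>E\<close>, and the remaining vertex, which lies strictly below, spans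
\<open>T\<close> together with \<open>E\<close>.\<close>
definition facet_frame :: "'a::euclidean_space set \<Rightarrow> 'a set \<Rightarrow> 'a \<Rightarrow> real \<Rightarrow> bool" where
  "facet_frame T E \<nu> b \<longleftrightarrow> norm \<nu> = 1 \<and> affine hull E = {x. \<nu> \<bullet> x = b} \<and>
     (\<exists>v\<in>T. \<nu> \<bullet> v < b \<and> T = convex hull (insert v E))"

text \<open>The affine function \<open>x \<mapsto> \<nu> \<bullet> x - \<beta>\<close> is the barycentric coordinate of the vertex \<open>b\<close>.\<close>
lemma vertex_functional:
  fixes S :: "'a::euclidean_space set"
  assumes S: "\<not> affine_dependent S" "card S = DIM('a) + 1" and b: "b \<in> S"
  obtains \<nu> \<beta> where "\<nu> \<noteq> 0" "\<nu> \<bullet> b = \<beta> + 1" "affine hull (S - {b}) = {x. \<nu> \<bullet> x = \<beta>}"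
proof -
  have ind: "\<not> affine_dependent (S - {b})" using S(1) by (meson Diff_subset affine_dependent_subset)
  have "aff_dim (S - {b}) = int (card (S - {b})) - 1" using ind by (simp add: aff_dim_affine_independent)
  also have "card (S - {b}) = DIM('a)" using S b by simp
  finally obtain a c where ac: "a \<noteq> 0" "affine hull (S - {b}) = {x. a \<bullet> x = c}"
    using aff_dim_eq_hyperplane[of "S - {b}"] by auto
  have "b \<notin> affine hull (S - {b})" using S(1) b by (auto simp: affine_dependent_def)
  then have ne: "a \<bullet> b - c \<noteq> 0" using ac by auto
  show thesis
    by (rule that[of "(1 / (a \<bullet> b - c)) *\<^sub>R a" "c / (a \<bullet> b - c)"])
      (use ac ne in \<open>simp_all add: diff_divide_distrib [symmetric] field_simps\<close>)
qed

lemma simplex_facet_frame: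
  fixes T :: "'a::euclidean_space set"
  assumes T: "DIM('a) simplex T" and E: "E facet_of T"
  obtains \<nu> b where "facet_frame T E \<nu> b"
proof -
  obtain S where S: "\<not> affine_dependent S" "int (card S) = int (DIM('a)) + 1" "T = convex hull S"
    using T by (auto simp: simplex_def)
  have "E \<noteq> {} \<and> (\<exists>u. u \<in> S \<and> E = convex hull (S - {u}))"
    using E S(3) facet_of_convex_hull_affine_independent[OF S(1), of E] by blast
  then obtain u where u: "u \<in> S" "E = convex hull (S - {u})" by blast
  obtain a b where ab: "a \<noteq> 0" "a \<bullet> u = b + 1" "affine hull E = {x. a \<bullet> x = b}"
    using vertex_functional[OF S(1) _ u(1)] S(2) by (auto simp: u(2))
  have hull: "T = convex hull (insert u E)"
  proof -
    have "S = insert u (S - {u})" using u(1) by auto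
    then show ?thesis unfolding S(3) u(2)
      by (metis hull_Un_right insert_is_Un)
  qed
  have uT: "u \<in> T" unfolding hull by (simp add: hull_inc)
  have "facet_frame T E ((- 1 / norm a) *\<^sub>R a) (- b / norm a)"
    unfolding facet_frame_def
  proof (intro conjI bexI[OF _ uT] hull)
    show "norm ((- 1 / norm a) *\<^sub>R a) = 1" using ab by simp
  qed (use ab in \<open>auto simp: field_simps\<close>)
  then show thesis by (rule that)
qed

lemma facet_frame_le:
  assumes "facet_frame T E \<nu> b" "y \<in> T" shows "\<nu> \<bullet> y \<le> b"
proof -
  obtain v where v: "\<nu> \<bullet> v < b" "T = convex hull (insert v E)" and E: "affine hull E = {x. \<nu> \<bullet> x = b}"
    using assms by (auto simp: facet_frame_def)
  have "insert v E \<subseteq> {x. \<nu> \<bullet> x \<le> b}"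
    using v E hull_subset[of E affine] by auto
  then have "convex hull (insert v E) \<subseteq> {x. \<nu> \<bullet> x \<le> b}"
    by (rule hull_minimal) (rule convex_halfspace_le)
  then show ?thesis using assms v by auto
qed

lemma facet_frame_eq:
  assumes "facet_frame T E \<nu> b" "y \<in> E" shows "\<nu> \<bullet> y = b"
  using assms hull_subset[of E affine] by (auto simp: facet_frame_def)

text \<open>A vector that satisfies the inequalities of \<^const>\<open>outer_normal\<close> is constant on \<open>E\<close>, hence
orthogonal to the hyperplane spanned by \<open>E\<close>, hence a multiple of \<open>\<nu>\<close>; the vertex
opposite to \<open>E\<close> decides the sign.\<close>
lemma outer_normal_iff:
  fixes T :: "(real^'n::finite) set"
  assumes fr: "facet_frame T E \<nu> b"
  shows "outer_normal T E \<nu>' \<longleftrightarrow> \<nu>' = \<nu>"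
proof
  assume "\<nu>' = \<nu>"
  then show "outer_normal T E \<nu>'"
    using facet_frame_le[OF fr] facet_frame_eq[OF fr] fr
    by (auto simp: outer_normal_def facet_frame_def inner_diff_right)
next
  assume o: "outer_normal T E \<nu>'"
  obtain v where v: "v \<in> T" "\<nu> \<bullet> v < b" and hull: "T = convex hull (insert v E)"
    and E: "affine hull E = {x. \<nu> \<bullet> x = b}" and n: "norm \<nu> = 1"
    using fr by (auto simp: facet_frame_def)
  have ET: "E \<subseteq> T" unfolding hull using hull_subset[of "insert v E" convex] by blast
  have nn: "\<nu> \<bullet> \<nu> = 1" using n by (simp add: dot_square_norm)
  have "E \<noteq> {}"
  proof
    assume "E = {}"
    then have "b *\<^sub>R \<nu> \<notin> affine hull E" by simp
    then show False using E nn by simp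
  qed
  then obtain x where x: "x \<in> E" by auto
  define c where "c = \<nu>' \<bullet> x"
  have "\<nu>' \<bullet> y = c" if "y \<in> E" for y
  proof -
    have "\<nu>' \<bullet> (y - x) \<le> 0" "\<nu>' \<bullet> (x - y) \<le> 0"
      using o x that ET unfolding outer_normal_def by blast+
    then show ?thesis by (simp add: c_def inner_diff_right)
  qed
  then have "E \<subseteq> {y. \<nu>' \<bullet> y = c}" by auto
  then have aff: "affine hull E \<subseteq> {y. \<nu>' \<bullet> y = c}" by (rule hull_minimal) (rule affine_hyperplane)
  define w where "w = \<nu>' - (\<nu>' \<bullet> \<nu>) *\<^sub>R \<nu>"
  have "\<nu> \<bullet> w = 0" by (simp add: w_def inner_diff_right nn inner_commute)
  have "x + w \<in> affine hull E" using facet_frame_eq[OF fr x] \<open>\<nu> \<bullet> w = 0\<close>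
    by (simp add: E inner_add_right)
  then have "\<nu>' \<bullet> w = 0" using aff by (auto simp: inner_add_right c_def)
  with \<open>\<nu> \<bullet> w = 0\<close> have "w \<bullet> w = 0"
    by (subst (1) w_def) (simp add: inner_diff_left)
  then have eq: "\<nu>' = (\<nu>' \<bullet> \<nu>) *\<^sub>R \<nu>" by (simp add: w_def)
  have "norm \<nu>' = 1" using o by (simp add: outer_normal_def)
  then have "\<bar>\<nu>' \<bullet> \<nu>\<bar> = 1" using eq n by (metis mult.right_neutral norm_scaleR)
  moreover have "\<nu>' \<bullet> (v - x) \<le> 0" using o x v by (auto simp: outer_normal_def)
  moreover have "\<nu>' \<bullet> (v - x) = (\<nu>' \<bullet> \<nu>) * (\<nu> \<bullet> (v - x))" by (subst eq) simp
  moreover have "\<nu> \<bullet> (v - x) < 0" using v facet_frame_eq[OF fr x] by (simp add: inner_diff_right)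
  ultimately have "\<nu>' \<bullet> \<nu> = 1" by (cases "\<nu>' \<bullet> \<nu> \<ge> 0") auto
  then show "\<nu>' = \<nu>" using eq by simp
qed

text \<open>Projecting from the opposite vertex \<open>v\<close> onto the hyperplane of \<open>E\<close> moves points near \<open>y\<close> only a little,
so they land in \<open>E\<close>. A point below the hyperplane lies on the segment from \<open>v\<close> to its projection.\<close>
lemma simplex_contains_half_ball:
  fixes T :: "'a::euclidean_space set"
  assumes fr: "facet_frame T E \<nu> b" and E: "convex E" and y: "y \<in> rel_interior E"
  shows "\<forall>\<^sub>F z in nhds y. \<nu> \<bullet> z \<le> b \<longrightarrow> z \<in> T"
proof -
  obtain v where v: "v \<in> T" "\<nu> \<bullet> v < b" and hull: "T = convex hull (insert v E)"
    and aff: "affine hull E = {x. \<nu> \<bullet> x = b}"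
    using fr by (auto simp: facet_frame_def)
  have yE: "y \<in> E" using y rel_interior_subset by blast
  note yb = facet_frame_eq[OF fr yE]
  obtain e where e: "e > 0" "ball y e \<inter> affine hull E \<subseteq> E"
    using y by (auto simp: mem_rel_interior_ball)
  \<comment> \<open>\<open>w z\<close> is the projection of \<open>z\<close> from \<open>v\<close> onto the hyperplane, and \<open>z = (1 - t z) w z + t z v\<close>\<close>
  define t where "t = (\<lambda>z. (b - \<nu> \<bullet> z) / (b - \<nu> \<bullet> v))"
  define w where "w = (\<lambda>z. (1 / (1 - t z)) *\<^sub>R (z - t z *\<^sub>R v))"
  have t0: "t y = 0" "w y = y" by (auto simp: t_def yb w_def)
  have ct: "isCont t y" unfolding t_def using v by (intro continuous_intros) auto
  then have cw: "isCont w y" unfolding w_def using t0 by (intro continuous_intros) auto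
  have "\<forall>\<^sub>F z in nhds y. t z < 1"
    using order_tendstoD(2)[OF tendsto_at_iff_tendsto_nhds[THEN iffD1, OF ct[unfolded isCont_def]], of 1] t0 by simp
  moreover have "\<forall>\<^sub>F z in nhds y. w z \<in> ball y e"
    using tendsto_at_iff_tendsto_nhds[THEN iffD1, OF cw[unfolded isCont_def]] e t0
    by (intro topological_tendstoD) auto
  ultimately show ?thesis
  proof eventually_elim
    case (elim z)
    show ?case
    proof
      assume zb: "\<nu> \<bullet> z \<le> b"
      then have tz: "0 \<le> t z" using v by (simp add: t_def)
      have vz: "t z * (b - \<nu> \<bullet> v) = b - \<nu> \<bullet> z" using v by (simp add: t_def)
      have "\<nu> \<bullet> w z = (\<nu> \<bullet> z - t z * (\<nu> \<bullet> v)) / (1 - t z)"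
        by (simp add: w_def inner_diff_right)
      also have "\<nu> \<bullet> z - t z * (\<nu> \<bullet> v) = b * (1 - t z)" using vz by (simp add: algebra_simps)
      also have "\<dots> / (1 - t z) = b" using elim by simp
      finally have "w z \<in> E" using e elim by (auto simp: aff)
      moreover have "z = (1 - t z) *\<^sub>R w z + t z *\<^sub>R v" using elim by (simp add: w_def)
      ultimately show "z \<in> T"
        using convexD_alt[OF convex_convex_hull, of "w z" "insert v E" v "t z"] tz elim
        by (simp add: hull hull_inc)
    qed
  qed
qed

text \<open>Two simplices on the same side of a common facet share a half ball. In a conforming mesh this
is excluded, so neighbours lie on opposite sides.\<close>
lemma facets_same_side_overlap:
  fixes T1 T2 :: "'a::euclidean_space set"
  assumes fr: "facet_frame T1 E \<nu> b" "facet_frame T2 E \<nu> b" and E: "convex E" "E \<noteq> {}"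
  shows "interior (T1 \<inter> T2) \<noteq> {}"
proof -
  obtain y where y: "y \<in> rel_interior E" using E rel_interior_eq_empty by blast
  have "\<forall>\<^sub>F z in nhds y. \<nu> \<bullet> z \<le> b \<longrightarrow> z \<in> T1 \<inter> T2"
    using simplex_contains_half_ball[OF fr(1) E(1) y] simplex_contains_half_ball[OF fr(2) E(1) y]
    by eventually_elim auto
  then obtain e where e: "e > 0" "\<And>z. dist z y < e \<Longrightarrow> \<nu> \<bullet> z \<le> b \<Longrightarrow> z \<in> T1 \<inter> T2"
    unfolding eventually_nhds_metric by auto
  have sub: "ball y e \<inter> {z. \<nu> \<bullet> z < b} \<subseteq> T1 \<inter> T2"
    using e(2) by (force simp: dist_commute)
  have op: "open (ball y e \<inter> {z. \<nu> \<bullet> z < b})" by (intro open_Int open_ball open_halfspace_lt)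
  have nn: "norm \<nu> = 1" using fr by (simp add: facet_frame_def)
  have "y - (e/2) *\<^sub>R \<nu> \<in> ball y e \<inter> {z. \<nu> \<bullet> z < b}"
    using e(1) nn facet_frame_eq[OF fr(1), of y] y rel_interior_subset[of E]
    by (auto simp: dist_norm inner_diff_right dot_square_norm)
  then show ?thesis using interior_maximal[OF sub op] by blast
qed

text \<open>Two simplices on opposite sides of a common facet contribute the two halves of a ball around each point of
its relative interior.\<close>
lemma facets_opposite_sides_interior:
  fixes T1 T2 :: "'a::euclidean_space set"
  assumes fr: "facet_frame T1 E \<nu> b" "facet_frame T2 E (-\<nu>) (-b)" and E: "convex E"
  shows "rel_interior E \<subseteq> interior (T1 \<union> T2)"
proof
  fix y assume y: "y \<in> rel_interior E"
  have "\<forall>\<^sub>F z in nhds y. z \<in> T1 \<union> T2"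
    using simplex_contains_half_ball[OF fr(1) E(1) y] simplex_contains_half_ball[OF fr(2) E(1) y]
    by eventually_elim auto
  then show "y \<in> interior (T1 \<union> T2)" by (simp add: eventually_nhds_in_nhd interior_def eventually_nhds)
      blast
qed

text \<open>Take the diameter of the ball in a direction parallel to \<open>E\<close>. Its end points lie on segments from
the opposite vertex to points of \<open>E\<close>, at the same height and therefore with the same parameter \<open>t \<le> 1\<close>,
so it is a copy, shrunk by \<open>t\<close>, of a segment between two points of \<open>E\<close>. Thus the
inradius of an element is controlled by the diameter of each of its facets.\<close>
lemma cball_in_simplex_facet_diameter:
  fixes T :: "'a::euclidean_space set"
  assumes fr: "facet_frame T E \<nu> b" and E: "bounded E" "convex E" and ball: "cball x r \<subseteq> T" "0 \<le> r"
    and dim: "DIM('a) \<ge> 2"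
  shows "2 * r \<le> diameter E"
proof -
  obtain v where v: "v \<in> T" "\<nu> \<bullet> v < b" and hull: "T = convex hull (insert v E)"
    and aff: "affine hull E = {x. \<nu> \<bullet> x = b}" and nn: "norm \<nu> = 1"
    using fr by (auto simp: facet_frame_def)
  have "\<nu> \<noteq> 0" using nn by auto
  obtain u where u: "u \<noteq> 0" "\<nu> \<bullet> u = 0"
    using orthogonal_to_vector_exists[OF dim, of \<nu>] by (metis orthogonal_def)
  define w where "w = (r / norm u) *\<^sub>R u"
  have w: "norm w = r" "\<nu> \<bullet> w = 0" using u ball by (auto simp: w_def)
  have "E \<noteq> {}"
  proof
    assume "E = {}"
    then have "b *\<^sub>R \<nu> \<notin> affine hull E" by simp
    then show False using nn by (simp add: aff dot_square_norm)
  qed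
  have z: "x + w \<in> T" "x - w \<in> T" using ball w by (auto simp: subset_iff dist_norm)
  have rep: "\<exists>t y. 0 \<le> t \<and> t \<le> 1 \<and> y \<in> E \<and> z = (1 - t) *\<^sub>R v + t *\<^sub>R y" if "z \<in> T" for z
  proof -
    obtain y where "y \<in> convex hull E" "z \<in> closed_segment v y"
      using \<open>z \<in> T\<close> \<open>E \<noteq> {}\<close> unfolding hull convex_hull_insert_segments by auto
    then show ?thesis using E by (auto simp: closed_segment_def hull_same)
  qed
  obtain t1 y1 where 1: "0 \<le> t1" "t1 \<le> 1" "y1 \<in> E" "x + w = (1 - t1) *\<^sub>R v + t1 *\<^sub>R y1"
    using rep[OF z(1)] by auto
  obtain t2 y2 where 2: "0 \<le> t2" "t2 \<le> 1" "y2 \<in> E" "x - w = (1 - t2) *\<^sub>R v + t2 *\<^sub>R y2"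
    using rep[OF z(2)] by auto
  have "\<nu> \<bullet> (x + w) = \<nu> \<bullet> (x - w)" using w by (simp add: inner_add_right inner_diff_right)
  then have "(1 - t1) * (\<nu> \<bullet> v) + t1 * b = (1 - t2) * (\<nu> \<bullet> v) + t2 * b"
    unfolding 1(4) 2(4) by (simp add: inner_add_right facet_frame_eq[OF fr 1(3)] facet_frame_eq[OF fr 2(3)])
  then have "(t1 - t2) * (b - \<nu> \<bullet> v) = 0" by (simp add: algebra_simps)
  then have t: "t1 = t2" using v by simp
  have "2 *\<^sub>R w = (x + w) - (x - w)" by (simp add: scaleR_2)
  also have "\<dots> = t1 *\<^sub>R (y1 - y2)" unfolding 1(4) 2(4) t by (simp add: algebra_simps)
  finally have "norm (2 *\<^sub>R w) = norm (t1 *\<^sub>R (y1 - y2))" by (rule arg_cong)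
  then have "2 * r = t1 * dist y1 y2" using w 1 by (simp add: dist_norm)
  also have "\<dots> \<le> 1 * dist y1 y2" using 1 by (intro mult_right_mono) auto
  also have "\<dots> \<le> diameter E" using diameter_bounded_bound[OF E(1) 1(3) 2(3)] by simp
  finally show ?thesis .
qed


section \<open>Domains with Lipschitz boundary\<close>

text \<open>The domain does not lie on both sides of its boundary: from a boundary point one can move down, against
the vertical direction of the graph, and arrives at points that have a neighbourhood without points of the domain.\<close>
lemma lipschitz_domain_interior_closure:
  fixes \<Omega> :: "(real^'n::finite) set"
  assumes "lipschitz_domain \<Omega>"
  shows "interior (closure \<Omega>) = \<Omega>"
proof
  have op: "open \<Omega>" using assms by (simp add: lipschitz_domain_def)
  then show "\<Omega> \<subseteq> interior (closure \<Omega>)" by (simp add: closure_subset interior_maximal)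
  show "interior (closure \<Omega>) \<subseteq> \<Omega>"
  proof (rule ccontr)
    assume "\<not> ?thesis"
    then obtain x where x: "x \<in> interior (closure \<Omega>)" "x \<notin> \<Omega>" by auto
    then have "x \<in> frontier \<Omega>" using op interior_subset[of "closure \<Omega>"] by (auto simp: frontier_def interior_open)
    then obtain U e L \<phi> where U: "open U" "x \<in> U" and e: "norm e = 1"
      and lip: "L-lipschitz_on {y. y \<bullet> e = 0} \<phi>"
      and graph: "\<Omega> \<inter> U = {y \<in> U. \<phi> (y - (y \<bullet> e) *\<^sub>R e) < y \<bullet> e}"
      using assms unfolding lipschitz_domain_def by meson
    have ee: "e \<bullet> e = 1" using e by (simp add: dot_square_norm)
    have hor: "(y - (y \<bullet> e) *\<^sub>R e) \<bullet> e = 0" for y by (simp add: inner_diff_left ee)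
    have "continuous_on UNIV (\<lambda>y. \<phi> (y - (y \<bullet> e) *\<^sub>R e))"
      by (rule continuous_on_compose2[OF lipschitz_on_continuous_on[OF lip]])
        (auto intro!: continuous_intros simp: hor)
    then have opV: "open {y. y \<bullet> e < \<phi> (y - (y \<bullet> e) *\<^sub>R e)}"
      by (intro open_Collect_less continuous_intros)
    have "x \<notin> \<Omega> \<inter> U" using x by simp
    then have xle: "x \<bullet> e \<le> \<phi> (x - (x \<bullet> e) *\<^sub>R e)" using U by (auto simp: graph)
    have "open (U \<inter> interior (closure \<Omega>))" "x \<in> U \<inter> interior (closure \<Omega>)" using U x by auto
    then obtain r where r: "0 < r" "ball x r \<subseteq> U \<inter> interior (closure \<Omega>)"
      by (meson open_contains_ball)
    \<comment> \<open>moving down from \<open>x\<close> keeps the horizontal part and ends strictly below the graph\<close>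
    define y where "y = x - (r/2) *\<^sub>R e"
    have yb: "y \<in> ball x r" using r e by (simp add: y_def dist_norm)
    have ye: "y \<bullet> e = x \<bullet> e - r/2" by (simp add: y_def inner_diff_left ee)
    have "y - (y \<bullet> e) *\<^sub>R e = x - (x \<bullet> e) *\<^sub>R e" unfolding ye by (simp add: y_def algebra_simps)
    then have "y \<in> {y. y \<bullet> e < \<phi> (y - (y \<bullet> e) *\<^sub>R e)} \<inter> U" using xle ye r yb by auto
    moreover have "open ({y. y \<bullet> e < \<phi> (y - (y \<bullet> e) *\<^sub>R e)} \<inter> U)" using opV U by auto
    moreover have "y \<in> closure \<Omega>" using yb r interior_subset by blast
    ultimately obtain z where "z \<in> \<Omega>" "z \<in> {y. y \<bullet> e < \<phi> (y - (y \<bullet> e) *\<^sub>R e)} \<inter> U"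
      by (meson closure_iff_nhds_not_empty disjoint_iff order_refl)
    then show False using graph by force
  qed
qed


section \<open>Volume loss under bisection\<close>

text \<open>The barycentric coordinate of \<open>b\<close> is at most \<open>1/2\<close> on the child that contains \<open>a\<close>, and at least \<open>1/2\<close> on the
copy of the simplex that is contracted to \<open>b\<close> with ratio \<open>1/2\<close>. The child and this copy overlap only in
a hyperplane, so the child misses at least the fraction \<open>(1/2)\<^sup>d\<close> of the volume. (The exact
ratio is \<open>1/2\<close>; any bound below \<open>1\<close> serves the estimate, and this one needs no determinants.)\<close>
lemma bisected_simplex:
  fixes a b :: "'a::euclidean_space"
  assumes S: "\<not> affine_dependent (insert a (insert b Y))" "card (insert a (insert b Y)) = DIM('a) + 1"
    and ab: "a \<noteq> b" "a \<notin> Y" "b \<notin> Y" and fin: "finite Y"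
  defines "m \<equiv> midpoint a b"
  shows "m \<noteq> a" "m \<notin> Y" "\<not> affine_dependent (insert a (insert m Y))"
    and "convex hull (insert a (insert m Y)) \<subseteq> convex hull (insert a (insert b Y))"
    and "volume (convex hull (insert a (insert m Y)))
      \<le> (1 - (1/2) ^ DIM('a)) * volume (convex hull (insert a (insert b Y)))"
proof -
  let ?T = "convex hull (insert a (insert b Y))" and ?C = "convex hull (insert a (insert m Y))"
  obtain \<nu> \<beta> where \<nu>: "\<nu> \<noteq> 0" "\<nu> \<bullet> b = \<beta> + 1"
    "affine hull (insert a (insert b Y) - {b}) = {x. \<nu> \<bullet> x = \<beta>}"
    using vertex_functional[OF S, of b] by blast
  have \<nu>Y: "\<nu> \<bullet> x = \<beta>" if "x \<in> insert a Y" for x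
    using that ab \<nu>(3) hull_inc[of x "insert a (insert b Y) - {b}" affine] by auto
  have m: "\<nu> \<bullet> m = \<beta> + 1/2"
    using \<nu>(2) \<nu>Y[of a] by (simp add: m_def midpoint_def inner_add_right)
  show ma: "m \<noteq> a" using m \<nu>Y[of a] by auto
  show mY: "m \<notin> Y" using m \<nu>Y[of m] by auto
  have "affine hull (insert a Y) \<subseteq> {x. \<nu> \<bullet> x = \<beta>}"
    by (rule hull_minimal) (use \<nu>Y in \<open>auto simp: affine_hyperplane\<close>)
  then have "m \<notin> affine hull (insert a Y)" using m by auto
  moreover have "\<not> affine_dependent (insert a Y)"
    using S(1) by (metis affine_dependent_subset insert_commute subset_insertI)
  ultimately have "\<not> affine_dependent (insert m (insert a Y))" by (rule affine_independent_insert[rotated])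
  then show "\<not> affine_dependent (insert a (insert m Y))" by (simp add: insert_commute)
  have aT: "a \<in> ?T" and bT: "b \<in> ?T" by (auto intro: hull_inc)
  have "m \<in> ?T"
    using convexD_alt[OF convex_convex_hull aT bT, of "1/2"]
    by (simp add: m_def midpoint_def scaleR_add_right)
  then show CT: "?C \<subseteq> ?T"
    by (intro hull_minimal convex_convex_hull) (auto intro: hull_inc)
  define h where "h = (\<lambda>x. (1/2) *\<^sub>R x + (1/2) *\<^sub>R b)"
  have hT: "h ` ?T \<subseteq> ?T"
    using convexD_alt[OF convex_convex_hull _ bT, of _ "1/2"] by (auto simp: h_def)
  have T0: "\<beta> \<le> \<nu> \<bullet> x" if "x \<in> ?T" for x
  proof -
    have "?T \<subseteq> {x. \<nu> \<bullet> x \<ge> \<beta>}"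
      by (rule hull_minimal) (use \<nu>Y \<nu>(2) in \<open>auto simp: convex_halfspace_ge\<close>)
    then show ?thesis using that by auto
  qed
  have C0: "\<nu> \<bullet> x \<le> \<beta> + 1/2" if "x \<in> ?C" for x
  proof -
    have "?C \<subseteq> {x. \<nu> \<bullet> x \<le> \<beta> + 1/2}"
      by (rule hull_minimal) (use \<nu>Y m in \<open>auto simp: convex_halfspace_le\<close>)
    then show ?thesis using that by auto
  qed
  have "?C \<inter> h ` ?T \<subseteq> {x. \<nu> \<bullet> x = \<beta> + 1/2}"
  proof
    fix x assume x: "x \<in> ?C \<inter> h ` ?T"
    then obtain y where "y \<in> ?T" "x = h y" by auto
    then have "\<beta> + 1/2 \<le> \<nu> \<bullet> x" using T0[of y] \<nu>(2) by (simp add: h_def inner_add_right field_simps)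
    then show "x \<in> {x. \<nu> \<bullet> x = \<beta> + 1/2}" using C0[of x] x by auto
  qed
  then have neg: "negligible (?C \<inter> h ` ?T)"
    using negligible_hyperplane[of \<nu> "\<beta> + 1/2"] \<nu>(1) negligible_subset by blast
  have comp: "compact ?T" "compact ?C" using fin by (auto intro: finite_imp_compact_convex_hull)
  have meas: "?T \<in> lmeasurable" "?C \<in> lmeasurable" using comp by (auto intro: lmeasurable_compact)
  have "h ` ?T = (\<lambda>x. (1/2) *\<^sub>R x + (1/2) *\<^sub>R b) ` ?T" by (simp add: h_def)
  have measH: "h ` ?T \<in> lmeasurable"
    by (rule lmeasurable_compact) (use comp in \<open>auto simp: h_def intro!: compact_continuous_image continuous_intros\<close>)
  have "volume (h ` ?T) = (1/2) ^ DIM('a) * volume ?T"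
    using measure_lebesgue_affine[of "1/2" "(1/2) *\<^sub>R b" ?T] by (simp add: h_def)
  moreover have "volume (?C \<union> h ` ?T) = volume ?C + volume (h ` ?T)"
    using measure_Un3[OF meas(2) measH] negligible_imp_measure0[OF neg] by simp
  moreover have "volume (?C \<union> h ` ?T) \<le> volume ?T"
    using CT hT meas measH by (intro measure_mono_fmeasurable) (auto dest: fmeasurableD)
  ultimately show "volume ?C \<le> (1 - (1/2) ^ DIM('a)) * volume ?T"
    by (simp add: algebra_simps)
qed

lemma simplex_element:
  fixes t :: "'n::finite tagged"
  assumes "tagged_simplex t"
  shows "DIM(real^'n) simplex (element t)"
  using assms by (auto simp: tagged_simplex_def element_def simplex_def distinct_card intro!: exI[of _ "set (fst t)"])

lemma tagged_simplex_children:
  fixes t s :: "'n::finite tagged"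
  assumes t: "tagged_simplex t" and s: "s \<in> children t"
  shows "tagged_simplex s" "element s \<subseteq> element t"
    "volume (element s) \<le> (1 - (1/2) ^ CARD('n)) * volume (element t)"
proof -
  obtain xs \<gamma> where t_eq: "t = (xs, \<gamma>)" by (cases t)
  have len: "length xs = CARD('n) + 1" "distinct xs" "\<not> affine_dependent (set xs)"
    using t by (auto simp: tagged_simplex_def t_eq)
  define a b ys where "a = hd xs" and "b = last xs" and "ys = butlast (tl xs)"
  have "xs \<noteq> []" "tl xs \<noteq> []" using len by (cases xs; auto)+
  then have xs: "xs = a # ys @ [b]"
    by (simp add: a_def b_def ys_def last_tl[symmetric])
  define m where "m = midpoint a b"
  have ab: "a \<noteq> b" "a \<notin> set ys" "b \<notin> set ys" "distinct ys" using len(2) by (auto simp: xs)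
  have set_xs: "set xs = insert a (insert b (set ys))" "set xs = insert b (insert a (set ys))"
    by (auto simp: xs)
  have card: "card (set xs) = DIM(real^'n) + 1" using len by (simp add: distinct_card)
  note A = bisected_simplex[OF len(3)[unfolded set_xs(1)] card[unfolded set_xs(1)] ab(1-3) finite_set]
  note B = bisected_simplex[OF len(3)[unfolded set_xs(2)] card[unfolded set_xs(2)] ab(1)[symmetric] ab(3,2) finite_set]
  have mm: "midpoint b a = m" "midpoint a b = m" by (simp_all add: m_def midpoint_sym)
  note A = A[unfolded mm, folded set_xs(1)] and B = B[unfolded mm, folded set_xs(2)]
  have pos: "CARD('n) > 0" by simp
  have "s = (a # m # ys, (\<gamma> + 1) mod CARD('n)) \<or>
     s = (b # m # take \<gamma> ys @ rev (drop \<gamma> ys), (\<gamma> + 1) mod CARD('n))"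
    using s by (auto simp: children_def t_eq a_def b_def ys_def m_def Let_def)
  moreover have "set (take \<gamma> ys) \<union> set (drop \<gamma> ys) = set ys"
    by (metis append_take_drop_id set_append)
  moreover have "distinct (take \<gamma> ys @ rev (drop \<gamma> ys))"
    using ab(4) by (metis append_take_drop_id distinct_append distinct_rev set_rev)
  moreover have "length ys + 1 = CARD('n)" using len by (simp add: xs)
  ultimately have "tagged_simplex s \<and> element s \<subseteq> element t \<and>
    volume (element s) \<le> (1 - (1/2) ^ CARD('n)) * volume (element t)"
    using A B ab by (elim disjE) (auto simp: tagged_simplex_def element_def t_eq)
  then show "tagged_simplex s" "element s \<subseteq> element t"
    "volume (element s) \<le> (1 - (1/2) ^ CARD('n)) * volume (element t)" by auto
qed

text \<open>The meshes between two steps of the refinement need not be conforming, so the invariant of the iteration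
speaks of single elements. Only the comparison with an element of the starting mesh is recorded: volumes
decrease along further bisections, so one factor remains valid.\<close>
definition descends_from :: "'n::finite tagged set \<Rightarrow> 'n tagged \<Rightarrow> bool" where
  "descends_from \<T> s \<longleftrightarrow> tagged_simplex s \<and> (s \<in> \<T> \<or> (\<exists>t\<in>\<T>. element s \<subseteq> element t \<and>
     volume (element s) \<le> (1 - (1/2) ^ CARD('n)) * volume (element t)))"

lemma descends_from_bisect:
  fixes \<T> :: "'n::finite tagged set"
  assumes S: "\<forall>s\<in>\<S>. descends_from \<T> s" and M: "\<M> \<subseteq> \<S>"
  shows "\<forall>s\<in>bisect \<M> \<S>. descends_from \<T> s"
proof
  fix s assume "s \<in> bisect \<M> \<S>"
  then consider "s \<in> \<S>" | u where "u \<in> \<S>" "s \<in> children u" using M by (auto simp: bisect_def)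
  then show "descends_from \<T> s"
  proof cases
    case 2
    have u: "tagged_simplex u" "descends_from \<T> u" using S 2 by (auto simp: descends_from_def)
    note c = tagged_simplex_children[OF u(1) 2(2)]
    obtain t where t: "t \<in> \<T>" "element u \<subseteq> element t"
      "volume (element u) \<le> volume (element t)"
    proof (cases "u \<in> \<T>")
      case False
      then obtain t where t: "t \<in> \<T>" "element u \<subseteq> element t"
        "volume (element u) \<le> (1 - (1/2) ^ CARD('n)) * volume (element t)"
        using u by (auto simp: descends_from_def)
      have "(1 - (1/2) ^ CARD('n)) * volume (element t) \<le> 1 * volume (element t)"
        by (intro mult_right_mono) auto
      with t that show thesis by simp
    qed (use that in auto)
    have "(1 - (1/2) ^ CARD('n)) * volume (element u) \<le> (1 - (1/2) ^ CARD('n)) * volume (element t)"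
      using t(3) by (intro mult_left_mono) (auto simp: power_le_one)
    then show ?thesis using c t by (auto simp: descends_from_def intro!: bexI[of _ t])
  qed (use S in auto)
qed

lemma nvb_descends:
  assumes "\<forall>s\<in>\<S>. descends_from \<T> s" "\<M> \<subseteq> \<S>" "nvb \<Omega> \<S> \<M> \<S>'"
  shows "\<forall>s\<in>\<S>'. descends_from \<T> s"
proof -
  obtain k :: nat where "\<S>' = ((\<lambda>\<S>. bisect (with_hanging_node \<S>) \<S>) ^^ k) (bisect \<M> \<S>)"
    using assms(3) by (auto simp: nvb_def)
  moreover have "\<forall>s\<in>((\<lambda>\<S>. bisect (with_hanging_node \<S>) \<S>) ^^ k) (bisect \<M> \<S>). descends_from \<T> s"
  proof (induction k)
    case 0
    show ?case using descends_from_bisect[OF assms(1,2)] by simp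
  next
    case (Suc k)
    show ?case unfolding funpow.simps o_apply
      by (rule descends_from_bisect[OF Suc]) (auto simp: with_hanging_node_def)
  qed
  ultimately show ?thesis by simp
qed

lemma refinements_descend:
  assumes "mesh \<Omega> \<T>" "\<T>' \<in> refinements \<Omega> \<T>"
  shows "mesh \<Omega> \<T>'" "\<forall>s\<in>\<T>'. descends_from \<T> s"
proof -
  have "(\<lambda>\<S> \<S>'. \<exists>\<M>\<subseteq>\<S>. nvb \<Omega> \<S> \<M> \<S>')\<^sup>*\<^sup>* \<T> \<T>'" using assms(2) by (simp add: refinements_def)
  then have "mesh \<Omega> \<T>' \<and> (\<forall>s\<in>\<T>'. descends_from \<T> s)"
  proof (induction rule: rtranclp_induct)
    case base
    then show ?case using assms(1) by (auto simp: descends_from_def mesh_def)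
  next
    case (step y z)
    then show ?case using nvb_descends[of y \<T> _ \<Omega> z] by (auto simp: nvb_def)
  qed
  then show "mesh \<Omega> \<T>'" "\<forall>s\<in>\<T>'. descends_from \<T> s" by auto
qed

lemma refinements_trans:
  "\<T>' \<in> refinements \<Omega> \<T> \<Longrightarrow> \<T>'' \<in> refinements \<Omega> \<T>' \<Longrightarrow> \<T>'' \<in> refinements \<Omega> \<T>"
  by (auto simp: refinements_def)


section \<open>Surface measure of simplices\<close>

lemma hausdorff_pre_finite_cover:
  assumes I: "finite I" "A \<subseteq> (\<Union>i\<in>I. P i)"
    and P: "\<And>i. i \<in> I \<Longrightarrow> bounded (P i)" "\<And>i. i \<in> I \<Longrightarrow> diameter (P i) \<le> e" and e: "0 \<le> e" "e \<le> \<delta>"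
  shows "hausdorff_pre s \<delta> A \<le> of_nat (card I) * ennreal (unit_ball_vol (real s) * (e / 2) ^ s)"
proof -
  obtain f where f: "bij_betw f {..<card I} I" using ex_bij_betw_nat_finite[OF I(1)] by (auto simp: atLeast0LessThan)
  define C where "C = (\<lambda>n. if n < card I then P (f n) else {})"
  have fI: "f n \<in> I" if "n < card I" for n using f that by (auto simp: bij_betw_def)
  have cover: "A \<subseteq> (\<Union>n. C n)"
  proof
    fix x assume "x \<in> A"
    then obtain i where i: "i \<in> I" "x \<in> P i" using I by auto
    then have "i \<in> f ` {..<card I}" using f by (simp add: bij_betw_def)
    then obtain n where "n < card I" "f n = i" by auto
    then have "x \<in> C n" using i by (simp add: C_def)
    then show "x \<in> (\<Union>n. C n)" by blast
  qed
  have "hausdorff_pre s \<delta> A \<le>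
      (\<Sum>n. if C n = {} then 0 else ennreal (unit_ball_vol (real s) * (diameter (C n) / 2) ^ s))"
    unfolding hausdorff_pre_def
  proof (rule INF_lower, intro CollectI conjI allI cover)
    fix n
    show "bounded (C n)" using P(1)[OF fI] by (simp add: C_def)
    show "diameter (C n) \<le> \<delta>" using P(2)[OF fI, of n] e by (auto simp: C_def)
  qed
  also have "\<dots> = (\<Sum>n<card I. if C n = {} then 0 else ennreal (unit_ball_vol (real s) * (diameter (C n) / 2) ^ s))"
    by (rule suminf_finite) (auto simp: C_def)
  also have "\<dots> \<le> (\<Sum>n<card I. ennreal (unit_ball_vol (real s) * (e / 2) ^ s))"
  proof (rule sum_mono)
    fix n assume "n \<in> {..<card I}"
    then have "diameter (C n) \<le> e" using P(2)[OF fI, of n] by (simp add: C_def)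
    moreover have "bounded (C n)" using P(1)[OF fI, of n] by (auto simp: C_def)
    ultimately have "unit_ball_vol (real s) * (diameter (C n) / 2) ^ s \<le> unit_ball_vol (real s) * (e / 2) ^ s"
      by (intro mult_left_mono power_mono divide_right_mono) (auto simp: diameter_ge_0)
    then show "(if C n = {} then 0 else ennreal (unit_ball_vol (real s) * (diameter (C n) / 2) ^ s))
       \<le> ennreal (unit_ball_vol (real s) * (e / 2) ^ s)"
      by (auto intro: ennreal_leI)
  qed
  finally show ?thesis by simp
qed

text \<open>Parametrise the simplex with \<open>k + 1\<close> vertices by the \<open>k\<close> barycentric coordinates other than that of \<open>p\<close>,
and cut the unit cube of parameters into a grid of width \<open>1/N\<close>.\<close>
lemma convex_hull_grid_cover:
  fixes S :: "'a::real_normed_vector set"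
  assumes S: "finite S" "card S = Suc k" and D: "\<And>x y. x \<in> S \<Longrightarrow> y \<in> S \<Longrightarrow> dist x y \<le> D" and N: "0 < N"
  obtains I :: "('a \<Rightarrow> nat) set" and P where "finite I" "card I = (N + 1) ^ k" "convex hull S \<subseteq> (\<Union>i\<in>I. P i)"
    "\<And>i. bounded (P i)" "\<And>i. diameter (P i) \<le> real k * D / real N"
proof -
  obtain p where p: "p \<in> S" using S by fastforce
  define R where "R = S - {p}"
  have R: "finite R" "card R = k" using S p by (auto simp: R_def)
  have D0: "0 \<le> D" using D[OF p p] by simp
  define P where "P = (\<lambda>\<phi>::'a \<Rightarrow> nat. {p + (\<Sum>r\<in>R. u r *\<^sub>R (r - p)) | u.
     \<forall>r\<in>R. real (\<phi> r) \<le> real N * u r \<and> real N * u r \<le> real (\<phi> r) + 1})"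
  define I where "I = PiE R (\<lambda>_. {0..N})"
  have dist: "dist x y \<le> real k * D / real N" if xy: "x \<in> P \<phi>" "y \<in> P \<phi>" for x y \<phi>
  proof -
    obtain u where u: "x = p + (\<Sum>r\<in>R. u r *\<^sub>R (r - p))"
      "\<forall>r\<in>R. real (\<phi> r) \<le> real N * u r \<and> real N * u r \<le> real (\<phi> r) + 1" using xy(1) unfolding P_def by blast
    obtain w where w: "y = p + (\<Sum>r\<in>R. w r *\<^sub>R (r - p))"
      "\<forall>r\<in>R. real (\<phi> r) \<le> real N * w r \<and> real N * w r \<le> real (\<phi> r) + 1" using xy(2) unfolding P_def by blast
    have "dist x y = norm (\<Sum>r\<in>R. (u r - w r) *\<^sub>R (r - p))"
      by (simp add: u(1) w(1) dist_norm scaleR_diff_left sum_subtractf)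
    also have "\<dots> \<le> (\<Sum>r\<in>R. norm ((u r - w r) *\<^sub>R (r - p)))" by (rule norm_sum)
    also have "\<dots> \<le> (\<Sum>r\<in>R. 1 / real N * D)"
    proof (rule sum_mono)
      fix r assume r: "r \<in> R"
      have "real N * u r - real N * w r \<le> 1" "real N * w r - real N * u r \<le> 1"
        using u(2) w(2) r by fastforce+
      then have "real N * \<bar>u r - w r\<bar> \<le> 1" by (auto simp: abs_if algebra_simps)
      then have "\<bar>u r - w r\<bar> \<le> 1 / real N" using N by (simp add: field_simps)
      moreover have "norm (r - p) \<le> D" using D[of r p] r p by (simp add: R_def dist_norm)
      ultimately show "norm ((u r - w r) *\<^sub>R (r - p)) \<le> 1 / real N * D"
        by (simp only: norm_scaleR) (intro mult_mono, auto)
    qed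
    also have "\<dots> = real k * D / real N" by (simp add: R)
    finally show ?thesis .
  qed
  show thesis
  proof (rule that[of I P])
    show "finite I" "card I = (N + 1) ^ k" using R by (auto simp: I_def card_PiE intro: finite_PiE)
    show "bounded (P i)" for i using dist by (meson boundedI bounded_two_points)
    show "diameter (P i) \<le> real k * D / real N" for i
    proof (rule diameter_le)
      show "P i \<noteq> {} \<or> 0 \<le> real k * D / real N" using D0 by simp
    qed (use dist in \<open>simp add: dist_norm\<close>)
    show "convex hull S \<subseteq> (\<Union>i\<in>I. P i)"
    proof
      fix x assume "x \<in> convex hull S"
      then obtain c where c: "\<forall>r\<in>S. 0 \<le> c r" "sum c S = 1" "(\<Sum>r\<in>S. c r *\<^sub>R r) = x"
        using S(1) by (auto simp: convex_hull_finite)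
      have "x = (\<Sum>r\<in>S. c r *\<^sub>R (r - p)) + sum c S *\<^sub>R p"
        by (simp add: c(3)[symmetric] scaleR_diff_right sum_subtractf scaleR_sum_left)
      also have "(\<Sum>r\<in>S. c r *\<^sub>R (r - p)) = (\<Sum>r\<in>R. c r *\<^sub>R (r - p))"
        unfolding R_def using S(1) by (intro sum.mono_neutral_right) auto
      finally have x: "x = p + (\<Sum>r\<in>R. c r *\<^sub>R (r - p))" by (simp add: c(2))
      define \<phi> where "\<phi> = restrict (\<lambda>r. nat \<lfloor>real N * c r\<rfloor>) R"
      have "\<phi> \<in> I"
        unfolding I_def \<phi>_def
      proof (rule restrict_PiE_iff[THEN iffD2], rule ballI)
        fix r assume r: "r \<in> R"
        have "c r \<le> sum c S" using r c(1) S(1) by (intro member_le_sum) (auto simp: R_def)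
        then have "real N * c r \<le> real N" using c(2) by (simp add: mult_left_le)
        then show "nat \<lfloor>real N * c r\<rfloor> \<in> {0..N}" by (simp add: nat_le_iff floor_le_iff)
      qed
      moreover have "x \<in> P \<phi>"
        unfolding P_def
      proof (intro CollectI exI[of _ c] conjI x ballI)
        fix r assume r: "r \<in> R"
        then have "0 \<le> real N * c r" using c(1) by (simp add: R_def)
        then show "real (\<phi> r) \<le> real N * c r" "real N * c r \<le> real (\<phi> r) + 1"
          using r by (auto simp: \<phi>_def of_nat_nat)
      qed
      ultimately show "x \<in> (\<Union>i\<in>I. P i)" by blast
    qed
  qed
qed

lemma hausdorff_pre_convex_hull:
  fixes S :: "'a::real_normed_vector set"
  assumes S: "finite S" "card S = Suc k" and D: "\<And>x y. x \<in> S \<Longrightarrow> y \<in> S \<Longrightarrow> dist x y \<le> D"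
    and N: "0 < N" "real k * D / real N \<le> \<delta>"
  shows "hausdorff_pre s \<delta> (convex hull S)
     \<le> ennreal (2 ^ k * real N ^ k * (unit_ball_vol (real s) * (real k * D / real N / 2) ^ s))"
proof -
  obtain I :: "('a \<Rightarrow> nat) set" and P where IP: "finite I" "card I = (N + 1) ^ k" "convex hull S \<subseteq> (\<Union>i\<in>I. P i)"
    "\<And>i. bounded (P i)" "\<And>i. diameter (P i) \<le> real k * D / real N"
    using convex_hull_grid_cover[OF S D N(1)] by blast
  obtain p where "p \<in> S" using S by fastforce
  then have D0: "0 \<le> D" using D[of p p] by simp
  have "hausdorff_pre s \<delta> (convex hull S)
      \<le> of_nat (card I) * ennreal (unit_ball_vol (real s) * (real k * D / real N / 2) ^ s)"
    using IP N D0 by (intro hausdorff_pre_finite_cover) auto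
  also have "\<dots> = ennreal (real (card I) * (unit_ball_vol (real s) * (real k * D / real N / 2) ^ s))"
    by (simp add: ennreal_of_nat_eq_real_of_nat ennreal_mult' D0)
  also have "\<dots> \<le> ennreal (2 ^ k * real N ^ k * (unit_ball_vol (real s) * (real k * D / real N / 2) ^ s))"
  proof (intro ennreal_leI mult_right_mono)
    have "real (card I) = (real N + 1) ^ k" by (simp add: IP(2) add.commute)
    also have "\<dots> \<le> (2 * real N) ^ k" using N by (intro power_mono) auto
    finally show "real (card I) \<le> 2 ^ k * real N ^ k" by (simp add: power_mult_distrib)
  qed (use D0 in auto)
  finally show ?thesis .
qed

text \<open>About \<open>N\<^sup>k\<close> pieces of diameter \<open>k D / N\<close> suffice, and these contributions have the same
size for all \<open>N\<close>.\<close>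
lemma hausdorff_outer_convex_hull_le:
  fixes S :: "'a::real_normed_vector set"
  assumes S: "finite S" "card S = Suc k" and D: "\<And>x y. x \<in> S \<Longrightarrow> y \<in> S \<Longrightarrow> dist x y \<le> D"
  shows "hausdorff_outer k (convex hull S) \<le> ennreal (unit_ball_vol (real k) * (real k * D) ^ k)"
  unfolding hausdorff_outer_def
proof (rule SUP_least)
  fix \<delta> :: real assume "\<delta> \<in> {0<..}"
  then have \<delta>: "0 < \<delta>" by simp
  obtain n :: nat where n: "real k * D / \<delta> < real n" using reals_Archimedean2 by blast
  define N where "N = Suc n"
  have N: "0 < N" "real k * D / real N \<le> \<delta>"
    using n \<delta> by (auto simp: N_def field_simps)
  have scale: "2 ^ k * real N ^ k * (c * X ^ k) = c * (2 * real N * X) ^ k" for c X :: real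
    by (simp add: power_mult_distrib)
  have "2 ^ k * real N ^ k * (unit_ball_vol (real k) * (real k * D / real N / 2) ^ k)
     = unit_ball_vol (real k) * (2 * real N * (real k * D / real N / 2)) ^ k"
    by (rule scale)
  also have "2 * real N * (real k * D / real N / 2) = real k * D" using N by simp
  finally show "hausdorff_pre k \<delta> (convex hull S) \<le> ennreal (unit_ball_vol (real k) * (real k * D) ^ k)"
    using hausdorff_pre_convex_hull[OF S D N, of k] by (simp only:)
qed

text \<open>With fewer than \<open>s + 1\<close> vertices the \<open>N\<^sup>k\<close> pieces have total weight of order \<open>N\<^sup>k / N\<^sup>s\<close>, which tends to zero.
This makes the common part of two facets negligible for the surface measure.\<close>
lemma hausdorff_outer_convex_hull_null:
  fixes S :: "'a::real_normed_vector set"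
  assumes S: "finite S" "card S \<le> s"
  shows "hausdorff_outer s (convex hull S) = 0"
proof (cases "S = {}")
  case True
  then show ?thesis by (simp add: hausdorff_outer_empty)
next
  case False
  then obtain k where k: "card S = Suc k" using S by (cases "card S") auto
  define D where "D = diameter S"
  have D: "dist x y \<le> D" if "x \<in> S" "y \<in> S" for x y
    using diameter_bounded_bound[OF finite_imp_bounded[OF S(1)] that] by (simp add: D_def)
  have D0: "0 \<le> D" using S by (simp add: D_def diameter_ge_0 finite_imp_bounded)
  define C where "C = 2 ^ k * (unit_ball_vol (real s) * (real k * D / 2) ^ s)"
  have C0: "0 \<le> C" using D0 by (simp add: C_def)
  have "hausdorff_pre s \<delta> (convex hull S) \<le> ennreal e" if \<delta>: "0 < \<delta>" and e: "0 < e" for \<delta> e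
  proof -
    obtain n1 :: nat where n1: "real k * D / \<delta> < real n1" using reals_Archimedean2 by blast
    obtain n2 :: nat where n2: "C / e < real n2" using reals_Archimedean2 by blast
    define N where "N = Suc (n1 + n2)"
    have Nr: "real N = 1 + real n1 + real n2" by (simp add: N_def)
    have "real k * D / \<delta> < real N" "C / e < real N" using n1 n2 unfolding Nr by linarith+
    then have N: "0 < N" "real k * D / real N \<le> \<delta>" "C / real N \<le> e"
      using \<delta> e by (auto simp: N_def field_simps)
    have "s = k + Suc (s - Suc k)" using S k by simp
    then have sp: "real N ^ s = real N ^ k * (real N * real N ^ (s - Suc k))"
      by (metis power_Suc power_add)
    have "2 ^ k * real N ^ k * (unit_ball_vol (real s) * (real k * D / real N / 2) ^ s)
      = C * (real N ^ k / real N ^ s)"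
      by (simp add: C_def power_divide ac_simps)
    also have "real N ^ k / real N ^ s = 1 / (real N * real N ^ (s - Suc k))"
      using N by (simp add: sp)
    also have "\<dots> \<le> 1 / (real N * 1)"
      using N by (intro divide_left_mono mult_left_mono one_le_power) auto
    finally have "2 ^ k * real N ^ k * (unit_ball_vol (real s) * (real k * D / real N / 2) ^ s) \<le> C / real N"
      using C0 by (simp add: mult_left_mono)
    also have "\<dots> \<le> e" by (rule N)
    finally show ?thesis
      using hausdorff_pre_convex_hull[OF S(1) k D N(1,2), of s] by (meson ennreal_leI order_trans)
  qed
  note small = this
  have "hausdorff_pre s \<delta> (convex hull S) = 0" if "0 < \<delta>" for \<delta>
  proof -
    have "hausdorff_pre s \<delta> (convex hull S) \<le> 0"
      by (rule ennreal_le_epsilon) (simp add: small[OF that])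
    then show ?thesis by simp
  qed
  then show ?thesis by (simp add: hausdorff_outer_def)
qed


section \<open>The fundamental lemma of the calculus of variations\<close>

lemma integrable_continuous_compact_support:
  fixes f :: "'a::euclidean_space \<Rightarrow> real"
  assumes "continuous_on UNIV f" "compact K" "\<And>x. x \<notin> K \<Longrightarrow> f x = 0"
  shows "integrable lborel f"
proof -
  have "integrable lborel (\<lambda>x. indicator K x *\<^sub>R f x)"
    using assms by (intro borel_integrable_compact) (auto intro: continuous_on_subset)
  also have "(\<lambda>x. indicator K x *\<^sub>R f x) = f" using assms(3) by (auto simp: indicator_def fun_eq_iff)
  finally show ?thesis .
qed

lemma gderiv_continuous:
  fixes \<psi> :: "'a::euclidean_space \<Rightarrow> real"
  assumes "\<And>x. GDERIV \<psi> x :> D x"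
  shows "continuous_on UNIV \<psi>"
proof (rule has_derivative_continuous_on)
  show "(\<psi> has_derivative (\<lambda>h. h \<bullet> D x)) (at x within UNIV)" for x
    using assms[of x] by (simp add: gderiv_def)
qed

lemma gderiv_zero_outside:
  fixes \<psi> :: "'a::euclidean_space \<Rightarrow> real"
  assumes D: "\<And>x. GDERIV \<psi> x :> D x" and K: "compact K" "\<And>x. x \<notin> K \<Longrightarrow> \<psi> x = 0" and x: "x \<notin> K"
  shows "D x = 0"
proof -
  have "open (- K)" using K(1) by (simp add: compact_imp_closed open_Compl)
  then have 0: "(\<psi> has_derivative (\<lambda>h. 0)) (at x)"
    by (rule has_derivative_transform_within_open[OF has_derivative_const]) (use x K in auto)
  have "(\<psi> has_derivative (\<lambda>h. h \<bullet> D x)) (at x)" using D[of x] by (simp add: gderiv_def)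
  from has_derivative_unique[OF this 0] have "D x \<bullet> D x = 0" by metis
  then show ?thesis by simp
qed

text \<open>By translation invariance of the Lebesgue measure the difference quotients in direction \<open>e\<close> have
integral zero, and they converge boundedly, with supports in one ball, to the directional derivative.\<close>
lemma integral_gradient_compact_support:
  fixes \<psi> :: "'a::euclidean_space \<Rightarrow> real"
  assumes D: "\<And>x. GDERIV \<psi> x :> D x" "continuous_on UNIV D" and K: "compact K" "\<And>x. x \<notin> K \<Longrightarrow> \<psi> x = 0"
  shows "(\<integral>x. D x \<bullet> e \<partial>lborel) = 0"
proof -
  define q where "q = (\<lambda>n x. (\<psi> (x + (1 / real (Suc n)) *\<^sub>R e) - \<psi> x) * real (Suc n))"
  have cont: "continuous_on UNIV \<psi>" using D(1) by (rule gderiv_continuous)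
  have int: "integrable lborel \<psi>" using cont K by (rule integrable_continuous_compact_support)
  have D0: "D x = 0" if "x \<notin> K" for x using gderiv_zero_outside[OF D(1) K that] .
  have meas\<psi>: "\<psi> \<in> borel_measurable borel" using cont by (rule borel_measurable_continuous_onI)
  have "\<exists>B. \<forall>x\<in>K. norm (D x) \<le> B"
    using compact_imp_bounded[OF compact_continuous_image[OF continuous_on_subset[OF D(2)] K(1)]]
    by (auto simp: bounded_iff)
  then obtain B0 where B0: "\<And>x. x \<in> K \<Longrightarrow> norm (D x) \<le> B0" by auto
  define B where "B = max 0 B0"
  have B: "norm (D x) \<le> B" for x using B0[of x] D0[of x] by (cases "x \<in> K") (auto simp: B_def)
  obtain R where R: "\<And>x. x \<in> K \<Longrightarrow> norm x \<le> R"
    using compact_imp_bounded[OF K(1)] by (auto simp: bounded_iff)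
  have shift: "integrable lborel (\<lambda>x. \<psi> (c + x))" "(\<integral>x. \<psi> (c + x) \<partial>lborel) = (\<integral>x. \<psi> x \<partial>lborel)" for c
  proof -
    show "integrable lborel (\<lambda>x. \<psi> (c + x))"
      using integrable_distr_eq[of "(+) c" lborel borel \<psi>] int meas\<psi> by (simp add: lborel_distr_plus)
    show "(\<integral>x. \<psi> (c + x) \<partial>lborel) = (\<integral>x. \<psi> x \<partial>lborel)"
      using integral_distr[of "(+) c" lborel borel \<psi>] meas\<psi> by (simp add: lborel_distr_plus)
  qed
  have q0: "(\<integral>x. q n x \<partial>lborel) = 0" for n
    using shift[of "(1 / real (Suc n)) *\<^sub>R e"] int by (simp add: q_def add.commute)
  have lim: "(\<lambda>n. \<integral>x. q n x \<partial>lborel) \<longlonglongrightarrow> (\<integral>x. D x \<bullet> e \<partial>lborel)"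
  proof (rule integral_dominated_convergence[where w = "\<lambda>x. indicator (cball 0 (R + norm e)) x * (B * norm e)"])
    show "(\<lambda>x. D x \<bullet> e) \<in> borel_measurable lborel"
      using D(2) by (auto intro!: borel_measurable_continuous_onI continuous_intros)
    show "q n \<in> borel_measurable lborel" for n
    proof -
      have "continuous_on UNIV (\<lambda>x. \<psi> (x + (1 / real (Suc n)) *\<^sub>R e))"
        by (rule continuous_on_compose2[OF cont]) (auto intro!: continuous_intros)
      then have "continuous_on UNIV (q n)" unfolding q_def by (intro continuous_intros cont)
      then show ?thesis by (simp add: borel_measurable_continuous_onI)
    qed
    show "integrable lborel (\<lambda>x. indicator (cball 0 (R + norm e)) x * (B * norm e))"
      using emeasure_bounded_finite[of "cball 0 (R + norm e)"]
      by (intro integrable_mult_left) (simp add: integrable_indicator_iff)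
    show "AE x in lborel. (\<lambda>n. q n x) \<longlonglongrightarrow> D x \<bullet> e"
    proof (rule AE_I2)
      fix x
      have "((\<lambda>t. \<psi> (x + t *\<^sub>R e)) has_derivative (\<lambda>t. (t *\<^sub>R e) \<bullet> D x)) (at 0)"
      proof -
        have "((\<lambda>t. x + t *\<^sub>R e) has_derivative (\<lambda>t. t *\<^sub>R e)) (at 0)"
          by (auto intro!: derivative_eq_intros)
        moreover have "(\<psi> has_derivative (\<lambda>h. h \<bullet> D x)) (at (x + 0 *\<^sub>R e))"
          using D(1)[of x] by (simp add: gderiv_def)
        ultimately show ?thesis by (rule has_derivative_compose)
      qed
      then have "((\<lambda>t. \<psi> (x + t *\<^sub>R e)) has_real_derivative (D x \<bullet> e)) (at 0)"
        unfolding has_field_derivative_def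
        by (rule has_derivative_eq_rhs) (auto simp: fun_eq_iff inner_commute mult.commute)
      then have "((\<lambda>t. (\<psi> (x + t *\<^sub>R e) - \<psi> x) / t) \<longlongrightarrow> D x \<bullet> e) (at 0)"
        by (simp add: DERIV_def)
      moreover have "filterlim (\<lambda>n. 1 / real (Suc n)) (at 0) sequentially"
        using lim_1_over_n LIMSEQ_Suc[of "\<lambda>n. 1 / real n" 0] by (auto simp: filterlim_at)
      ultimately have "(\<lambda>n. (\<psi> (x + (1 / real (Suc n)) *\<^sub>R e) - \<psi> x) / (1 / real (Suc n))) \<longlonglongrightarrow> D x \<bullet> e"
        by (rule filterlim_compose)
      then show "(\<lambda>n. q n x) \<longlonglongrightarrow> D x \<bullet> e" by (simp add: q_def)
    qed
    show "AE x in lborel. norm (q n x) \<le> indicator (cball 0 (R + norm e)) x * (B * norm e)" for n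
    proof (rule AE_I2)
      fix x
      let ?h = "(1 / real (Suc n)) *\<^sub>R e"
      have he: "norm ?h \<le> norm e" by (simp add: divide_le_eq algebra_simps)
      show "norm (q n x) \<le> indicator (cball 0 (R + norm e)) x * (B * norm e)"
      proof (cases "norm x \<le> R + norm e")
        case True
        have "norm (\<psi> (x + ?h) - \<psi> x) \<le> B * norm ((x + ?h) - x)"
        proof (rule differentiable_bound[of UNIV _ "\<lambda>x h. h \<bullet> D x"])
          show "(\<psi> has_derivative (\<lambda>h. h \<bullet> D z)) (at z within UNIV)" for z
            using D(1)[of z] by (simp add: gderiv_def)
          show "onorm (\<lambda>h. h \<bullet> D z) \<le> B" for z
          proof (rule onorm_le)
            fix h
            have "\<bar>h \<bullet> D z\<bar> \<le> norm h * norm (D z)" by (rule Cauchy_Schwarz_ineq2)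
            also have "\<dots> \<le> norm h * B" by (intro mult_left_mono B) auto
            finally show "norm (h \<bullet> D z) \<le> B * norm h" by (simp add: mult.commute)
          qed
        qed auto
        then have "norm (\<psi> (x + ?h) - \<psi> x) * real (Suc n) \<le> B * norm ?h * real (Suc n)"
          by (intro mult_right_mono) auto
        moreover have "norm ?h * real (Suc n) = norm e" by simp
        ultimately have "norm (\<psi> (x + ?h) - \<psi> x) * real (Suc n) \<le> B * norm e"
          by (metis mult.assoc)
        then show ?thesis using True by (simp add: q_def abs_mult)
      next
        case False
        have "norm x \<le> norm (x + ?h) + norm ?h" using norm_triangle_ineq4[of "x + ?h" ?h] by simp
        then have "R < norm (x + ?h)" "R < norm x"
          using False he norm_ge_zero[of e] by linarith+
        then have "x \<notin> K" "x + ?h \<notin> K" using R by fastforce+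
        moreover have "0 \<le> B" by (simp add: B_def)
        ultimately show ?thesis using K by (simp add: q_def)
      qed
    qed
  qed
  have "(\<lambda>n. \<integral>x. q n x \<partial>lborel) \<longlonglongrightarrow> 0" unfolding q0 by simp
  with lim show ?thesis by (rule LIMSEQ_unique)
qed

text \<open>Integration by parts: the gradient of the product of \<open>\<phi>\<close> and the affine function has integral zero.\<close>
lemma integral_affine_mult_gradient:
  fixes \<phi> :: "real^'n::finite \<Rightarrow> real" and a :: "real^'n"
  assumes D: "\<And>x. GDERIV \<phi> x :> D x" "continuous_on UNIV D" and K: "compact K" "\<And>x. x \<notin> K \<Longrightarrow> \<phi> x = 0"
  shows "(\<integral>x. (a \<bullet> x + b) * D x $ j \<partial>lborel) = - (\<integral>x. a $ j * \<phi> x \<partial>lborel)"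
proof -
  define \<psi> where "\<psi> = (\<lambda>x. (a \<bullet> x + b) * \<phi> x)"
  define G where "G = (\<lambda>x. (a \<bullet> x + b) *\<^sub>R D x + \<phi> x *\<^sub>R a)"
  have cont: "continuous_on UNIV \<phi>" using D(1) by (rule gderiv_continuous)
  have D0: "D x = 0" if "x \<notin> K" for x using gderiv_zero_outside[OF D(1) K that] .
  have "GDERIV \<psi> x :> G x" for x
  proof -
    have "GDERIV (\<lambda>x. a \<bullet> x + b) x :> a"
      unfolding gderiv_def by (auto intro!: derivative_eq_intros simp: inner_commute)
    from GDERIV_mult[OF this D(1)] show ?thesis by (simp add: \<psi>_def G_def)
  qed
  moreover have "continuous_on UNIV G" unfolding G_def using D(2) cont by (intro continuous_intros)
  moreover have "\<psi> x = 0" if "x \<notin> K" for x using K(2)[OF that] by (simp add: \<psi>_def)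
  ultimately have "(\<integral>x. G x \<bullet> axis j 1 \<partial>lborel) = 0"
    using K(1) by (intro integral_gradient_compact_support[of \<psi> G K]) auto
  also have "(\<lambda>x. G x \<bullet> axis j 1) = (\<lambda>x. (a \<bullet> x + b) * D x $ j + a $ j * \<phi> x)"
    by (simp add: G_def inner_axis ac_simps)
  finally have 0: "(\<integral>x. (a \<bullet> x + b) * D x $ j + a $ j * \<phi> x \<partial>lborel) = 0" .
  have "integrable lborel (\<lambda>x. (a \<bullet> x + b) * D x $ j)"
    by (rule integrable_continuous_compact_support[of _ K])
      (use D(2) D0 K in \<open>auto intro!: continuous_intros\<close>)
  moreover have "integrable lborel (\<lambda>x. a $ j * \<phi> x)"
    by (rule integrable_continuous_compact_support[of _ K])
      (use cont K in \<open>auto intro!: continuous_intros\<close>)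
  ultimately show ?thesis using 0 by (simp add: Bochner_Integration.integral_add)
qed

text \<open>A continuously differentiable function that is positive exactly in the ball with centre \<open>c\<close> and radius \<open>r\<close>;
the square removes the kink of the positive part.\<close>
definition bump :: "'a::euclidean_space \<Rightarrow> real \<Rightarrow> 'a \<Rightarrow> real" where
  "bump c r x = (max 0 (r\<^sup>2 - (x - c) \<bullet> (x - c)))\<^sup>2"

definition bump_grad :: "'a::euclidean_space \<Rightarrow> real \<Rightarrow> 'a \<Rightarrow> 'a" where
  "bump_grad c r x = (- 4 * max 0 (r\<^sup>2 - (x - c) \<bullet> (x - c))) *\<^sub>R (x - c)"

lemma DERIV_max0_power2: "DERIV (\<lambda>t::real. (max 0 t)\<^sup>2) t :> 2 * max 0 t"
proof -
  consider "t < 0" | "t > 0" | "t = 0" by linarith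
  then show ?thesis
  proof cases
    case 1
    have "DERIV (\<lambda>t. 0) t :> 0" by simp
    then show ?thesis using 1
      by (auto intro: has_field_derivative_transform_within_open[of "\<lambda>_. 0" 0 t "{..<0}"])
  next
    case 2
    have "DERIV (\<lambda>t. t\<^sup>2) t :> 2 * t" by (auto intro!: derivative_eq_intros)
    then show ?thesis using 2
      by (auto intro: has_field_derivative_transform_within_open[of "\<lambda>t. t\<^sup>2" _ t "{0<..}"])
  next
    case 3
    have "(\<lambda>h::real. (max 0 h)\<^sup>2 / h) \<midarrow>0\<rightarrow> 0"
    proof (rule Lim_null_comparison[where g = "\<lambda>h. \<bar>h\<bar>"])
      show "\<forall>\<^sub>F h in at 0. norm ((max 0 h)\<^sup>2 / h) \<le> \<bar>h::real\<bar>"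
        by (auto simp: max_def power2_eq_square intro!: always_eventually)
      show "((\<lambda>h::real. \<bar>h\<bar>) \<longlongrightarrow> 0) (at 0)" by (auto intro!: tendsto_eq_intros)
    qed
    then show ?thesis using 3 by (simp add: DERIV_def)
  qed
qed

lemma bump_gderiv: "GDERIV (bump c r) x :> bump_grad c r x"
proof -
  have "GDERIV (\<lambda>x. r\<^sup>2 - (x - c) \<bullet> (x - c)) x :> - 2 *\<^sub>R (x - c)"
    unfolding gderiv_def by (auto intro!: derivative_eq_intros simp: inner_commute)
  from GDERIV_DERIV_compose[OF this DERIV_max0_power2] show ?thesis
    by (simp add: bump_def[abs_def] bump_grad_def)
qed

lemma bump_pos: "0 < r \<Longrightarrow> 0 < bump c r x \<longleftrightarrow> x \<in> ball c r"
proof -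
  assume r: "0 < r"
  have "0 < bump c r x \<longleftrightarrow> (x - c) \<bullet> (x - c) < r\<^sup>2" by (auto simp: bump_def max_def)
  also have "\<dots> \<longleftrightarrow> (norm (x - c))\<^sup>2 < r\<^sup>2" by (simp add: power2_norm_eq_inner)
  also have "\<dots> \<longleftrightarrow> norm (x - c) < r" using r by (auto simp: power_strict_mono intro: power2_less_imp_less)
  finally show ?thesis by (simp add: dist_norm norm_minus_commute)
qed

lemma bump_nonneg: "0 \<le> bump c r x"
  by (simp add: bump_def)

lemma continuous_bump_grad: "continuous_on UNIV (bump_grad c r)"
  unfolding bump_grad_def by (intro continuous_intros)

text \<open>Cover \<open>V\<close> by countably many balls whose closures lie in \<open>V\<close>, and let \<open>p\<^sub>n\<close> be the sum of their bumps up to number \<open>n\<close>. The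
test functions \<open>n p\<^sub>n / (1 + n p\<^sub>n)\<close> take values in \<open>[0, 1]\<close> and converge pointwise to the indicator
of \<open>V\<close>, so dominated convergence applies.\<close>
lemma integral_open_eq_0:
  fixes h :: "real^'n::finite \<Rightarrow> real"
  assumes h: "integrable lborel h" and V: "open V" "V \<subseteq> W"
    and test: "\<And>\<phi> D. test_function W \<phi> D \<Longrightarrow> (\<integral>x. h x * \<phi> x \<partial>lborel) = 0"
  shows "(\<integral>x. h x * indicator V x \<partial>lborel) = 0"
proof (cases "V = {}")
  case False
  define \<F> where "\<F> = {ball x r | x r. 0 < r \<and> cball x r \<subseteq> V}"
  obtain \<F>' where F': "\<F>' \<subseteq> \<F>" "countable \<F>'" "\<Union>\<F>' = \<Union>\<F>"
    using Lindelof[of \<F>] by (auto simp: \<F>_def)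
  have "\<Union>\<F> = V"
  proof
    show "V \<subseteq> \<Union>\<F>"
    proof
      fix x assume "x \<in> V"
      then obtain r where "0 < r" "cball x r \<subseteq> V" using V by (auto simp: open_contains_cball)
      then have "ball x r \<in> \<F>" "x \<in> ball x r" by (auto simp: \<F>_def)
      then show "x \<in> \<Union>\<F>" by blast
    qed
  qed (auto simp: \<F>_def)
  then have UF': "\<Union>\<F>' = V" using F' by simp
  then have ne: "\<F>' \<noteq> {}" using False by auto
  have "\<forall>k. \<exists>c r. from_nat_into \<F>' k = ball c r \<and> 0 < r \<and> cball c r \<subseteq> V"
    using from_nat_into[OF ne] F'(1) by (fastforce simp: \<F>_def)
  then obtain c r where cr: "\<And>k. from_nat_into \<F>' k = ball (c k) (r k)" "\<And>k. 0 < r k" "\<And>k. cball (c k) (r k) \<subseteq> V"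
    by metis
  have V_eq: "V = (\<Union>k. ball (c k) (r k))"
    using UF' range_from_nat_into[OF ne F'(2)] cr(1) by (metis (no_types, lifting) image_cong)
  define p where "p = (\<lambda>n x. \<Sum>k\<le>n. bump (c k) (r k) x)"
  define Dp where "Dp = (\<lambda>n x. \<Sum>k\<le>n. bump_grad (c k) (r k) x)"
  have pD: "GDERIV (p n) x :> Dp n x" for n x
    unfolding p_def Dp_def gderiv_def inner_sum_right
    by (rule has_derivative_sum) (use bump_gderiv in \<open>auto simp: gderiv_def\<close>)
  have p0: "0 \<le> p n x" for n x by (auto simp: p_def intro!: sum_nonneg bump_nonneg)
  have pV: "p n x = 0" if "x \<notin> (\<Union>k\<le>n. cball (c k) (r k))" for n x
  proof -
    have "bump (c k) (r k) x = 0" if "k \<le> n" for k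
    proof -
      have "x \<notin> ball (c k) (r k)" using that \<open>x \<notin> _\<close> ball_subset_cball by blast
      then show ?thesis using bump_pos[OF cr(2)[of k], of "c k" x] bump_nonneg[of "c k" "r k" x] by simp
    qed
    then show ?thesis by (simp add: p_def)
  qed
  define \<phi> where "\<phi> = (\<lambda>n x. real n * p n x / (1 + real n * p n x))"
  define D where "D = (\<lambda>n x. (real n / (1 + real n * p n x)\<^sup>2) *\<^sub>R Dp n x)"
  have pos: "0 < 1 + real n * p n x" for n x using p0[of n x] by (simp add: add_pos_nonneg)
  have test\<phi>: "test_function W (\<phi> n) (D n)" for n
    unfolding test_function_def
  proof (intro conjI allI exI[of _ "\<Union>k\<le>n. cball (c k) (r k)"] impI)
    show "GDERIV (\<phi> n) x :> D n x" for x
    proof -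
      have "DERIV (\<lambda>s. real n * s / (1 + real n * s)) (p n x) :> real n / (1 + real n * p n x)\<^sup>2"
        using pos[of n x] by (auto intro!: derivative_eq_intros simp: power2_eq_square field_simps)
      from GDERIV_DERIV_compose[OF pD this] show ?thesis by (simp add: \<phi>_def D_def)
    qed
    have "continuous_on UNIV (p n)" using pD by (rule gderiv_continuous)
    moreover have "continuous_on UNIV (Dp n)"
      unfolding Dp_def by (intro continuous_on_sum continuous_bump_grad)
    ultimately show "continuous_on UNIV (D n)"
      unfolding D_def using pos by (intro continuous_intros) (auto simp: less_imp_neq[THEN not_sym])
    show "compact (\<Union>k\<le>n. cball (c k) (r k))" by (intro compact_UN) auto
    show "(\<Union>k\<le>n. cball (c k) (r k)) \<subseteq> W" using cr(3) V by blast
    show "\<phi> n x = 0" if "x \<notin> (\<Union>k\<le>n. cball (c k) (r k))" for x using pV[OF that] by (simp add: \<phi>_def)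
  qed
  have \<phi>01: "0 \<le> \<phi> n x" "\<phi> n x \<le> 1" for n x using pos[of n x] p0[of n x] by (auto simp: \<phi>_def)
  have \<phi>lim: "(\<lambda>n. \<phi> n x) \<longlonglongrightarrow> indicator V x" for x
  proof (cases "x \<in> V")
    case True
    then obtain k where k: "x \<in> ball (c k) (r k)" using V_eq by auto
    define \<delta> where "\<delta> = bump (c k) (r k) x"
    have \<delta>: "0 < \<delta>" using bump_pos[OF cr(2)[of k], of "c k" x] k by (simp add: \<delta>_def)
    have ge: "\<delta> \<le> p n x" if "k \<le> n" for n
      unfolding \<delta>_def p_def using that by (intro member_le_sum) (auto simp: bump_nonneg)
    have "filterlim (\<lambda>n. \<delta> * real n) at_top sequentially"
      using \<delta> filterlim_real_sequentially by (intro filterlim_tendsto_pos_mult_at_top[OF tendsto_const])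
    moreover have "\<forall>\<^sub>F n in sequentially. \<delta> * real n \<le> 1 + real n * p n x"
      using eventually_ge_at_top[of k]
    proof eventually_elim
      case (elim n)
      then have "\<delta> * real n \<le> p n x * real n" using ge by (intro mult_right_mono) auto
      then show ?case by (simp add: mult.commute)
    qed
    ultimately have "filterlim (\<lambda>n. 1 + real n * p n x) at_top sequentially"
      by (rule filterlim_at_top_mono)
    then have "(\<lambda>n. inverse (1 + real n * p n x)) \<longlonglongrightarrow> 0" by (rule tendsto_inverse_0_at_top)
    then have "(\<lambda>n. 1 - inverse (1 + real n * p n x)) \<longlonglongrightarrow> 1 - 0" by (intro tendsto_intros)
    moreover have "1 - inverse (1 + real n * p n x) = \<phi> n x" for n
      using pos[of n x] by (simp add: \<phi>_def field_simps)
    ultimately show ?thesis using True by simp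
  next
    case False
    then have "p n x = 0" for n using pV[of x n] cr(3) by blast
    then show ?thesis using False by (simp add: \<phi>_def)
  qed
  have "(\<lambda>n. \<integral>x. h x * \<phi> n x \<partial>lborel) \<longlonglongrightarrow> (\<integral>x. h x * indicator V x \<partial>lborel)"
  proof (rule integral_dominated_convergence[where w = "\<lambda>x. norm (h x)"])
    have [measurable]: "h \<in> borel_measurable borel" using borel_measurable_integrable[OF h] by simp
    have [measurable]: "V \<in> sets borel" using V by simp
    show "(\<lambda>x. h x * indicator V x) \<in> borel_measurable lborel" by measurable
    show "(\<lambda>x. h x * \<phi> n x) \<in> borel_measurable lborel" for n
    proof -
      have "continuous_on UNIV (\<phi> n)" using test\<phi>[of n] by (auto simp: test_function_def intro: gderiv_continuous)
      then have [measurable]: "\<phi> n \<in> borel_measurable borel" by (rule borel_measurable_continuous_onI)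
      show ?thesis by measurable
    qed
    show "integrable lborel (\<lambda>x. norm (h x))" using h by simp
    show "AE x in lborel. (\<lambda>n. h x * \<phi> n x) \<longlonglongrightarrow> h x * indicator V x"
      by (intro AE_I2 tendsto_intros \<phi>lim)
    show "AE x in lborel. norm (h x * \<phi> n x) \<le> norm (h x)" for n
      using \<phi>01[of n] by (auto simp: abs_mult intro!: AE_I2 mult_left_le)
  qed
  moreover have "(\<integral>x. h x * \<phi> n x \<partial>lborel) = 0" for n using test[OF test\<phi>] .
  ultimately show ?thesis using LIMSEQ_const_iff[of 0] LIMSEQ_unique tendsto_const by fastforce
qed simp

text \<open>The open sets are an intersection-stable generator of the Borel sets, so all integrals over Borel sets vanish.\<close>
lemma du_bois_reymond:
  fixes h :: "real^'n::finite \<Rightarrow> real"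
  assumes h: "integrable lborel h" and W: "open W" "AE x in lborel. x \<notin> W \<longrightarrow> h x = 0"
    and test: "\<And>\<phi> D. test_function W \<phi> D \<Longrightarrow> (\<integral>x. h x * \<phi> x \<partial>lborel) = 0"
  shows "AE x in lborel. h x = 0"
proof (rule sigma_finite_measure.density_zero[OF sigma_finite_lborel h])
  fix A :: "(real^'n) set" assume "A \<in> sets lborel"
  then have A: "A \<in> sigma_sets UNIV {S. open S}" by (simp add: borel_def)
  have sets: "B \<in> sets borel" if "B \<in> sigma_sets UNIV {S. open S}" for B :: "(real^'n) set"
    using that by (simp add: borel_def)
  have hm[measurable]: "h \<in> borel_measurable borel" using borel_measurable_integrable[OF h] by simp
  have intB: "integrable lborel (\<lambda>x. h x * indicator B x)" if "B \<in> sets borel" for B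
    using integrable_mult_indicator[of B lborel h] h that by (simp add: mult.commute)
  have op: "(\<integral>x. h x * indicator V x \<partial>lborel) = 0" if "open V" for V
  proof -
    have [measurable]: "V \<in> sets borel" "W \<in> sets borel" using that W by auto
    have "(\<integral>x. h x * indicator V x \<partial>lborel) = (\<integral>x. h x * indicator (V \<inter> W) x \<partial>lborel)"
    proof (rule integral_cong_AE)
      show "AE x in lborel. h x * indicator V x = h x * indicator (V \<inter> W) x"
        using W(2) by eventually_elim (auto simp: indicator_def)
    qed measurable
    also have "\<dots> = 0" using that W by (intro integral_open_eq_0[OF h _ _ test]) auto
    finally show ?thesis .
  qed
  have stable: "Int_stable {S :: (real^'n) set. open S}" by (auto simp: Int_stable_def)
  have "{S. open S} \<subseteq> Pow UNIV" by simp
  note induct = sigma_sets_induct_disjoint[OF stable this A, case_names basic empty compl union]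
  have "(\<integral>x. h x * indicator A x \<partial>lborel) = 0"
  proof (induction rule: induct)
    case (basic V)
    then show ?case using op by simp
  next
    case empty
    then show ?case by simp
  next
    case (compl B)
    have "h x * indicator (UNIV - B) x = h x * indicator UNIV x - h x * indicator B x" for x
      by (simp add: indicator_def)
    then show ?case using compl op[of UNIV] intB[OF sets, of B] intB[of UNIV] by (simp add: h)
  next
    case (union B)
    have Bs: "B i \<in> sets lborel" for i using union(2) sets by auto
    have disj: "B i \<inter> B j = {}" if "i \<noteq> j" for i j using union(1) that by (auto simp: disjoint_family_on_def)
    have UB: "(\<Union>i. B i) \<in> sets borel" using Bs by auto
    have "(LINT x:(\<Union>i. B i)|lborel. h x) = (\<Sum>i. (LINT x:(B i)|lborel. h x))"
      using intB[OF UB] by (intro lebesgue_integral_countable_add Bs disj) (simp_all add: set_integrable_def ac_simps)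
    then show ?case using union(3) by (simp add: set_lebesgue_integral_def ac_simps)
  qed
  then show "set_lebesgue_integral lborel A h = 0" by (simp add: set_lebesgue_integral_def ac_simps)
qed


section \<open>Constancy of the stress on elements\<close>

lemma borel_measurable_vec_nth:
  fixes f :: "'a \<Rightarrow> 'b::euclidean_space^'n::finite"
  assumes "f \<in> borel_measurable M"
  shows "(\<lambda>x. f x $ i) \<in> borel_measurable M"
proof -
  have "(\<lambda>y. y $ i) \<in> borel_measurable (borel :: ('b^'n) measure)"
    by (intro borel_measurable_continuous_onI continuous_intros)
  from measurable_compose[OF assms this] show ?thesis .
qed

text \<open>Tested with functions that are supported in \<open>W\<close>, the weak gradient and the constant matrix give the same values; the
difference is zero by the fundamental lemma. As weak gradients are unique almost everywhere, this
determines the gradient that is selected by \<^const>\<open>weak_grad\<close>.\<close>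
lemma weak_gradient_affine:
  fixes v :: "real^'n::finite \<Rightarrow> real^'n"
  assumes wg: "weak_gradient \<Omega> v G" and G: "square_integrable (lebesgue_on \<Omega>) G"
    and v: "v \<in> borel_measurable (lebesgue_on \<Omega>)"
    and \<Omega>: "open \<Omega>" and W: "open W" "bounded W" "W \<subseteq> \<Omega>"
    and aff: "AE x in lebesgue. x \<in> W \<longrightarrow> v x = A *v x + b"
  shows "AE x in lebesgue. x \<in> W \<longrightarrow> G x = A"
proof -
  have sets: "\<Omega> \<in> sets lebesgue" "W \<in> sets lebesgue" using \<Omega> W by auto
  have fin: "emeasure lebesgue W < \<infinity>" using W emeasure_bounded_finite[of W] by simp
  define Gt where "Gt = (\<lambda>x. indicator \<Omega> x *\<^sub>R G x)"
  have Gt_m: "Gt \<in> borel_measurable lebesgue"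
    using G sets by (simp add: square_integrable_def Gt_def borel_measurable_restrict_space_iff)
  have "integrable lebesgue (\<lambda>x. indicator \<Omega> x *\<^sub>R (norm (G x))\<^sup>2)"
    using G sets by (simp add: square_integrable_def integrable_restrict_space)
  also have "(\<lambda>x. indicator \<Omega> x *\<^sub>R (norm (G x))\<^sup>2) = (\<lambda>x. (norm (Gt x))\<^sup>2)"
    by (auto simp: Gt_def indicator_def)
  finally have Gt_i: "integrable lebesgue (\<lambda>x. (norm (Gt x))\<^sup>2)" .
  have "AE x in lebesgue. x \<in> W \<longrightarrow> G x $ i $ j = A $ i $ j" for i j
  proof -
    have m[measurable]: "(\<lambda>x. Gt x $ i $ j) \<in> borel_measurable lebesgue"
      by (intro borel_measurable_vec_nth Gt_m)
    have [measurable]: "W \<in> sets lebesgue" by (rule sets)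
    \<comment> \<open>the difference to be shown zero, extended by zero to a function on the whole space; it is only Lebesgue
      measurable and is replaced by a Borel function \<open>h\<close>\<close>
    define h0 where "h0 = (\<lambda>x. indicator W x * (Gt x $ i $ j - A $ i $ j))"
    have h0_m[measurable]: "h0 \<in> borel_measurable lebesgue" unfolding h0_def by measurable
    have h0: "integrable lebesgue h0"
    proof (rule Bochner_Integration.integrable_bound)
      show "integrable lebesgue (\<lambda>x. indicator W x * (1 + \<bar>A $ i $ j\<bar>) + (norm (Gt x))\<^sup>2)"
        using fin sets by (intro Bochner_Integration.integrable_add Gt_i integrable_mult_left) (simp add: integrable_indicator_iff)
      show "AE x in lebesgue. norm (h0 x) \<le> norm (indicator W x * (1 + \<bar>A $ i $ j\<bar>) + (norm (Gt x))\<^sup>2)"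
      proof (rule AE_I2)
        fix x
        have "\<bar>Gt x $ i $ j\<bar> \<le> norm (Gt x)"
          using component_le_norm_cart[of "Gt x $ i" j] Finite_Cartesian_Product.norm_nth_le[of "Gt x" i] by simp
        also have "\<dots> \<le> 1 + (norm (Gt x))\<^sup>2"
          using zero_le_power2[of "norm (Gt x) - 1/2"] by (simp add: power2_eq_square algebra_simps)
        finally show "norm (h0 x) \<le> norm (indicator W x * (1 + \<bar>A $ i $ j\<bar>) + (norm (Gt x))\<^sup>2)"
          by (auto simp: h0_def indicator_def)
      qed
    qed (rule h0_m)
    obtain h where h: "h \<in> borel_measurable lborel" "AE x in lborel. h0 x = h x"
      using completion_ex_borel_measurable_real[OF h0_m] by auto
    have h': "AE x in lebesgue. h0 x = h x" using h(2) by (rule AE_completion)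
    have hm: "h \<in> borel_measurable lebesgue" using h(1) by (rule measurable_completion)
    have "integrable lebesgue h" using h0 h' hm integrable_cong_AE[OF h0_m hm] by simp
    then have hi: "integrable lborel h" using integrable_completion[OF h(1)] by simp
    have "AE x in lborel. h x = 0"
    proof (rule du_bois_reymond[OF hi W(1)])
      show "AE x in lborel. x \<notin> W \<longrightarrow> h x = 0"
        using h(2) by eventually_elim (auto simp: h0_def)
      fix \<phi> D assume test: "test_function W \<phi> D"
      then obtain K where D: "\<And>x. GDERIV \<phi> x :> D x" "continuous_on UNIV D"
        and K: "compact K" "K \<subseteq> W" "\<And>x. x \<notin> K \<Longrightarrow> \<phi> x = 0" by (auto simp: test_function_def)
      have test': "test_function \<Omega> \<phi> D" using test W(3) unfolding test_function_def by blast
      have D0: "D x = 0" if "x \<notin> K" for x using gderiv_zero_outside[OF D(1) K(1,3) that] .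
      have cont: "continuous_on UNIV \<phi>" using D(1) by (rule gderiv_continuous)
      have \<phi>m: "\<phi> \<in> borel_measurable lborel" using cont by (simp add: borel_measurable_continuous_onI)
      have Dm: "(\<lambda>x. D x $ j) \<in> borel_measurable lborel" using D(2) by (auto intro!: borel_measurable_continuous_onI continuous_intros)
      have \<phi>i: "integrable lborel \<phi>" by (rule integrable_continuous_compact_support[OF cont K(1,3)])
      obtain B where B: "\<And>x. x \<in> K \<Longrightarrow> norm (\<phi> x) \<le> B"
        using compact_imp_bounded[OF compact_continuous_image[OF continuous_on_subset[OF cont] K(1)]]
        by (auto simp: bounded_iff)
      have h0\<phi>: "integrable lebesgue (\<lambda>x. h0 x * \<phi> x)"
      proof (rule Bochner_Integration.integrable_bound)
        show "integrable lebesgue (\<lambda>x. \<bar>B\<bar> * norm (h0 x))" using h0 by simp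
        show "(\<lambda>x. h0 x * \<phi> x) \<in> borel_measurable lebesgue"
          by (intro borel_measurable_times h0_m measurable_completion \<phi>m)
        show "AE x in lebesgue. norm (h0 x * \<phi> x) \<le> norm (\<bar>B\<bar> * norm (h0 x))"
        proof (rule AE_I2)
          fix x
          have "norm (\<phi> x) \<le> \<bar>B\<bar>" using B[of x] K(3)[of x] by (cases "x \<in> K") auto
          then show "norm (h0 x * \<phi> x) \<le> norm (\<bar>B\<bar> * norm (h0 x))"
            by (simp add: abs_mult mult.commute mult_right_mono)
        qed
      qed
      have "integrable lebesgue (\<lambda>x. A $ i $ j * \<phi> x)"
        using \<phi>i integrable_completion[OF \<phi>m] by simp
      note A\<phi> = this
      have "(\<integral>x. (A $ i \<bullet> x + b $ i) * D x $ j \<partial>lborel) = - (\<integral>x. A $ i $ j * \<phi> x \<partial>lborel)"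
        by (rule integral_affine_mult_gradient[OF D K(1,3)])
      also have "(\<integral>x. (A $ i \<bullet> x + b $ i) * D x $ j \<partial>lborel) = (\<integral>x. (A $ i \<bullet> x + b $ i) * D x $ j \<partial>lebesgue)"
        by (rule integral_completion[symmetric]) (use D(2) in \<open>auto intro!: borel_measurable_continuous_onI continuous_intros\<close>)
      also have "\<dots> = (\<integral>x. indicator \<Omega> x *\<^sub>R (v x $ i * D x $ j) \<partial>lebesgue)"
      proof (rule integral_cong_AE)
        show "(\<lambda>x. (A $ i \<bullet> x + b $ i) * D x $ j) \<in> borel_measurable lebesgue"
        proof -
          have "(\<lambda>x. (A $ i \<bullet> x + b $ i) * D x $ j) \<in> borel_measurable lborel"
            using D(2) by (auto intro!: borel_measurable_continuous_onI continuous_intros)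
          then show ?thesis by (rule measurable_completion)
        qed
        have "(\<lambda>x. v x $ i * D x $ j) \<in> borel_measurable (lebesgue_on \<Omega>)"
        proof (rule borel_measurable_times)
          show "(\<lambda>x. v x $ i) \<in> borel_measurable (lebesgue_on \<Omega>)" by (rule borel_measurable_vec_nth[OF v])
          have "(\<lambda>x. D x $ j) \<in> borel_measurable lebesgue" using Dm by (rule measurable_completion)
          then show "(\<lambda>x. D x $ j) \<in> borel_measurable (lebesgue_on \<Omega>)" by (rule measurable_restrict_space1)
        qed
        then show "(\<lambda>x. indicator \<Omega> x *\<^sub>R (v x $ i * D x $ j)) \<in> borel_measurable lebesgue"
          using sets by (simp add: borel_measurable_restrict_space_iff)
        show "AE x in lebesgue. (A $ i \<bullet> x + b $ i) * D x $ j = indicator \<Omega> x *\<^sub>R (v x $ i * D x $ j)"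
          using aff
        proof eventually_elim
          case (elim x)
          show ?case
          proof (cases "x \<in> W")
            case True
            then have "v x $ i = A $ i \<bullet> x + b $ i" using elim by (simp add: matrix_vector_mul_component)
            then show ?thesis using True W by (auto simp: indicator_def)
          next
            case False
            then have "D x = 0" using D0 K by auto
            then show ?thesis by simp
          qed
        qed
      qed
      also have "\<dots> = (\<integral>x. v x $ i * D x $ j \<partial>lebesgue_on \<Omega>)"
        using sets by (simp add: integral_restrict_space)
      also have "\<dots> = - (\<integral>x. G x $ i $ j * \<phi> x \<partial>lebesgue_on \<Omega>)"
        using wg test' unfolding weak_gradient_def by blast
      also have "(\<integral>x. G x $ i $ j * \<phi> x \<partial>lebesgue_on \<Omega>) = (\<integral>x. indicator \<Omega> x *\<^sub>R (G x $ i $ j * \<phi> x) \<partial>lebesgue)"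
        using sets by (simp add: integral_restrict_space)
      also have "(\<lambda>x. indicator \<Omega> x *\<^sub>R (G x $ i $ j * \<phi> x)) = (\<lambda>x. h0 x * \<phi> x + A $ i $ j * \<phi> x)"
      proof
        fix x
        show "indicator \<Omega> x *\<^sub>R (G x $ i $ j * \<phi> x) = h0 x * \<phi> x + A $ i $ j * \<phi> x"
          using K(2) K(3)[of x] W by (cases "x \<in> W") (auto simp: h0_def Gt_def algebra_simps indicator_def)
      qed
      also have "(\<integral>x. h0 x * \<phi> x + A $ i $ j * \<phi> x \<partial>lebesgue) = (\<integral>x. h0 x * \<phi> x \<partial>lebesgue) + (\<integral>x. A $ i $ j * \<phi> x \<partial>lebesgue)"
        by (rule Bochner_Integration.integral_add[OF h0\<phi> A\<phi>])
      also have "(\<integral>x. A $ i $ j * \<phi> x \<partial>lebesgue) = (\<integral>x. A $ i $ j * \<phi> x \<partial>lborel)"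
        by (rule integral_completion) (use \<phi>m in simp)
      finally have "(\<integral>x. h0 x * \<phi> x \<partial>lebesgue) = 0" by simp
      also have "(\<integral>x. h0 x * \<phi> x \<partial>lebesgue) = (\<integral>x. h x * \<phi> x \<partial>lebesgue)"
      proof (rule integral_cong_AE)
        have "\<phi> \<in> borel_measurable lebesgue" using \<phi>m by (rule measurable_completion)
        then show "(\<lambda>x. h0 x * \<phi> x) \<in> borel_measurable lebesgue" "(\<lambda>x. h x * \<phi> x) \<in> borel_measurable lebesgue"
          using hm h0_m by (auto intro: borel_measurable_times)
        show "AE x in lebesgue. h0 x * \<phi> x = h x * \<phi> x" using h' by eventually_elim simp
      qed
      also have "\<dots> = (\<integral>x. h x * \<phi> x \<partial>lborel)"
        by (rule integral_completion) (use \<phi>m h(1) in simp)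
      finally show "(\<integral>x. h x * \<phi> x \<partial>lborel) = 0" .
    qed
    then have "AE x in lebesgue. h x = 0" by (rule AE_completion)
    with h' show ?thesis
      by eventually_elim (use W in \<open>auto simp: h0_def Gt_def indicator_def split: if_splits\<close>)
  qed
  then have "AE x in lebesgue. \<forall>i\<in>UNIV. \<forall>j\<in>UNIV. x \<in> W \<longrightarrow> G x $ i $ j = A $ i $ j"
    by (intro AE_finite_allI) auto
  then show ?thesis by eventually_elim (auto simp: vec_eq_iff)
qed

abbreviation ae_constant_on :: "(real^'n::finite) set \<Rightarrow> (real^'n \<Rightarrow> 'b) \<Rightarrow> bool" where
  "ae_constant_on T \<tau> \<equiv> \<exists>s. AE x in lebesgue. x \<in> T \<longrightarrow> \<tau> x = s"

lemma stress_constant_on_element: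
  fixes T :: "(real^'n::finite) set"
  assumes U: "U \<in> space_X \<Omega> \<Gamma>D \<K>" and T: "T \<in> \<K>" "compact T" "convex T" "interior T \<subseteq> \<Omega>" and \<Omega>: "open \<Omega>"
  shows "ae_constant_on T (stress \<Omega> \<C> U)"
proof -
  obtain v q \<beta> where U_eq: "U = (v, q, \<beta>)" by (cases U)
  have v: "v \<in> H1 \<Omega>" using U by (auto simp: U_eq space_X_def space_V_def)
  have Tm: "T \<in> sets lebesgue" using T(2) by (simp add: lmeasurable_compact fmeasurableD)
  obtain A b where "AE x in lebesgue_on T. v x = A *v x + b"
    using U T(1) by (auto simp: U_eq space_X_def)
  then have Ab: "AE x in lebesgue. x \<in> T \<longrightarrow> v x = A *v x + b"
    using Tm by (simp add: AE_restrict_space_iff)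
  obtain c where "AE x in lebesgue_on T. q x = c"
    using U T(1) by (auto simp: U_eq space_X_def)
  then have c: "AE x in lebesgue. x \<in> T \<longrightarrow> q x = c"
    using Tm by (simp add: AE_restrict_space_iff)
  have wg: "square_integrable (lebesgue_on \<Omega>) (weak_grad \<Omega> v)" "weak_gradient \<Omega> v (weak_grad \<Omega> v)"
    using someI_ex[of "\<lambda>G. square_integrable (lebesgue_on \<Omega>) G \<and> weak_gradient \<Omega> v G"] v
    by (auto simp: H1_def weak_grad_def)
  have "AE x in lebesgue. x \<in> interior T \<longrightarrow> weak_grad \<Omega> v x = A"
  proof (rule weak_gradient_affine[OF wg(2,1) _ \<Omega>])
    show "v \<in> borel_measurable (lebesgue_on \<Omega>)" using v by (simp add: H1_def square_integrable_def)
    show "bounded (interior T)" using T(2) by (simp add: compact_imp_bounded bounded_interior)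
    show "AE x in lebesgue. x \<in> interior T \<longrightarrow> v x = A *v x + b"
      using Ab by eventually_elim (use interior_subset in auto)
  qed (use T in auto)
  moreover have "AE x in lebesgue. x \<notin> frontier T"
    using negligible_convex_frontier[OF T(3)] by (intro AE_not_in) (simp add: negligible_iff_null_sets)
  ultimately have "AE x in lebesgue. x \<in> T \<longrightarrow> stress \<Omega> \<C> U x = \<C> ((1/2) *\<^sub>R (A + transpose A) - c)"
    using c
  proof eventually_elim
    case (elim x)
    then show ?case using T(2)
      by (auto simp: U_eq stress_def strain_def frontier_def compact_imp_closed closure_closed)
  qed
  then show ?thesis by blast
qed


section \<open>Facets of a conforming mesh\<close>

text \<open>The outer normal exists and is unique for a facet of a simplex; unlike \<^const>\<open>facet_normal\<close>
it depends on the element and not on the mesh.\<close>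
definition unit_normal :: "(real^'n::finite) set \<Rightarrow> (real^'n) set \<Rightarrow> real^'n" where
  "unit_normal T E = (SOME \<nu>. outer_normal T E \<nu>)"

lemma unit_normal:
  fixes T :: "(real^'n::finite) set"
  assumes "CARD('n) simplex T" "E facet_of T"
  shows "\<exists>b. facet_frame T E (unit_normal T E) b" "outer_normal T E \<nu> \<longleftrightarrow> \<nu> = unit_normal T E"
proof -
  obtain \<mu> b where fr: "facet_frame T E \<mu> b" using simplex_facet_frame[of T E] assms by auto
  have "outer_normal T E (unit_normal T E)"
    unfolding unit_normal_def by (rule someI[of _ \<mu>]) (simp add: outer_normal_iff[OF fr])
  then have eq: "unit_normal T E = \<mu>" by (simp add: outer_normal_iff[OF fr])
  show "\<exists>b. facet_frame T E (unit_normal T E) b" using fr eq by auto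
  show "outer_normal T E \<nu> \<longleftrightarrow> \<nu> = unit_normal T E" unfolding eq by (rule outer_normal_iff[OF fr])
qed

lemma norm_unit_normal:
  fixes T :: "(real^'n::finite) set"
  assumes "CARD('n) simplex T" "E facet_of T"
  shows "norm (unit_normal T E) = 1"
  using unit_normal(2)[OF assms, of "unit_normal T E"] by (simp add: outer_normal_def)

lemma facet_frame_nonempty:
  assumes "facet_frame T E \<nu> b" shows "E \<noteq> {}"
proof
  assume "E = {}"
  then have "b *\<^sub>R \<nu> \<notin> affine hull E" by simp
  then show False using assms by (simp add: facet_frame_def dot_square_norm)
qed

text \<open>A hyperplane has only two unit normals, so the position of two simplices relative to a common facet either agrees or
is opposite.\<close>
lemma facet_frames_cases:
  fixes T1 T2 :: "(real^'n::finite) set"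
  assumes fr1: "facet_frame T1 E \<nu>1 b1" and fr2: "facet_frame T2 E \<nu>2 b2"
  shows "\<nu>2 = \<nu>1 \<and> b2 = b1 \<or> \<nu>2 = - \<nu>1 \<and> b2 = - b1"
proof -
  obtain x where x: "x \<in> E" using facet_frame_nonempty[OF fr1] by auto
  obtain v where v: "v \<in> T2" "\<nu>2 \<bullet> v < b2" "T2 = convex hull (insert v E)"
    and aff: "affine hull E = {x. \<nu>2 \<bullet> x = b2}" using fr2 by (auto simp: facet_frame_def)
  have aff1: "affine hull E = {x. \<nu>1 \<bullet> x = b1}" "norm \<nu>1 = 1" using fr1 by (auto simp: facet_frame_def)
  have b: "b1 = \<nu>1 \<bullet> x" "b2 = \<nu>2 \<bullet> x" using facet_frame_eq[OF fr1 x] facet_frame_eq[OF fr2 x] by simp_all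
  have "v \<notin> affine hull E" using v aff by simp
  then consider "\<nu>1 \<bullet> v < b1" | "(-\<nu>1) \<bullet> v < - b1" using aff1 by fastforce
  then show ?thesis
  proof cases
    case 1
    then have "facet_frame T2 E \<nu>1 b1" using v aff1 by (auto simp: facet_frame_def)
    then have "\<nu>1 = \<nu>2" using outer_normal_iff[OF fr2] outer_normal_iff by blast
    then show ?thesis using b by simp
  next
    case 2
    have "facet_frame T2 E (-\<nu>1) (-b1)"
      unfolding facet_frame_def using v(1,3) aff1 2 by (auto intro!: bexI[of _ v])
    then have "-\<nu>1 = \<nu>2" using outer_normal_iff[OF fr2] outer_normal_iff by blast
    then show ?thesis using b by auto
  qed
qed

definition facet_const :: "nat \<Rightarrow> real" where
  "facet_const d = unit_ball_vol (real (d - 1)) * real (d - 1) ^ (d - 1)"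

lemma facet_surface_measure:
  fixes T :: "(real^'n::finite) set"
  assumes T: "CARD('n) simplex T" and E: "E facet_of T"
  shows "emeasure surface_measure E < \<infinity>"
    "area E \<le> facet_const CARD('n) * diameter E ^ (CARD('n) - 1)"
proof -
  obtain S where S: "\<not> affine_dependent S" "int (card S) = int (CARD('n)) + 1" "T = convex hull S"
    using T by (auto simp: simplex_def)
  have "E \<noteq> {} \<and> (\<exists>u. u \<in> S \<and> E = convex hull (S - {u}))"
    using E S(3) facet_of_convex_hull_affine_independent[OF S(1), of E] by blast
  then obtain u where u: "u \<in> S" "E = convex hull (S - {u})" by blast
  have fin: "finite S" using S(2) by (metis card.infinite of_nat_0 add_pos_nonneg less_numeral_extra(3) of_nat_0_le_iff add.commute zero_less_one)
  have "0 < CARD('n)" by simp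
  then have card: "card (S - {u}) = Suc (CARD('n) - 1)" using S u fin by (simp add: card_Diff_singleton)
  have comp: "compact E" unfolding u(2) using fin by (intro finite_imp_compact_convex_hull) auto
  then have borel: "E \<in> sets borel" by (simp add: borel_compact)
  have "dist x y \<le> diameter E" if "x \<in> S - {u}" "y \<in> S - {u}" for x y
    using diameter_bounded_bound[OF compact_imp_bounded[OF comp]] that by (simp add: u(2) hull_inc)
  from hausdorff_outer_convex_hull_le[OF _ card this] fin
  have le: "emeasure surface_measure E \<le> ennreal (facet_const CARD('n) * diameter E ^ (CARD('n) - 1))"
    by (simp add: surface_measure_def emeasure_hausdorff_measure borel facet_const_def power_mult_distrib
        flip: u(2) mult.assoc)
  then show "emeasure surface_measure E < \<infinity>" using le_less_trans ennreal_less_top by force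
  have "0 \<le> facet_const CARD('n) * diameter E ^ (CARD('n) - 1)"
    using comp by (simp add: facet_const_def diameter_ge_0 compact_imp_bounded)
  then show "area E \<le> facet_const CARD('n) * diameter E ^ (CARD('n) - 1)"
    using le unfolding measure_def by (metis enn2real_leI)
qed

lemma surface_measure_face_null:
  fixes T F :: "(real^'n::finite) set"
  assumes T: "CARD('n) simplex T" and F: "F face_of T" "aff_dim F \<le> int CARD('n) - 2"
  shows "F \<in> null_sets surface_measure"
proof -
  obtain S where S: "\<not> affine_dependent S" "int (card S) = int (CARD('n)) + 1" "T = convex hull S"
    using T by (auto simp: simplex_def)
  obtain c where c: "c \<subseteq> S" "F = convex hull c"
    using F(1) S by (auto simp: face_of_convex_hull_affine_independent)
  have ind: "\<not> affine_dependent c" using S(1) c(1) by (meson affine_dependent_subset)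
  have fin: "finite c" using aff_independent_finite[OF ind] .
  have "int (card c) = aff_dim F + 1" using aff_dim_affine_independent[OF ind] by (simp add: c(2) aff_dim_convex_hull)
  then have card: "card c \<le> CARD('n) - 1" using F(2) by linarith
  have "F \<in> sets borel" unfolding c(2) using fin by (intro borel_compact finite_imp_compact_convex_hull)
  then show ?thesis
    using hausdorff_outer_convex_hull_null[OF fin card]
    by (intro null_setsI) (simp_all add: surface_measure_def emeasure_hausdorff_measure c(2))
qed

lemma eq_minus_self_imp_0: "x = - x \<Longrightarrow> x = 0" for x :: "'a::real_vector"
  by (metis add.right_inverse scaleR_2 scaleR_eq_0_iff zero_neq_numeral)

text \<open>The elements of a mesh on a Lipschitz domain have these properties (\<open>mesh_conforming\<close>). The last one excludes slits,
whose two sides would share facets that lie on the boundary.\<close>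
locale conforming_mesh =
  fixes \<Omega> :: "(real^'n::finite) set" and \<K> :: "(real^'n) set set"
  assumes finite_mesh: "finite \<K>"
    and simplices: "T \<in> \<K> \<Longrightarrow> CARD('n) simplex T"
    and conforming: "T \<in> \<K> \<Longrightarrow> T' \<in> \<K> \<Longrightarrow> T \<inter> T' face_of T"
    and covers: "\<Union>\<K> = closure \<Omega>"
    and open_domain: "open \<Omega>"
    and regular_domain: "interior (closure \<Omega>) \<subseteq> \<Omega>"
begin

lemma compact_element: "T \<in> \<K> \<Longrightarrow> compact T" and convex_element: "T \<in> \<K> \<Longrightarrow> convex T"
  using simplices by (auto intro: compact_simplex convex_simplex)

lemma aff_dim_element: "T \<in> \<K> \<Longrightarrow> aff_dim T = int CARD('n)"
  using simplices by (auto dest: aff_dim_simplex)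

lemma interior_element: "T \<in> \<K> \<Longrightarrow> interior T \<noteq> {}"
proof -
  assume T: "T \<in> \<K>"
  have "affine hull T = UNIV" using aff_dim_element[OF T] aff_dim_eq_full[of T] by simp
  moreover have "T \<noteq> {}" using aff_dim_element[OF T] by auto
  ultimately show ?thesis using convex_element[OF T] rel_interior_interior rel_interior_eq_empty by metis
qed

lemma interior_subset_domain: "T \<in> \<K> \<Longrightarrow> interior T \<subseteq> \<Omega>"
  using covers regular_domain interior_mono[of T "closure \<Omega>"] by auto

lemma measure_element_pos: "T \<in> \<K> \<Longrightarrow> 0 < volume T"
proof -
  assume T: "T \<in> \<K>"
  have "\<not> negligible (interior T)" using interior_element[OF T] open_not_negligible by blast
  then have "\<not> negligible T" using interior_subset negligible_subset by blast
  then show ?thesis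
    using lmeasurable_compact[OF compact_element[OF T]] by (metis negligible_iff_measure zero_less_measure_iff)
qed

lemma bounded_domain: "bounded \<Omega>"
proof -
  have "compact (\<Union>\<K>)" using finite_mesh compact_element by (intro compact_Union) auto
  then show ?thesis by (metis covers bounded_closure_image bounded_subset closure_subset compact_imp_bounded)
qed

lemma facet_props:
  assumes "T \<in> \<K>" "E facet_of T"
  shows "E face_of T" "compact E" "convex E" "E \<noteq> {}" "aff_dim E = int CARD('n) - 1" "E \<subseteq> T"
proof -
  show 1: "E face_of T" "E \<noteq> {}" "aff_dim E = int CARD('n) - 1"
    using assms aff_dim_element by (auto simp: facet_of_def)
  show "compact E" "convex E" "E \<subseteq> T"
    using 1 face_of_imp_compact compact_element convex_element face_of_imp_convex face_of_imp_subset assms by blast+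
qed

text \<open>Otherwise \<open>T1\<close> would be a proper face of \<open>T2\<close> and have smaller dimension.\<close>
lemma element_not_subset:
  assumes "T1 \<in> \<K>" "T2 \<in> \<K>" "T1 \<noteq> T2" shows "T1 \<inter> T2 \<noteq> T1"
proof
  assume eq: "T1 \<inter> T2 = T1"
  have "T2 \<inter> T1 face_of T2" using assms by (intro conforming)
  then have "T1 face_of T2" using eq by (simp add: Int_commute)
  then have "aff_dim T1 < aff_dim T2" using assms by (intro face_of_aff_dim_lt convex_element)
  then show False using assms by (simp add: aff_dim_element)
qed

lemma interiors_disjoint:
  assumes "T1 \<in> \<K>" "T2 \<in> \<K>" "T1 \<noteq> T2" shows "interior (T1 \<inter> T2) = {}"
proof -
  have "(T1 \<inter> T2) \<inter> interior T1 = {}"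
    using conforming[OF assms(1,2)] element_not_subset[OF assms] by (rule face_of_disjoint_interior)
  then show ?thesis using interior_subset interior_mono[of "T1 \<inter> T2" T1] by blast
qed

lemma shared_facet_frames:
  assumes T: "T1 \<in> \<K>" "T2 \<in> \<K>" "T1 \<noteq> T2" and E: "convex E"
    and fr: "facet_frame T1 E \<nu>1 b1" "facet_frame T2 E \<nu>2 b2"
  shows "\<nu>2 = - \<nu>1 \<and> b2 = - b1"
  using facet_frames_cases[OF fr] facets_same_side_overlap[OF fr(1), of T2] fr interiors_disjoint[OF T]
    E facet_frame_nonempty by blast

lemma shared_facet_normals:
  assumes "T1 \<in> \<K>" "T2 \<in> \<K>" "T1 \<noteq> T2" "E facet_of T1" "E facet_of T2"
  shows "unit_normal T2 E = - unit_normal T1 E"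
  using unit_normal(1)[OF simplices assms(4)] unit_normal(1)[OF simplices assms(5)] assms
    shared_facet_frames[OF assms(1-3)] facet_props(3) by blast

lemma shared_facet_interior:
  assumes T: "T1 \<in> \<K>" "T2 \<in> \<K>" "T1 \<noteq> T2" "E facet_of T1" "E facet_of T2"
  shows "rel_interior E \<subseteq> \<Omega>"
proof -
  obtain b1 b2 where fr: "facet_frame T1 E (unit_normal T1 E) b1" "facet_frame T2 E (unit_normal T2 E) b2"
    using unit_normal(1)[OF simplices] T by blast
  have E: "convex E" using facet_props T by blast
  have "facet_frame T2 E (- unit_normal T1 E) (- b1)"
    using shared_facet_frames[OF T(1-3) E fr] fr by simp
  then have "rel_interior E \<subseteq> interior (T1 \<union> T2)"
    using facets_opposite_sides_interior[OF fr(1) _ E] by simp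
  also have "\<dots> \<subseteq> interior (closure \<Omega>)" using T covers by (intro interior_mono) auto
  finally show ?thesis using regular_domain by blast
qed

lemma shared_facet_not_boundary:
  assumes T: "T1 \<in> \<K>" "T2 \<in> \<K>" "T1 \<noteq> T2" "E facet_of T1" "E facet_of T2"
  shows "\<not> E \<subseteq> frontier \<Omega>"
proof -
  have "rel_interior E \<noteq> {}" using facet_props[OF T(1,4)] by (simp add: rel_interior_eq_empty)
  then obtain y where "y \<in> E" "y \<in> \<Omega>" using shared_facet_interior[OF T] rel_interior_subset by blast
  then show ?thesis using open_domain by (auto simp: frontier_def interior_open)
qed

text \<open>Near a point \<open>y\<close> of \<open>\<Omega>\<close> in the relative interior of \<open>E\<close> the element \<open>T\<close> alone cannot cover \<open>\<Omega>\<close>, so another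
element contains \<open>y\<close>. It meets \<open>T\<close> in a common face, and a face that meets the relative interior of \<open>E\<close> contains \<open>E\<close>.\<close>
lemma interior_facet_shared:
  assumes T: "T \<in> \<K>" "E facet_of T" and E: "\<not> E \<subseteq> frontier \<Omega>"
  obtains T2 where "T2 \<in> \<K>" "T2 \<noteq> T" "E facet_of T2"
proof -
  note fp = facet_props[OF T]
  have "E \<subseteq> closure \<Omega>" using fp T covers by blast
  then obtain x where x: "x \<in> E" "x \<in> \<Omega>" using E open_domain by (auto simp: frontier_def interior_open)
  have "x \<in> closure (rel_interior E)"
    using convex_closure_rel_interior[OF fp(3)] x closure_subset by blast
  then obtain y where y: "y \<in> rel_interior E" "y \<in> \<Omega>"
    using open_domain x by (auto simp: closure_iff_nhds_not_empty)
  have yT: "y \<in> E" "y \<notin> interior T"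
  proof -
    show "y \<in> E" using y rel_interior_subset by blast
    moreover have "E \<noteq> T" using fp(5) aff_dim_element[OF T(1)] by auto
    ultimately show "y \<notin> interior T" using face_of_disjoint_interior[OF fp(1)] by blast
  qed
  have "\<exists>T2\<in>\<K>. T2 \<noteq> T \<and> y \<in> T2"
  proof (rule ccontr)
    assume no: "\<not> ?thesis"
    have "closed (\<Union>(\<K> - {T}))" using finite_mesh compact_element by (intro closed_Union) (auto intro: compact_imp_closed)
    then have "open (\<Omega> - \<Union>(\<K> - {T}))" using open_domain by (rule open_Diff[rotated])
    moreover have "\<Omega> - \<Union>(\<K> - {T}) \<subseteq> T" using covers closure_subset by blast
    moreover have "y \<in> \<Omega> - \<Union>(\<K> - {T})" using y no by auto
    ultimately show False using yT interior_maximal by blast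
  qed
  then obtain T2 where T2: "T2 \<in> \<K>" "T2 \<noteq> T" "y \<in> T2" by auto
  have face: "T \<inter> T2 face_of T" "T2 \<inter> T face_of T2" using T T2 by (auto intro: conforming)
  have "E \<subseteq> T \<inter> T2"
    by (rule subset_of_face_of[OF face(1)]) (use fp yT y T2 in auto)
  moreover have "aff_dim (T \<inter> T2) < aff_dim T"
    using face_of_aff_dim_lt[OF convex_element[OF T(1)] face(1)] element_not_subset[of T T2] T T2 by auto
  ultimately have dim: "aff_dim (T \<inter> T2) = aff_dim E"
    using aff_dim_subset[of E "T \<inter> T2"] fp(5) aff_dim_element[OF T(1)] by simp
  have "E face_of T \<inter> T2" using fp(1) \<open>E \<subseteq> T \<inter> T2\<close> face(1) by (simp add: face_of_face)
  have "convex (T \<inter> T2)" using convex_element T T2 by (intro convex_Int)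
  then have eq: "E = T \<inter> T2"
    using face_of_aff_dim_lt[OF _ \<open>E face_of T \<inter> T2\<close>] dim by force
  then have "E facet_of T2"
    using face(2) fp(4,5) aff_dim_element[OF T2(1)] by (auto simp: facet_of_def Int_commute)
  then show thesis using that T2 by blast
qed

text \<open>Distinct elements at a facet have opposite normals, so the description in \<^const>\<open>side\<close> determines one element.\<close>
lemma side_eq:
  assumes T: "T \<in> \<K>" "E facet_of T"
  shows "side \<K> E (unit_normal T E) = T"
  unfolding side_def
proof (rule the_equality)
  show "T \<in> \<K> \<and> E facet_of T \<and> outer_normal T E (unit_normal T E)"
    using T unit_normal(2)[OF simplices] by blast
  fix T' assume T': "T' \<in> \<K> \<and> E facet_of T' \<and> outer_normal T' E (unit_normal T E)"
  then have eq: "unit_normal T E = unit_normal T' E" using unit_normal(2)[OF simplices] by blast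
  show "T' = T"
  proof (rule ccontr)
    assume "T' \<noteq> T"
    then have "unit_normal T E = - unit_normal T' E" using T T' by (intro shared_facet_normals) auto
    then have "unit_normal T E = 0" using eq by (intro eq_minus_self_imp_0) simp
    then show False using norm_unit_normal[OF simplices[OF T(1)] T(2)] by simp
  qed
qed

lemma facet_normal_cases:
  assumes T: "T \<in> \<K>" "E facet_of T"
  obtains T' where "T' \<in> \<K>" "E facet_of T'" "facet_normal \<K> E = unit_normal T' E"
proof -
  have "\<exists>\<nu>. \<exists>T\<in>\<K>. E facet_of T \<and> outer_normal T E \<nu>" using T unit_normal(2)[OF simplices] by blast
  from someI_ex[OF this] show thesis
    unfolding facet_normal_def[symmetric] using that unit_normal(2)[OF simplices] by blast
qed

text \<open>The choice of the sign in \<^const>\<open>facet_normal\<close> cancels: it changes the sign of the jump as well.\<close>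
lemma jump_normal:
  assumes T: "T1 \<in> \<K>" "T2 \<in> \<K>" "T1 \<noteq> T2" "E facet_of T1" "E facet_of T2"
  shows "jump \<K> E \<tau> *v facet_normal \<K> E = (elem_value T1 \<tau> - elem_value T2 \<tau>) *v unit_normal T1 E"
proof -
  obtain T' where T': "T' \<in> \<K>" "E facet_of T'" "facet_normal \<K> E = unit_normal T' E"
    using facet_normal_cases[OF T(1,4)] .
  have nu: "unit_normal T2 E = - unit_normal T1 E" by (rule shared_facet_normals[OF T])
  have "T' = T1 \<or> T' = T2"
  proof (rule ccontr)
    assume "\<not> ?thesis"
    then have "unit_normal T' E = - unit_normal T1 E" "unit_normal T' E = - unit_normal T2 E"
      using T T' by (auto intro: shared_facet_normals)
    then have "unit_normal T1 E = 0" using nu by (intro eq_minus_self_imp_0) simp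
    then show False using norm_unit_normal[OF simplices[OF T(1)] T(4)] by simp
  qed
  then show ?thesis
  proof
    assume "T' = T1"
    then have "facet_normal \<K> E = unit_normal T1 E" "- facet_normal \<K> E = unit_normal T2 E" using T' nu by auto
    then show ?thesis using T by (simp add: jump_def side_eq)
  next
    assume "T' = T2"
    then have n: "facet_normal \<K> E = unit_normal T2 E" "- facet_normal \<K> E = unit_normal T1 E" using T' nu by auto
    then have "jump \<K> E \<tau> = elem_value T2 \<tau> - elem_value T1 \<tau>" using T by (simp add: jump_def side_eq)
    then show ?thesis by (simp add: n nu matrix_vector_mult_diff_rdistrib vec.neg)
  qed
qed

lemma interior_facet_residual:
  assumes T: "T1 \<in> \<K>" "T2 \<in> \<K>" "T1 \<noteq> T2" "E facet_of T1" "E facet_of T2"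
  shows "(facet_residual \<Omega> \<Gamma>D g \<C> \<K> z E)\<^sup>2
    = (norm ((elem_value T1 (stress \<Omega> \<C> z) - elem_value T2 (stress \<Omega> \<C> z)) *v unit_normal T1 E))\<^sup>2
      * area E"
proof -
  have "E \<in> sets borel" using facet_props[OF T(1,4)] by (simp add: borel_compact)
  then have "measure (restrict_space surface_measure E) E = area E"
    by (simp add: measure_restrict_space surface_measure_def)
  then show ?thesis
    using shared_facet_not_boundary[OF T]
    by (simp add: facet_residual_def jump_normal[OF T] L2_norm_def space_restrict_space surface_measure_def)
qed

lemma boundary_facet_residual:
  assumes T: "T \<in> \<K>" "E facet_of T" and E: "E \<subseteq> frontier \<Omega>"
  shows "facet_residual \<Omega> \<Gamma>D g \<C> \<K> z E = (if E \<subseteq> \<Gamma>D then 0 else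
     L2_norm (restrict_space surface_measure (E - \<Gamma>D)) (\<lambda>x. g x - elem_value T (stress \<Omega> \<C> z) *v unit_normal T E))"
proof -
  obtain T' where T': "T' \<in> \<K>" "E facet_of T'" "facet_normal \<K> E = unit_normal T' E"
    using facet_normal_cases[OF T] .
  have "T' = T" using shared_facet_not_boundary[OF T'(1) T(1) _ T'(2) T(2)] E by blast
  then show ?thesis using E T' T by (simp add: facet_residual_def side_eq)
qed

end


section \<open>Dependence of the residuals on the state\<close>

lemma elem_value_eq:
  assumes T: "T \<in> sets lebesgue" "0 < volume T" and s: "AE x in lebesgue. x \<in> T \<longrightarrow> \<tau> x = s"
  shows "elem_value T \<tau> = s"
  unfolding elem_value_def
proof (rule the_equality)
  have iff: "(AE x in lebesgue_on T. P x) \<longleftrightarrow> (AE x in lebesgue. x \<in> T \<longrightarrow> P x)" for P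
    using T by (simp add: AE_restrict_space_iff)
  show "AE x in lebesgue_on T. \<tau> x = s" using s by (simp add: iff)
  fix c assume "AE x in lebesgue_on T. \<tau> x = c"
  then have c: "AE x in lebesgue. x \<in> T \<longrightarrow> \<tau> x = c" by (simp add: iff)
  show "c = s"
  proof (rule ccontr)
    assume "c \<noteq> s"
    have "AE x in lebesgue. x \<in> T \<longrightarrow> False" using c s by eventually_elim (use \<open>c \<noteq> s\<close> in auto)
    then have "T \<in> null_sets lebesgue" using T(1) AE_iff_null_sets[of T lebesgue] by simp
    then show False using T(2) by (simp add: measure_eq_0_null_sets)
  qed
qed

lemma norm_matrix_vector_mult_le:
  fixes A :: "real^'n::finite^'m::finite"
  shows "norm (A *v x) \<le> norm A * norm x"
proof -
  have "norm (A *v x) = L2_set (\<lambda>i. \<bar>A $ i \<bullet> x\<bar>) UNIV"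
    by (simp add: norm_vec_def matrix_vector_mul_component)
  also have "\<dots> \<le> L2_set (\<lambda>i. norm (A $ i) * norm x) UNIV"
    by (rule L2_set_mono) (auto simp: Cauchy_Schwarz_ineq2)
  also have "\<dots> = norm A * norm x" by (simp add: norm_vec_def[of A] L2_set_left_distrib)
  finally show ?thesis .
qed

lemma young_norm:
  fixes x y :: "'a::real_normed_vector"
  assumes "0 < \<delta>"
  shows "(norm (x + y))\<^sup>2 \<le> (1 + \<delta>) * (norm x)\<^sup>2 + (1 + 1 / \<delta>) * (norm y)\<^sup>2"
proof -
  have "0 \<le> (\<delta> * norm x - norm y)\<^sup>2 / \<delta>" using assms by simp
  also have "\<dots> = \<delta> * (norm x)\<^sup>2 + (norm y)\<^sup>2 / \<delta> - 2 * norm x * norm y"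
    using assms by (simp add: power2_eq_square field_simps)
  finally have "(norm x + norm y)\<^sup>2 \<le> (1 + \<delta>) * (norm x)\<^sup>2 + (1 + 1 / \<delta>) * (norm y)\<^sup>2"
    by (simp add: power2_eq_square algebra_simps)
  moreover have "(norm (x + y))\<^sup>2 \<le> (norm x + norm y)\<^sup>2"
    by (intro power_mono norm_triangle_ineq) auto
  ultimately show ?thesis by linarith
qed

text \<open>Almost every point lies in at most one of the sets. The lemma is used for the Lebesgue measure on elements and for the
surface measure on facets.\<close>
lemma sum_integral_null_overlap:
  fixes \<rho> :: "'a \<Rightarrow> real"
  assumes P: "finite P" "\<And>p. p \<in> P \<Longrightarrow> A p \<in> sets M" "\<And>p. p \<in> P \<Longrightarrow> A p \<subseteq> B"
    and overlap: "\<And>p q. p \<in> P \<Longrightarrow> q \<in> P \<Longrightarrow> p \<noteq> q \<Longrightarrow> A p \<inter> A q \<in> null_sets M"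
    and \<rho>: "\<And>x. 0 \<le> \<rho> x" "integrable M (\<lambda>x. indicator B x * \<rho> x)"
  shows "(\<Sum>p\<in>P. \<integral>x. indicator (A p) x * \<rho> x \<partial>M) \<le> (\<integral>x. indicator B x * \<rho> x \<partial>M)"
proof -
  have int: "integrable M (\<lambda>x. indicator (A p) x * \<rho> x)" if "p \<in> P" for p
  proof -
    have "integrable M (\<lambda>x. indicator (A p) x *\<^sub>R (indicator B x * \<rho> x))"
      by (rule integrable_mult_indicator[OF P(2)[OF that] \<rho>(2)])
    also have "(\<lambda>x. indicator (A p) x *\<^sub>R (indicator B x * \<rho> x)) = (\<lambda>x. indicator (A p) x * \<rho> x)"
      using P(3)[OF that] by (auto simp: fun_eq_iff split: split_indicator)
    finally show ?thesis .
  qed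
  have "AE x in M. \<forall>p\<in>P. \<forall>q\<in>P. p \<noteq> q \<longrightarrow> x \<notin> A p \<inter> A q"
  proof (intro AE_finite_allI P(1))
    fix p q assume pq: "p \<in> P" "q \<in> P"
    show "AE x in M. p \<noteq> q \<longrightarrow> x \<notin> A p \<inter> A q"
      using AE_not_in[OF overlap[OF pq]] by (cases "p = q") simp_all
  qed
  then have ae: "AE x in M. (\<Sum>p\<in>P. indicator (A p) x * \<rho> x) \<le> indicator B x * \<rho> x"
  proof eventually_elim
    case (elim x)
    show ?case
    proof (cases "\<exists>p\<in>P. x \<in> A p")
      case True
      then obtain p where p: "p \<in> P" "x \<in> A p" by auto
      have "(\<Sum>q\<in>P. indicator (A q) x * \<rho> x) = (\<Sum>q\<in>P. if q = p then \<rho> x else 0)"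
        using elim p by (intro sum.cong) (auto simp: indicator_def)
      also have "\<dots> = \<rho> x" using P(1) p by simp
      finally show ?thesis using P(3)[OF p(1)] p(2) by (auto simp: indicator_def)
    next
      case False
      then have "(\<Sum>q\<in>P. indicator (A q) x * \<rho> x) = 0" by (intro sum.neutral) auto
      then show ?thesis using \<rho>(1)[of x] by simp
    qed
  qed
  have "(\<Sum>p\<in>P. \<integral>x. indicator (A p) x * \<rho> x \<partial>M) = (\<integral>x. (\<Sum>p\<in>P. indicator (A p) x * \<rho> x) \<partial>M)"
    using int by (simp add: Bochner_Integration.integral_sum)
  also have "\<dots> \<le> (\<integral>x. indicator B x * \<rho> x \<partial>M)"
    using int \<rho>(2) ae by (intro integral_mono_AE) auto
  finally show ?thesis .
qed

lemma square_integrable_restrict_subset: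
  assumes u: "square_integrable (restrict_space M A) u" and "A \<in> sets M" "B \<in> sets M" "B \<subseteq> A"
  shows "square_integrable (restrict_space M B) u"
proof -
  have eq: "restrict_space M B = restrict_space (restrict_space M A) B"
    using assms by (simp add: restrict_restrict_space Int_absorb1)
  have B: "B \<inter> space (restrict_space M A) \<in> sets (restrict_space M A)"
    using assms sets.sets_into_space[OF assms(3)] by (auto simp: space_restrict_space sets_restrict_space_iff Int_absorb2 le_infI1)
  have "integrable (restrict_space M A) (\<lambda>x. indicator B x *\<^sub>R (norm (u x))\<^sup>2)"
  proof (rule integrable_mult_indicator)
    show "B \<in> sets (restrict_space M A)" using assms by (simp add: sets_restrict_space_iff)
  qed (use u in \<open>simp add: square_integrable_def\<close>)
  then show ?thesis
    using u unfolding square_integrable_def eq integrable_restrict_space[OF B]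
    by (auto intro: measurable_restrict_space1)
qed

lemma integrable_norm_diff_const:
  fixes u :: "'a \<Rightarrow> 'b::euclidean_space"
  assumes u: "square_integrable M u" and M: "emeasure M (space M) < \<infinity>"
  shows "integrable M (\<lambda>x. (norm (u x - c))\<^sup>2)"
proof (rule Bochner_Integration.integrable_bound)
  have m: "u \<in> borel_measurable M" using u by (simp add: square_integrable_def)
  interpret finite_measure M using M by (intro finite_measureI) auto
  show "integrable M (\<lambda>x. 2 * (norm (u x))\<^sup>2 + 2 * (norm c)\<^sup>2)"
    using u by (auto simp: square_integrable_def)
  show "(\<lambda>x. (norm (u x - c))\<^sup>2) \<in> borel_measurable M" using m by measurable
  show "AE x in M. norm ((norm (u x - c))\<^sup>2) \<le> norm (2 * (norm (u x))\<^sup>2 + 2 * (norm c)\<^sup>2)"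
    using young_norm[of 1 "u _" "-c"] by (intro AE_I2) simp
qed

text \<open>The inradius is a supremum; half of it is the radius of a ball in \<open>T\<close>.\<close>
lemma cball_of_shape_regular:
  fixes T :: "(real^'n::finite) set"
  assumes "T \<noteq> {}" "0 < diameter T" "0 < c" "diameter T \<le> c * inradius T"
  obtains x where "cball x (diameter T / (2 * c)) \<subseteq> T"
proof -
  let ?X = "{r. 0 \<le> r \<and> (\<exists>x. cball x r \<subseteq> T)}"
  obtain x where "x \<in> T" using assms by auto
  then have "0 \<in> ?X" by (auto intro!: exI[of _ x])
  then have ne: "?X \<noteq> {}" by blast
  have "diameter T / (2 * c) < diameter T / c" using assms by (simp add: field_simps)
  also have "\<dots> \<le> Sup ?X" using assms by (simp add: field_simps inradius_def)
  finally obtain r where "r \<in> ?X" "diameter T / (2 * c) < r" using less_cSupD[OF ne] by blast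
  then obtain x where "cball x r \<subseteq> T" by auto
  moreover have "cball x (diameter T / (2 * c)) \<subseteq> cball x r"
    using \<open>diameter T / (2 * c) < r\<close> by (intro subset_cball) simp
  ultimately show thesis using that by blast
qed

text \<open>The constant of \<open>facet_scaling\<close>. It depends on the mesh only through the shape regularity constant \<open>c\<close>.\<close>
definition scaling_const :: "(real^'n::finite) set \<Rightarrow> real \<Rightarrow> real" where
  "scaling_const \<Omega> c = facet_const CARD('n)
     * sqrt (unit_ball_vol CARD('n) * c ^ CARD('n) * diameter \<Omega> ^ (CARD('n) - 2))
     * ((2 * c) ^ CARD('n) / unit_ball_vol CARD('n))"

context conforming_mesh
begin

lemma element_sets: "T \<in> \<K> \<Longrightarrow> T \<in> sets lebesgue" "T \<in> \<K> \<Longrightarrow> T \<in> lmeasurable"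
  using compact_element by (auto intro: lmeasurable_compact fmeasurableD)

lemma measure_interior_element: "T \<in> \<K> \<Longrightarrow> volume (interior T) = volume T"
  using compact_element convex_element
  by (intro measure_interior negligible_convex_frontier compact_imp_bounded) auto

lemma element_nonempty: "T \<in> \<K> \<Longrightarrow> T \<noteq> {}"
  using interior_element interior_subset by blast

lemma scaling_const_nonneg: "0 < c \<Longrightarrow> 0 \<le> scaling_const \<Omega> c"
  unfolding scaling_const_def facet_const_def
  by (intro mult_nonneg_nonneg divide_nonneg_nonneg real_sqrt_ge_zero zero_le_power unit_ball_vol_nonneg
      of_nat_0_le_iff diameter_ge_0 bounded_domain) auto

text \<open>Let \<open>e\<close> be the diameter of \<open>E\<close>. By shape regularity the diameter of \<open>T\<close> is at most \<open>c e\<close>, so \<open>sqrt |T|\<close>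
is bounded by a multiple of \<open>sqrt (e\<^sup>d)\<close>, and by a multiple of \<open>e\<close> since \<open>d \<ge> 2\<close> and \<open>\<Omega>\<close> is bounded. The facet contributes
\<open>e\<^sup>d / e\<close>, and \<open>e\<^sup>d\<close> is bounded by a multiple of \<open>|S|\<close> because \<open>S\<close> contains a ball of radius
proportional to its diameter, which is at least \<open>e\<close>.\<close>
lemma facet_scaling:
  assumes dim: "2 \<le> CARD('n)" and c: "0 < c" "\<And>T. T \<in> \<K> \<Longrightarrow> diameter T \<le> c * inradius T"
    and T: "T \<in> \<K>" "E facet_of T" and S: "S \<in> \<K>" "E facet_of S"
  shows "sqrt (volume T) * area E \<le> scaling_const \<Omega> c * volume S"
proof -
  let ?d = "CARD('n)" and ?\<omega> = "unit_ball_vol CARD('n)"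
  define h e where "h = diameter T" and "e = diameter E"
  have \<omega>: "0 < ?\<omega>" by simp
  note fT = facet_props[OF T] and fS = facet_props[OF S]
  have upper: "volume R \<le> ?\<omega> * diameter R ^ ?d" if R: "R \<in> \<K>" for R
  proof -
    obtain x where x: "x \<in> R" using interior_element[OF R] interior_subset by blast
    have bR: "bounded R" using compact_element[OF R] by (rule compact_imp_bounded)
    have "R \<subseteq> cball x (diameter R)" using diameter_bounded_bound[OF bR x] by auto
    then have "volume R \<le> volume (cball x (diameter R))"
      using element_sets(1)[OF R] by (intro measure_mono_fmeasurable) auto
    then show ?thesis using content_cball[OF diameter_ge_0[OF bR], of x] by simp
  qed
  have diam_pos: "0 < diameter R" if R: "R \<in> \<K>" for R
  proof -
    have "0 \<le> diameter R" using compact_element[OF R] by (simp add: diameter_ge_0 compact_imp_bounded)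
    moreover have "diameter R \<noteq> 0" using upper[OF R] measure_element_pos[OF R] by (auto simp: power_0_left)
    ultimately show ?thesis by simp
  qed
  have e0: "0 \<le> e" using fT(2) by (simp add: e_def diameter_ge_0 compact_imp_bounded)
  obtain xT where xT: "cball xT (h / (2 * c)) \<subseteq> T"
    using cball_of_shape_regular[of T c] diam_pos[OF T(1)] c T element_nonempty[OF T(1)] by (auto simp: h_def)
  obtain b where fr: "facet_frame T E (unit_normal T E) b" using unit_normal(1)[OF simplices[OF T(1)] T(2)] by auto
  have "2 * (h / (2 * c)) \<le> e"
    unfolding e_def using xT diam_pos[OF T(1)] c dim fT
    by (intro cball_in_simplex_facet_diameter[OF fr]) (auto simp: compact_imp_bounded h_def)
  then have he: "h \<le> c * e" using c by (simp add: field_simps)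
  have h0: "0 \<le> h" using diam_pos[OF T(1)] by (simp add: h_def)
  have es: "e \<le> diameter S"
    unfolding e_def using fS compact_element[OF S(1)] by (intro diameter_subset compact_imp_bounded)
  have "diameter S \<le> diameter (closure \<Omega>)"
    using covers S bounded_domain by (intro diameter_subset) auto
  then have eD: "e \<le> diameter \<Omega>" using es by (simp add: diameter_closure bounded_domain)
  have "volume T \<le> ?\<omega> * h ^ ?d" using upper[OF T(1)] by (simp add: h_def)
  also have "\<dots> \<le> ?\<omega> * (c * e) ^ ?d" using he h0 \<omega> by (intro mult_left_mono power_mono) auto
  also have "\<dots> = ?\<omega> * c ^ ?d * (e\<^sup>2 * e ^ (?d - 2))"
  proof -
    have "e ^ ?d = e\<^sup>2 * e ^ (?d - 2)" using dim by (metis le_add_diff_inverse power_add)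
    then show ?thesis by (simp only: power_mult_distrib mult.assoc)
  qed
  also have "\<dots> \<le> ?\<omega> * c ^ ?d * (e\<^sup>2 * diameter \<Omega> ^ (?d - 2))"
    using eD e0 \<omega> c by (intro mult_left_mono power_mono) auto
  finally have "sqrt (volume T) \<le> sqrt (?\<omega> * c ^ ?d * diameter \<Omega> ^ (?d - 2) * e\<^sup>2)"
    by (simp add: ac_simps)
  also have "\<dots> = sqrt (?\<omega> * c ^ ?d * diameter \<Omega> ^ (?d - 2)) * e"
    using e0 by (simp add: real_sqrt_mult)
  finally have 1: "sqrt (volume T) \<le> sqrt (?\<omega> * c ^ ?d * diameter \<Omega> ^ (?d - 2)) * e" .
  have 2: "area E \<le> facet_const ?d * e ^ (?d - 1)"
    unfolding e_def by (rule facet_surface_measure(2)[OF simplices[OF T(1)] T(2)])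
  have fc: "0 \<le> facet_const ?d" by (simp add: facet_const_def)
  have "sqrt (volume T) * area E
      \<le> (sqrt (?\<omega> * c ^ ?d * diameter \<Omega> ^ (?d - 2)) * e) * (facet_const ?d * e ^ (?d - 1))"
    by (rule mult_mono[OF 1 2]) (use e0 c \<omega> bounded_domain in \<open>auto intro!: mult_nonneg_nonneg zero_le_power diameter_ge_0\<close>)
  also have "\<dots> = facet_const ?d * sqrt (?\<omega> * c ^ ?d * diameter \<Omega> ^ (?d - 2)) * (e * e ^ (?d - 1))"
    by (simp only: ac_simps)
  also have "e * e ^ (?d - 1) = e ^ ?d" by (simp flip: power_Suc)
  finally have main: "sqrt (volume T) * area E
      \<le> facet_const ?d * sqrt (?\<omega> * c ^ ?d * diameter \<Omega> ^ (?d - 2)) * e ^ ?d" .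
  obtain xS where xS: "cball xS (diameter S / (2 * c)) \<subseteq> S"
    using cball_of_shape_regular[of S c] diam_pos[OF S(1)] c S element_nonempty[OF S(1)] by auto
  have "?\<omega> * (e / (2 * c)) ^ ?d \<le> ?\<omega> * (diameter S / (2 * c)) ^ ?d"
    using es e0 c \<omega> by (intro mult_left_mono power_mono divide_right_mono) auto
  also have "\<dots> = volume (cball xS (diameter S / (2 * c)))"
    using content_cball[of "diameter S / (2 * c)" xS] diam_pos[OF S(1)] c by simp
  also have "\<dots> \<le> volume S"
    using xS element_sets[OF S(1)] by (intro measure_mono_fmeasurable) auto
  finally have "e ^ ?d \<le> (2 * c) ^ ?d / ?\<omega> * volume S"
    using \<omega> c by (simp add: power_divide field_simps)
  then have "facet_const ?d * sqrt (?\<omega> * c ^ ?d * diameter \<Omega> ^ (?d - 2)) * e ^ ?d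
     \<le> facet_const ?d * sqrt (?\<omega> * c ^ ?d * diameter \<Omega> ^ (?d - 2)) * ((2 * c) ^ ?d / ?\<omega> * volume S)"
    using fc c \<omega> bounded_domain
    by (intro mult_left_mono) (auto intro!: mult_nonneg_nonneg zero_le_power diameter_ge_0)
  with main show ?thesis by (simp add: scaling_const_def mult.assoc)
qed

lemma finite_facets: "T \<in> \<K> \<Longrightarrow> finite {E. E facet_of T}"
  using simplices by (auto intro: finite_polytope_facets simplex_imp_polytope)

lemma card_facets_le: "T \<in> \<K> \<Longrightarrow> card {E. E facet_of T} \<le> CARD('n) + 1"
proof -
  assume "T \<in> \<K>"
  then obtain S where S: "\<not> affine_dependent S" "int (card S) = int (CARD('n)) + 1" "T = convex hull S"
    using simplices by (auto simp: simplex_def)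
  have fin: "finite S" using aff_independent_finite[OF S(1)] .
  have "{E. E facet_of T} \<subseteq> (\<lambda>u. convex hull (S - {u})) ` S"
    using S(3) facet_of_convex_hull_affine_independent[OF S(1)] by blast
  then have "card {E. E facet_of T} \<le> card S"
    using fin by (meson card_image_le card_mono finite_imageI order_trans)
  then show ?thesis using S(2) by simp
qed

abbreviation elements_at :: "(real^'n) set \<Rightarrow> (real^'n) set set" where
  "elements_at E \<equiv> {T \<in> \<K>. E facet_of T}"

lemma card_facet_neighbours_le:
  assumes S: "S \<in> \<K>" "E facet_of S"
  shows "card (elements_at E) \<le> 2"
proof -
  have "elements_at E \<subseteq> {S, side \<K> E (- unit_normal S E)}"
  proof
    fix T assume T: "T \<in> (elements_at E)"
    show "T \<in> {S, side \<K> E (- unit_normal S E)}"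
    proof (cases "T = S")
      case False
      then have "unit_normal T E = - unit_normal S E" using T S by (intro shared_facet_normals) auto
      then show ?thesis using side_eq[of T E] T by auto
    qed simp
  qed
  then have "card (elements_at E) \<le> card {S, side \<K> E (- unit_normal S E)}" by (intro card_mono) auto
  also have "\<dots> \<le> 2" by (simp add: card_insert_if)
  finally show ?thesis .
qed

lemma stress_constant:
  assumes "z \<in> space_X \<Omega> \<Gamma>D \<K>" "T \<in> \<K>"
  shows "ae_constant_on T (stress \<Omega> \<C> z)"
  using assms by (intro stress_constant_on_element[of z \<Omega> \<Gamma>D \<K>] compact_element convex_element
      interior_subset_domain open_domain)

text \<open>The change of the stress on one element; meaningful for stresses that are constant on the element.\<close>
definition stress_diff :: "(real^'n^'n \<Rightarrow> real^'n^'n) \<Rightarrow> 'n state \<Rightarrow> 'n state \<Rightarrow> (real^'n) set \<Rightarrow> real" where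
  "stress_diff \<C> z z' S = norm (elem_value S (stress \<Omega> \<C> z') - elem_value S (stress \<Omega> \<C> z))"

text \<open>The residual of a boundary facet is the norm of a difference of \<open>g\<close> and a constant on the Neumann part of the facet; it is finite
because the facet has finite surface measure.\<close>
lemma traction_on_facet:
  assumes T: "T \<in> \<K>" "E facet_of T" "E \<subseteq> frontier \<Omega>" and \<Gamma>D: "closed \<Gamma>D"
    and g: "square_integrable (restrict_space surface_measure (frontier \<Omega> - \<Gamma>D)) g"
  defines "M \<equiv> restrict_space surface_measure (E - \<Gamma>D)"
  shows "E - \<Gamma>D \<in> sets surface_measure" "finite_measure M"
    "measure M (space M) \<le> area E" "integrable M (\<lambda>x. (norm (g x - c))\<^sup>2)"
proof -
  have borel: "E \<in> sets borel" "\<Gamma>D \<in> sets borel" using facet_props[OF T(1,2)] \<Gamma>D by (auto simp: borel_compact)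
  then show sM: "E - \<Gamma>D \<in> sets surface_measure" by (simp add: surface_measure_def)
  have em: "emeasure M (space M) = emeasure surface_measure (E - \<Gamma>D)"
    using sM by (simp add: M_def emeasure_restrict_space space_restrict_space surface_measure_def)
  also have emle: "\<dots> \<le> emeasure surface_measure E"
    using borel by (intro emeasure_mono) (auto simp: surface_measure_def)
  also have finE: "\<dots> < \<infinity>" by (rule facet_surface_measure(1)[OF simplices[OF T(1)] T(2)])
  finally have fin: "emeasure M (space M) < \<infinity>" .
  then show "finite_measure M" by (intro finite_measureI) auto
  show "measure M (space M) \<le> area E"
    unfolding measure_def em using emle finE by (intro enn2real_mono) auto
  have "square_integrable M g"
    unfolding M_def using T(3) borel
    by (intro square_integrable_restrict_subset[OF g]) (auto simp: surface_measure_def)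
  then show "integrable M (\<lambda>x. (norm (g x - c))\<^sup>2)" by (rule integrable_norm_diff_const[OF _ fin])
qed

text \<open>On an interior facet the residual changes by the difference of two element values, on a boundary facet by one of them. In
both cases the inequality of Young with parameter \<open>\<delta>\<close> separates the old residual from the change.\<close>
lemma facet_residual_perturbation:
  assumes T: "T \<in> \<K>" "E facet_of T" and \<delta>: "0 < \<delta>" and \<Gamma>D: "closed \<Gamma>D"
    and g: "square_integrable (restrict_space surface_measure (frontier \<Omega> - \<Gamma>D)) g"
  shows "(facet_residual \<Omega> \<Gamma>D g \<C> \<K> z' E)\<^sup>2 \<le> (1 + \<delta>) * (facet_residual \<Omega> \<Gamma>D g \<C> \<K> z E)\<^sup>2
     + 2 * (1 + 1 / \<delta>) * area E * (\<Sum>S\<in>elements_at E. (stress_diff \<C> z z' S)\<^sup>2)"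
proof -
  let ?\<Sigma> = "\<Sum>S\<in>elements_at E. (stress_diff \<C> z z' S)\<^sup>2"
  define val where "val = (\<lambda>z S. elem_value S (stress \<Omega> \<C> z))"
  define \<nu> where "\<nu> = unit_normal T E"
  have \<nu>1: "norm \<nu> = 1" unfolding \<nu>_def by (rule norm_unit_normal[OF simplices[OF T(1)] T(2)])
  have diff: "norm ((val z' S - val z S) *v \<nu>) \<le> stress_diff \<C> z z' S" for S
    using norm_matrix_vector_mult_le[of "val z' S - val z S" \<nu>] \<nu>1 by (simp add: val_def stress_diff_def)
  have finS: "finite (elements_at E)" using finite_mesh by simp
  have \<delta>': "0 \<le> 1 + 1 / \<delta>" using \<delta> by simp
  show ?thesis
  proof (cases "E \<subseteq> frontier \<Omega>")
    case False
    obtain T2 where T2: "T2 \<in> \<K>" "T2 \<noteq> T" "E facet_of T2" using interior_facet_shared[OF T False] .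
    define x where "x = (val z T - val z T2) *v \<nu>"
    define y1 y2 where "y1 = (val z' T - val z T) *v \<nu>" and "y2 = (val z' T2 - val z T2) *v \<nu>"
    have R: "(facet_residual \<Omega> \<Gamma>D g \<C> \<K> w E)\<^sup>2 = (norm ((val w T - val w T2) *v \<nu>))\<^sup>2 * area E" for w
      using T T2 unfolding val_def \<nu>_def by (intro interior_facet_residual) auto
    have "(norm (y1 - y2))\<^sup>2 \<le> 2 * (norm y1)\<^sup>2 + 2 * (norm y2)\<^sup>2"
      using young_norm[of 1 y1 "- y2"] by simp
    also have "\<dots> \<le> 2 * (stress_diff \<C> z z' T)\<^sup>2 + 2 * (stress_diff \<C> z z' T2)\<^sup>2"
      using diff by (intro add_mono mult_left_mono power_mono) (auto simp: y1_def y2_def)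
    also have "\<dots> = 2 * (\<Sum>S\<in>{T, T2}. (stress_diff \<C> z z' S)\<^sup>2)" using T2 by simp
    also have "\<dots> \<le> 2 * ?\<Sigma>"
      using T T2 finS by (intro mult_left_mono sum_mono2) auto
    finally have y: "(norm (y1 - y2))\<^sup>2 \<le> 2 * ?\<Sigma>" .
    have "(val z' T - val z' T2) *v \<nu> = x + (y1 - y2)"
      by (simp add: x_def y1_def y2_def matrix_vector_mult_diff_rdistrib)
    then have "(norm ((val z' T - val z' T2) *v \<nu>))\<^sup>2 \<le> (1 + \<delta>) * (norm x)\<^sup>2 + (1 + 1 / \<delta>) * (norm (y1 - y2))\<^sup>2"
      using young_norm[OF \<delta>] by simp
    also have "\<dots> \<le> (1 + \<delta>) * (norm x)\<^sup>2 + (1 + 1 / \<delta>) * (2 * ?\<Sigma>)"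
      by (intro add_left_mono mult_left_mono y \<delta>')
    finally have "(norm ((val z' T - val z' T2) *v \<nu>))\<^sup>2 * area E
       \<le> ((1 + \<delta>) * (norm x)\<^sup>2 + (1 + 1 / \<delta>) * (2 * ?\<Sigma>)) * area E"
      by (intro mult_right_mono) auto
    then show ?thesis unfolding R x_def by (simp add: algebra_simps)
  next
    case True
    have rhs0: "0 \<le> 2 * (1 + 1 / \<delta>) * area E * ?\<Sigma>"
      using \<delta>' by (intro mult_nonneg_nonneg sum_nonneg) auto
    show ?thesis
    proof (cases "E \<subseteq> \<Gamma>D")
      case E: True
      then show ?thesis using rhs0 by (simp add: boundary_facet_residual[OF T True])
    next
      case E: False
      define M where "M = restrict_space surface_measure (E - \<Gamma>D)"
      define a where "a = (\<lambda>z. val z T *v \<nu>)"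
      note traction = traction_on_facet[OF T True \<Gamma>D g, folded M_def]
      have R: "(facet_residual \<Omega> \<Gamma>D g \<C> \<K> w E)\<^sup>2 = (\<integral>x. (norm (g x - a w))\<^sup>2 \<partial>M)" for w
        by (simp add: boundary_facet_residual[OF T True] E L2_norm_def M_def a_def val_def \<nu>_def)
      interpret finite_measure M by (rule traction(2))
      note int = traction(4) and mle = traction(3)
      have y: "(norm (a z' - a z))\<^sup>2 \<le> 2 * ?\<Sigma>"
      proof -
        have "a z' - a z = (val z' T - val z T) *v \<nu>" by (simp add: a_def matrix_vector_mult_diff_rdistrib)
        then have "(norm (a z' - a z))\<^sup>2 \<le> (stress_diff \<C> z z' T)\<^sup>2" using diff[of T] by (intro power_mono) auto
        also have "\<dots> \<le> ?\<Sigma>" using T finS by (intro member_le_sum) auto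
        finally show ?thesis using sum_nonneg[of "(elements_at E)" "\<lambda>S. (stress_diff \<C> z z' S)\<^sup>2"] by simp
      qed
      have "(\<integral>x. (norm (g x - a z'))\<^sup>2 \<partial>M) \<le> (\<integral>x. (1 + \<delta>) * (norm (g x - a z))\<^sup>2 + (1 + 1 / \<delta>) * (2 * ?\<Sigma>) \<partial>M)"
      proof (rule integral_mono)
        fix x
        have "(norm ((g x - a z) + - (a z' - a z)))\<^sup>2 \<le> (1 + \<delta>) * (norm (g x - a z))\<^sup>2 + (1 + 1 / \<delta>) * (norm (- (a z' - a z)))\<^sup>2"
          by (rule young_norm[OF \<delta>])
        also have "(g x - a z) + - (a z' - a z) = g x - a z'" by simp
        also have "norm (- (a z' - a z)) = norm (a z' - a z)" by (rule norm_minus_cancel)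
        also have "(1 + \<delta>) * (norm (g x - a z))\<^sup>2 + (1 + 1 / \<delta>) * (norm (a z' - a z))\<^sup>2
           \<le> (1 + \<delta>) * (norm (g x - a z))\<^sup>2 + (1 + 1 / \<delta>) * (2 * ?\<Sigma>)"
          by (intro add_left_mono mult_left_mono y \<delta>')
        finally show "(norm (g x - a z'))\<^sup>2 \<le> (1 + \<delta>) * (norm (g x - a z))\<^sup>2 + (1 + 1 / \<delta>) * (2 * ?\<Sigma>)" .
      qed (use int in auto)
      also have "\<dots> = (1 + \<delta>) * (\<integral>x. (norm (g x - a z))\<^sup>2 \<partial>M) + (1 + 1 / \<delta>) * (2 * ?\<Sigma>) * measure M (space M)"
        using int by (simp add: Bochner_Integration.integral_add mult.commute)
      also have "\<dots> \<le> (1 + \<delta>) * (\<integral>x. (norm (g x - a z))\<^sup>2 \<partial>M) + (1 + 1 / \<delta>) * (2 * ?\<Sigma>) * area E"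
        using \<delta>' by (intro add_left_mono mult_left_mono mle mult_nonneg_nonneg sum_nonneg) auto
      finally show ?thesis unfolding R by (simp only: ac_simps)
    qed
  qed
qed

text \<open>The stresses are constant on the elements, and almost every point of \<open>\<Omega>\<close> is interior to exactly one element.\<close>
lemma stress_dist_power2:
  assumes s: "\<And>T. T \<in> \<K> \<Longrightarrow> ae_constant_on T (stress \<Omega> \<C> z)"
    and s': "\<And>T. T \<in> \<K> \<Longrightarrow> ae_constant_on T (stress \<Omega> \<C> z')"
  shows "(\<Sum>S\<in>\<K>. volume S * (stress_diff \<C> z z' S)\<^sup>2) = (stress_dist \<Omega> \<C> z' z)\<^sup>2"
proof -
  define \<rho> where "\<rho> = (\<lambda>x. (norm (stress \<Omega> \<C> z' x - stress \<Omega> \<C> z x))\<^sup>2)"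
  define \<phi> where "\<phi> = (\<lambda>x. \<Sum>S\<in>\<K>. indicator (interior S) x * (stress_diff \<C> z z' S)\<^sup>2)"
  have val: "AE x in lebesgue. x \<in> T \<longrightarrow> \<rho> x = (stress_diff \<C> z z' T)\<^sup>2" if T: "T \<in> \<K>" for T
  proof -
    obtain c where c: "AE x in lebesgue. x \<in> T \<longrightarrow> stress \<Omega> \<C> z x = c" using s[OF T] by auto
    obtain c' where c': "AE x in lebesgue. x \<in> T \<longrightarrow> stress \<Omega> \<C> z' x = c'" using s'[OF T] by auto
    have "elem_value T (stress \<Omega> \<C> z) = c" "elem_value T (stress \<Omega> \<C> z') = c'"
      using c c' by (auto intro!: elem_value_eq element_sets measure_element_pos T)
    then have sd: "stress_diff \<C> z z' T = norm (c' - c)" by (simp add: stress_diff_def)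
    show ?thesis using c c' by eventually_elim (auto simp: \<rho>_def sd)
  qed
  have "AE x in lebesgue. \<forall>T\<in>\<K>. x \<in> T \<longrightarrow> \<rho> x = (stress_diff \<C> z z' T)\<^sup>2"
    using val by (intro AE_finite_allI finite_mesh) auto
  moreover have "AE x in lebesgue. \<forall>T\<in>\<K>. x \<notin> frontier T"
  proof (intro AE_finite_allI finite_mesh AE_not_in)
    show "frontier T \<in> null_sets lebesgue" if "T \<in> \<K>" for T
      using negligible_convex_frontier[OF convex_element[OF that]] by (simp add: negligible_iff_null_sets)
  qed
  ultimately have ae: "AE x in lebesgue. \<phi> x = indicator \<Omega> x *\<^sub>R \<rho> x"
  proof eventually_elim
    case (elim x)
    show "\<phi> x = indicator \<Omega> x *\<^sub>R \<rho> x"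
    proof (cases "x \<in> \<Omega>")
      case True
      then obtain T where T: "T \<in> \<K>" "x \<in> T" using covers closure_subset by blast
      then have xi: "x \<in> interior T" using elim closure_subset by (auto simp: frontier_def)
      have "\<phi> x = (\<Sum>S\<in>\<K>. if S = T then (stress_diff \<C> z z' T)\<^sup>2 else 0)"
        unfolding \<phi>_def
      proof (rule sum.cong)
        fix S assume S: "S \<in> \<K>"
        have "x \<notin> interior S" if "S \<noteq> T" using interiors_disjoint[OF S T(1) that] xi by auto
        then show "indicator (interior S) x * (stress_diff \<C> z z' S)\<^sup>2 = (if S = T then (stress_diff \<C> z z' T)\<^sup>2 else 0)"
          using xi by auto
      qed simp
      also have "\<dots> = (stress_diff \<C> z z' T)\<^sup>2" using finite_mesh T by simp
      also have "\<dots> = \<rho> x" using elim T by simp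
      finally show ?thesis using True by simp
    next
      case False
      then have "indicator (interior S) x = (0::real)" if "S \<in> \<K>" for S
        using interior_subset_domain[OF that] by (auto simp: indicator_def)
      then show ?thesis using False by (simp add: \<phi>_def)
    qed
  qed
  have fin: "integrable lebesgue (\<lambda>x. indicator (interior S) x * (stress_diff \<C> z z' S)\<^sup>2)" if "S \<in> \<K>" for S
  proof (intro integrable_mult_left)
    have "interior S \<in> lmeasurable" using compact_element[OF that] by (intro lmeasurable_interior compact_imp_bounded)
    then show "integrable lebesgue (indicator (interior S) :: _ \<Rightarrow> real)"
      by (simp add: integrable_indicator_iff fmeasurable_def)
  qed
  have \<phi>m: "\<phi> \<in> borel_measurable lebesgue" unfolding \<phi>_def by (intro borel_measurable_sum borel_measurable_integrable fin)
  have "(stress_dist \<Omega> \<C> z' z)\<^sup>2 = (\<integral>x. \<rho> x \<partial>lebesgue_on \<Omega>)"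
    by (simp add: stress_dist_def L2_norm_def \<rho>_def)
  also have "\<dots> = (\<integral>x. indicator \<Omega> x *\<^sub>R \<rho> x \<partial>lebesgue)"
    using open_domain by (intro integral_restrict_space) auto
  also have "\<dots> = (\<integral>x. \<phi> x \<partial>lebesgue)"
    using ae borel_measurable_AE[OF \<phi>m ae] \<phi>m by (intro integral_cong_AE) auto
  also have "\<dots> = (\<Sum>S\<in>\<K>. \<integral>x. indicator (interior S) x * (stress_diff \<C> z z' S)\<^sup>2 \<partial>lebesgue)"
    unfolding \<phi>_def using fin by (rule Bochner_Integration.integral_sum)
  also have "\<dots> = (\<Sum>S\<in>\<K>. volume S * (stress_diff \<C> z z' S)\<^sup>2)"
    using measure_interior_element by (intro sum.cong) auto
  finally show ?thesis by simp
qed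

text \<open>After \<open>facet_scaling\<close> every element \<open>S\<close> is counted once for each of its facets and each element at that facet, and
there are at most \<open>d + 1\<close> facets and at most two elements at each of them.\<close>
lemma sum_facet_neighbours_le:
  assumes dim: "2 \<le> CARD('n)" and c: "0 < c" "\<And>T. T \<in> \<K> \<Longrightarrow> diameter T \<le> c * inradius T"
    and A: "A \<subseteq> \<K>" and e: "\<And>S. 0 \<le> e S"
  shows "(\<Sum>T\<in>A. sqrt (volume T) *
      (\<Sum>E | E facet_of T. area E * (\<Sum>S\<in>elements_at E. e S)))
    \<le> 2 * (real CARD('n) + 1) * scaling_const \<Omega> c * (\<Sum>S\<in>\<K>. volume S * e S)"
proof -
  define C where "C = scaling_const \<Omega> c"
  have C0: "0 \<le> C" using c by (simp add: C_def scaling_const_nonneg)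
  have finA: "finite A" using A finite_mesh finite_subset by blast
  let ?f = "\<lambda>S. C * volume S * e S"
  have "(\<Sum>T\<in>A. sqrt (volume T) *
      (\<Sum>E | E facet_of T. area E * (\<Sum>S\<in>elements_at E. e S)))
    = (\<Sum>T\<in>A. \<Sum>E | E facet_of T. \<Sum>S\<in>elements_at E. (sqrt (volume T) * area E) * e S)"
    by (simp add: sum_distrib_left mult.assoc)
  also have "\<dots> \<le> (\<Sum>T\<in>A. \<Sum>E | E facet_of T. \<Sum>S\<in>elements_at E. ?f S)"
    unfolding C_def using A e by (intro sum_mono mult_right_mono facet_scaling[OF dim c]) auto
  also have "\<dots> \<le> (\<Sum>T\<in>\<K>. \<Sum>E | E facet_of T. \<Sum>S\<in>elements_at E. ?f S)"
    using A finite_mesh C0 e by (intro sum_mono2 sum_nonneg) auto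
  also have "\<dots> = (\<Sum>S\<in>\<K>. \<Sum>E | E facet_of S. \<Sum>T\<in>elements_at E. ?f S)"
  proof -
    have fin: "finite (elements_at E)" for E using finite_mesh by simp
    have "(\<Sum>T\<in>\<K>. \<Sum>E | E facet_of T. \<Sum>S\<in>elements_at E. ?f S)
       = (\<Sum>(T, E, S)\<in>(SIGMA T:\<K>. SIGMA E:{E. E facet_of T}. (elements_at E)). ?f S)"
      using finite_mesh finite_facets fin by (simp add: sum.Sigma del: sum_constant)
    also have "\<dots> = (\<Sum>(S, E, T)\<in>(SIGMA S:\<K>. SIGMA E:{E. E facet_of S}. (elements_at E)). ?f S)"
      by (rule sum.reindex_bij_witness[where i = "\<lambda>(S, E, T). (T, E, S)" and j = "\<lambda>(T, E, S). (S, E, T)"]) auto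
    also have "\<dots> = (\<Sum>S\<in>\<K>. \<Sum>E | E facet_of S. \<Sum>T\<in>elements_at E. ?f S)"
      using finite_mesh finite_facets fin by (simp add: sum.Sigma split_beta del: sum_constant)
    finally show ?thesis .
  qed
  also have "\<dots> \<le> (\<Sum>S\<in>\<K>. real (CARD('n) + 1) * (2 * ?f S))"
  proof (rule sum_mono)
    fix S assume S: "S \<in> \<K>"
    have f0: "0 \<le> ?f S" using C0 e by simp
    have "(\<Sum>E | E facet_of S. \<Sum>T\<in>elements_at E. ?f S) \<le> (\<Sum>E | E facet_of S. 2 * ?f S)"
    proof (rule sum_mono)
      fix E assume "E \<in> {E. E facet_of S}"
      then have "real (card (elements_at E)) \<le> 2" using card_facet_neighbours_le[OF S] by force
      then have "real (card (elements_at E)) * ?f S \<le> 2 * ?f S" using f0 by (rule mult_right_mono)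
      then show "(\<Sum>T\<in>elements_at E. ?f S) \<le> 2 * ?f S" by simp
    qed
    also have "\<dots> = real (card {E. E facet_of S}) * (2 * ?f S)" by simp
    also have "\<dots> \<le> real (CARD('n) + 1) * (2 * ?f S)"
      using f0 by (intro mult_right_mono of_nat_mono card_facets_le S) auto
    finally show "(\<Sum>E | E facet_of S. \<Sum>T\<in>elements_at E. ?f S) \<le> real (CARD('n) + 1) * (2 * ?f S)" .
  qed
  also have "\<dots> = 2 * (real CARD('n) + 1) * scaling_const \<Omega> c * (\<Sum>S\<in>\<K>. volume S * e S)"
    unfolding sum_distrib_left by (intro sum.cong) (simp_all add: C_def algebra_simps)
  finally show ?thesis .
qed

end


section \<open>Residuals on a refined mesh for a fixed state\<close>

lemma L2_norm_restrict_power2: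
  assumes "A \<in> sets M"
  shows "(L2_norm (restrict_space M A) u)\<^sup>2 = (\<integral>x. indicator A x * (norm (u x))\<^sup>2 \<partial>M)"
proof -
  have "A \<inter> space M \<in> sets M" using assms by auto
  then show ?thesis by (simp add: L2_norm_def integral_restrict_space)
qed

context conforming_mesh
begin

text \<open>The integrand of the squared residual on the facet \<open>E\<close> of \<open>T\<close>. The residual on a part of \<open>E\<close> that is a facet of a finer mesh is
the integral of the same function over this part.\<close>
definition facet_density ::
  "(real^'n) set \<Rightarrow> (real^'n \<Rightarrow> real^'n) \<Rightarrow> (real^'n^'n \<Rightarrow> real^'n^'n) \<Rightarrow> 'n state
    \<Rightarrow> (real^'n) set \<Rightarrow> (real^'n) set \<Rightarrow> real^'n \<Rightarrow> real" where
  "facet_density \<Gamma>D g \<C> z T E x =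
     (if \<not> E \<subseteq> frontier \<Omega> then (norm (jump \<K> E (stress \<Omega> \<C> z) *v facet_normal \<K> E))\<^sup>2
      else indicator (- \<Gamma>D) x * (norm (g x - elem_value T (stress \<Omega> \<C> z) *v unit_normal T E))\<^sup>2)"

lemma facet_sets: "T \<in> \<K> \<Longrightarrow> E facet_of T \<Longrightarrow> E \<in> sets surface_measure"
  using facet_props(2) by (simp add: surface_measure_def borel_compact)

lemma facet_residual_density:
  assumes T: "T \<in> \<K>" "E facet_of T" and \<Gamma>D: "closed \<Gamma>D"
  shows "(facet_residual \<Omega> \<Gamma>D g \<C> \<K> z E)\<^sup>2 = (\<integral>x. indicator E x * facet_density \<Gamma>D g \<C> z T E x \<partial>surface_measure)"
proof (cases "E \<subseteq> frontier \<Omega>")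
  case False
  then show ?thesis using facet_sets[OF T]
    by (simp add: facet_residual_def facet_density_def L2_norm_restrict_power2)
next
  case True
  have s: "E - \<Gamma>D \<in> sets surface_measure" using facet_sets[OF T] \<Gamma>D by (auto simp: surface_measure_def)
  have eq: "indicator (E - \<Gamma>D) x * u = indicator E x * (indicator (- \<Gamma>D) x * (u::real))" for x u
    by (simp split: split_indicator)
  show ?thesis
  proof (cases "E \<subseteq> \<Gamma>D")
    case sub: True
    then have "indicator E x * facet_density \<Gamma>D g \<C> z T E x = 0" for x
      using True by (auto simp: facet_density_def split: split_indicator)
    then show ?thesis using sub by (simp only: boundary_facet_residual[OF T True]) simp
  next
    case False
    then show ?thesis using True
      by (simp add: boundary_facet_residual[OF T True] facet_density_def L2_norm_restrict_power2[OF s] eq)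
  qed
qed

lemma facet_density_nonneg: "0 \<le> facet_density \<Gamma>D g \<C> z T E x"
  by (simp add: facet_density_def)

lemma integrable_facet_density:
  assumes T: "T \<in> \<K>" "E facet_of T" and \<Gamma>D: "closed \<Gamma>D"
    and g: "square_integrable (restrict_space surface_measure (frontier \<Omega> - \<Gamma>D)) g"
  shows "integrable surface_measure (\<lambda>x. indicator E x * facet_density \<Gamma>D g \<C> z T E x)"
proof (cases "E \<subseteq> frontier \<Omega>")
  case False
  then show ?thesis using facet_sets[OF T] facet_surface_measure(1)[OF simplices[OF T(1)] T(2)]
    by (simp add: facet_density_def integrable_indicator_iff)
next
  case True
  note traction = traction_on_facet[OF T True \<Gamma>D g]
  have "(E - \<Gamma>D) \<inter> space surface_measure \<in> sets surface_measure" using traction(1) by (simp add: surface_measure_def)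
  from traction(4)[unfolded integrable_restrict_space[OF this]]
  have "integrable surface_measure
      (\<lambda>x. indicator (E - \<Gamma>D) x * (norm (g x - elem_value T (stress \<Omega> \<C> z) *v unit_normal T E))\<^sup>2)" by simp
  moreover have "indicator (E - \<Gamma>D) x * u = indicator E x * (indicator (- \<Gamma>D) x * (u::real))" for x u
    by (simp split: split_indicator)
  ultimately show ?thesis using True by (simp add: facet_density_def)
qed

lemma L2_norm_element_power2:
  assumes T: "T \<in> \<K>" and f: "square_integrable (lebesgue_on \<Omega>) f"
  shows "(L2_norm (lebesgue_on T) f)\<^sup>2 = (\<integral>x. indicator (interior T) x * (norm (f x))\<^sup>2 \<partial>lebesgue)"
    "integrable lebesgue (\<lambda>x. indicator (interior T) x * (norm (f x))\<^sup>2)"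
proof -
  have \<Omega>: "\<Omega> \<inter> space lebesgue \<in> sets lebesgue" using open_domain by auto
  have "integrable lebesgue (\<lambda>x. indicator \<Omega> x *\<^sub>R (norm (f x))\<^sup>2)"
    using f by (simp add: square_integrable_def integrable_restrict_space[OF \<Omega>])
  then have "integrable lebesgue (\<lambda>x. indicator (interior T) x *\<^sub>R (indicator \<Omega> x *\<^sub>R (norm (f x))\<^sup>2))"
    by (rule integrable_mult_indicator[rotated]) auto
  also have "(\<lambda>x. indicator (interior T) x *\<^sub>R (indicator \<Omega> x *\<^sub>R (norm (f x))\<^sup>2)) = (\<lambda>x. indicator (interior T) x * (norm (f x))\<^sup>2)"
    using interior_subset_domain[OF T] by (auto simp: fun_eq_iff split: split_indicator)
  finally show int: "integrable lebesgue (\<lambda>x. indicator (interior T) x * (norm (f x))\<^sup>2)" .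
  have "AE x in lebesgue. x \<notin> frontier T"
    using negligible_convex_frontier[OF convex_element[OF T]] by (intro AE_not_in) (simp add: negligible_iff_null_sets)
  then have ae: "AE x in lebesgue. indicator (interior T) x * (norm (f x))\<^sup>2 = indicator T x * (norm (f x))\<^sup>2"
  proof eventually_elim
    case (elim x)
    have "closure T = T" using compact_element[OF T] by (simp add: compact_imp_closed)
    then have "x \<in> interior T \<longleftrightarrow> x \<in> T" using elim interior_subset by (auto simp: frontier_def)
    then show ?case by (simp add: indicator_def)
  qed
  have "(L2_norm (lebesgue_on T) f)\<^sup>2 = (\<integral>x. indicator T x * (norm (f x))\<^sup>2 \<partial>lebesgue)"
    using element_sets[OF T] by (intro L2_norm_restrict_power2) auto
  also have "\<dots> = (\<integral>x. indicator (interior T) x * (norm (f x))\<^sup>2 \<partial>lebesgue)"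
    using ae borel_measurable_AE[OF borel_measurable_integrable[OF int] ae] int
    by (intro integral_cong_AE) auto
  finally show "(L2_norm (lebesgue_on T) f)\<^sup>2 = (\<integral>x. indicator (interior T) x * (norm (f x))\<^sup>2 \<partial>lebesgue)" .
qed

abbreviation residual_sum where
  "residual_sum \<Gamma>D g \<C> z T \<equiv> \<Sum>E | E facet_of T. (facet_residual \<Omega> \<Gamma>D g \<C> \<K> z E)\<^sup>2"

lemma eta_power2:
  "(eta \<Omega> \<Gamma>D f g \<C> \<K> z T)\<^sup>2 = volume T * (L2_norm (lebesgue_on T) f)\<^sup>2
      + sqrt (volume T) * residual_sum \<Gamma>D g \<C> z T"
  unfolding eta_def by (intro real_sqrt_pow2 add_nonneg_nonneg mult_nonneg_nonneg sum_nonneg) auto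

end

text \<open>For the comparison of residuals it is enough that the fine mesh subdivides the coarse one, regardless of how the
elements were bisected.\<close>
locale refined_mesh = coarse: conforming_mesh \<Omega> \<K> + fine: conforming_mesh \<Omega> \<K>'
  for \<Omega> :: "(real^'n::finite) set" and \<K> \<K>' +
  assumes refines: "T' \<in> \<K>' \<Longrightarrow> \<exists>T\<in>\<K>. T' \<subseteq> T"
begin

lemma elem_value_descendant:
  assumes T: "T \<in> \<K>" "T' \<in> \<K>'" "T' \<subseteq> T" and s: "ae_constant_on T \<tau>"
  shows "elem_value T' \<tau> = elem_value T \<tau>"
proof -
  obtain s where s: "AE x in lebesgue. x \<in> T \<longrightarrow> \<tau> x = s" using s by auto
  then have s': "AE x in lebesgue. x \<in> T' \<longrightarrow> \<tau> x = s" by eventually_elim (use T in auto)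
  show ?thesis
    using elem_value_eq[OF _ _ s] elem_value_eq[OF _ _ s'] T coarse.element_sets fine.element_sets
      coarse.measure_element_pos fine.measure_element_pos by simp
qed

lemma unit_normal_descendant:
  assumes T: "T \<in> \<K>" "T' \<in> \<K>'" "T' \<subseteq> T" and E: "E facet_of T" "F facet_of T'" "F \<subseteq> E"
  shows "unit_normal T' F = unit_normal T E"
proof -
  have "outer_normal T E (unit_normal T E)" using unit_normal(2)[OF coarse.simplices[OF T(1)] E(1)] by blast
  then have "outer_normal T' F (unit_normal T E)" using T E by (auto simp: outer_normal_def)
  then show ?thesis using unit_normal(2)[OF fine.simplices[OF T(2)] E(2)] by simp
qed

text \<open>If \<open>F\<close> is an interior facet, consider the neighbour of \<open>T'\<close> at \<open>F\<close> and the coarse element \<open>T2\<close> that contains it. For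
\<open>T2 = T\<close> the jump is zero. For \<open>T2 \<noteq> T\<close> the common face of \<open>T\<close> and \<open>T2\<close> contains \<open>F\<close> and
is therefore a facet. If \<open>F\<close> lies on the boundary, a point of its relative interior lies on the boundary of \<open>T\<close>, hence in a facet
\<open>E\<close> of \<open>T\<close>, and \<open>E\<close> contains \<open>F\<close>; this \<open>E\<close> is a boundary facet, as otherwise its relative
interior would lie in \<open>\<Omega>\<close>.\<close>
lemma descendant_facet_residual:
  assumes T: "T \<in> \<K>" "T' \<in> \<K>'" "T' \<subseteq> T" and F: "F facet_of T'" and \<Gamma>D: "closed \<Gamma>D"
    and s: "\<And>T. T \<in> \<K> \<Longrightarrow> ae_constant_on T (stress \<Omega> \<C> z)"
  shows "facet_residual \<Omega> \<Gamma>D g \<C> \<K>' z F = 0 \<or>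
    (\<exists>E. E facet_of T \<and> F \<subseteq> E \<and> (facet_residual \<Omega> \<Gamma>D g \<C> \<K>' z F)\<^sup>2
       = (\<integral>x. indicator F x * coarse.facet_density \<Gamma>D g \<C> z T E x \<partial>surface_measure))"
proof -
  note fF = fine.facet_props[OF T(2) F]
  have val: "elem_value S' (stress \<Omega> \<C> z) = elem_value S (stress \<Omega> \<C> z)"
    if "S \<in> \<K>" "S' \<in> \<K>'" "S' \<subseteq> S" for S S'
    using elem_value_descendant[OF that s[OF that(1)]] .
  show ?thesis
  proof (cases "F \<subseteq> frontier \<Omega>")
    case False
    obtain T2' where T2': "T2' \<in> \<K>'" "T2' \<noteq> T'" "F facet_of T2'"
      using fine.interior_facet_shared[OF T(2) F False] .
    obtain T2 where T2: "T2 \<in> \<K>" "T2' \<subseteq> T2" using refines[OF T2'(1)] by auto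
    note R = fine.interior_facet_residual[OF T(2) T2'(1) T2'(2)[symmetric] F T2'(3), of \<Gamma>D g \<C> z]
    show ?thesis
    proof (cases "T2 = T")
      case True
      then have "facet_residual \<Omega> \<Gamma>D g \<C> \<K>' z F = 0"
        using R val[OF T] val[OF T2(1) T2'(1) T2(2)] by simp
      then show ?thesis ..
    next
      case ne: False
      define E where "E = T \<inter> T2"
      have FE: "F \<subseteq> E" using fF(6) T fine.facet_props(6)[OF T2'(1,3)] T2 by (auto simp: E_def)
      have face: "E face_of T" "E face_of T2"
        using coarse.conforming[OF T(1) T2(1)] coarse.conforming[OF T2(1) T(1)] by (simp_all add: E_def Int_commute)
      have "E \<noteq> T" using coarse.element_not_subset[OF T(1) T2(1)] ne by (auto simp: E_def)
      then have "aff_dim E < aff_dim T" using face coarse.convex_element[OF T(1)] by (intro face_of_aff_dim_lt)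
      moreover have "aff_dim F \<le> aff_dim E" by (rule aff_dim_subset[OF FE])
      ultimately have facet: "E facet_of T" "E facet_of T2"
        using face fF(4,5) FE coarse.aff_dim_element T(1) T2(1) by (auto simp: facet_of_def)
      have "\<not> E \<subseteq> frontier \<Omega>" using False FE by auto
      then have "coarse.facet_density \<Gamma>D g \<C> z T E x
         = (norm ((elem_value T' (stress \<Omega> \<C> z) - elem_value T2' (stress \<Omega> \<C> z)) *v unit_normal T' F))\<^sup>2" for x
        using coarse.jump_normal[OF T(1) T2(1) ne[symmetric] facet] val[OF T] val[OF T2(1) T2'(1) T2(2)]
          unit_normal_descendant[OF T facet(1) F FE]
        by (simp add: coarse.facet_density_def)
      then have "(facet_residual \<Omega> \<Gamma>D g \<C> \<K>' z F)\<^sup>2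
         = (\<integral>x. indicator F x * coarse.facet_density \<Gamma>D g \<C> z T E x \<partial>surface_measure)"
        using R fine.facet_sets[OF T(2) F] by (simp add: surface_measure_def)
      then show ?thesis using facet(1) FE by blast
    qed
  next
    case True
    obtain y where y: "y \<in> rel_interior F" using fF(3,4) rel_interior_eq_empty by blast
    have yF: "y \<in> F" using y rel_interior_subset by blast
    have y\<Omega>: "y \<notin> \<Omega>" using True yF coarse.open_domain by (auto simp: frontier_def interior_open)
    \<comment> \<open>\<open>y\<close> is not interior to \<open>T\<close>, so it lies in one of the facets that make up the boundary of \<open>T\<close>\<close>
    have "affine hull T = UNIV" using coarse.aff_dim_element[OF T(1)] aff_dim_eq_full[of T] by simp
    then have ri: "rel_interior T = interior T" by (rule rel_interior_interior)
    have "y \<in> T" using yF fF(6) T by auto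
    then have "y \<in> rel_frontier T"
      using y\<Omega> coarse.interior_subset_domain[OF T(1)] closure_subset by (auto simp: rel_frontier_def ri)
    then obtain E where E: "E facet_of T" "y \<in> E"
      using rel_frontier_of_polyhedron[OF simplex_imp_polyhedron[OF coarse.simplices[OF T(1)]]] by auto
    note fE = coarse.facet_props[OF T(1) E(1)]
    have FE: "F \<subseteq> E"
      by (rule subset_of_face_of[OF fE(1)]) (use fF(6) T y E in auto)
    have hulls: "affine hull F = affine hull E" using aff_dim_eq_full_gen[OF FE] fF(5) fE(5) by simp
    have Efr: "E \<subseteq> frontier \<Omega>"
    proof (rule ccontr)
      assume "\<not> ?thesis"
      then obtain T2 where "T2 \<in> \<K>" "T2 \<noteq> T" "E facet_of T2" using coarse.interior_facet_shared[OF T(1) E(1)] by blast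
      then have "rel_interior E \<subseteq> \<Omega>" using coarse.shared_facet_interior[OF T(1)] E by blast
      then show False using subset_rel_interior[OF FE hulls] y y\<Omega> by auto
    qed
    show ?thesis
    proof (cases "F \<subseteq> \<Gamma>D")
      case sub: True
      then show ?thesis by (simp add: fine.boundary_facet_residual[OF T(2) F True])
    next
      case nsub: False
      have "coarse.facet_density \<Gamma>D g \<C> z T E x = fine.facet_density \<Gamma>D g \<C> z T' F x" for x
        using True Efr val[OF T] unit_normal_descendant[OF T E(1) F FE]
        by (simp add: coarse.facet_density_def fine.facet_density_def)
      then have "(facet_residual \<Omega> \<Gamma>D g \<C> \<K>' z F)\<^sup>2
         = (\<integral>x. indicator F x * coarse.facet_density \<Gamma>D g \<C> z T E x \<partial>surface_measure)"
        using fine.facet_residual_density[OF T(2) F \<Gamma>D] by simp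
      then show ?thesis using E(1) FE by blast
    qed
  qed
qed

lemma descendant_facet_eq:
  assumes T: "T \<in> \<K>" "T' \<in> \<K>'" "T' \<subseteq> T" and E: "E facet_of T" "F facet_of T'" "F \<subseteq> E"
    and fr: "facet_frame T E \<nu> b"
  shows "F = T' \<inter> {x. \<nu> \<bullet> x = b}"
proof -
  let ?G = "T' \<inter> {x. \<nu> \<bullet> x = b}"
  note fF = fine.facet_props[OF T(2) E(2)]
  have face: "?G face_of T'"
    using facet_frame_le[OF fr] T fine.convex_element[OF T(2)] by (intro face_of_Int_supporting_hyperplane_le) auto
  have sub: "F \<subseteq> ?G" using fF(6) E(3) facet_frame_eq[OF fr] by auto
  have "\<nu> \<noteq> 0" using fr by (auto simp: facet_frame_def)
  then have "aff_dim ?G \<le> int CARD('n) - 1"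
    using aff_dim_subset[of ?G "{x. \<nu> \<bullet> x = b}"] by simp
  then have "aff_dim ?G = aff_dim F" using aff_dim_subset[OF sub] fF(5) by simp
  moreover have "F face_of ?G" using face fF(1) sub by (simp add: face_of_face)
  moreover have "convex ?G" using face_of_imp_convex[OF face] .
  ultimately show ?thesis using face_of_aff_dim_lt[of ?G F] by force
qed

text \<open>A facet of a descendant that lies in \<open>E\<close> is the intersection of the descendant with the hyperplane of \<open>E\<close>, so the two
descendants differ. Their facets \<open>F1\<close> and \<open>F2\<close> meet in a face of both descendants. Were it
of full dimension, it would be a common facet with both descendants on the same side of it, because they lie in \<open>T\<close>.\<close>
lemma descendant_facets_overlap_null:
  assumes T: "T \<in> \<K>" "E facet_of T"
    and 1: "T1 \<in> \<K>'" "T1 \<subseteq> T" "F1 facet_of T1" "F1 \<subseteq> E"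
    and 2: "T2 \<in> \<K>'" "T2 \<subseteq> T" "F2 facet_of T2" "F2 \<subseteq> E"
    and ne: "(T1, F1) \<noteq> (T2, F2)"
  shows "F1 \<inter> F2 \<in> null_sets surface_measure"
proof -
  obtain b where fr: "facet_frame T E (unit_normal T E) b" using unit_normal(1)[OF coarse.simplices[OF T(1)] T(2)] by auto
  note eq1 = descendant_facet_eq[OF T(1) 1(1,2) T(2) 1(3,4) fr]
  note eq2 = descendant_facet_eq[OF T(1) 2(1,2) T(2) 2(3,4) fr]
  note f1 = fine.facet_props[OF 1(1,3)] and f2 = fine.facet_props[OF 2(1,3)]
  have T12: "T1 \<noteq> T2" using ne eq1 eq2 by auto
  let ?N = "F1 \<inter> F2"
  have N: "?N = F1 \<inter> (T1 \<inter> T2)" "?N = F2 \<inter> (T2 \<inter> T1)" using eq1 eq2 by auto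
  have face1: "?N face_of T1" unfolding N(1) by (intro face_of_Int f1(1) fine.conforming 1 2)
  have face2: "?N face_of T2" unfolding N(2) by (intro face_of_Int f2(1) fine.conforming 1 2)
  have "aff_dim ?N \<le> int CARD('n) - 2"
  proof (rule ccontr)
    assume "\<not> ?thesis"
    then have dim: "aff_dim ?N \<ge> int CARD('n) - 1" by simp
    have "?N face_of F1" "?N face_of F2" using face1 face2 f1(1) f2(1) by (auto simp: face_of_face)
    then have "?N = F1" "?N = F2"
      using face_of_aff_dim_lt[OF f1(3), of ?N] face_of_aff_dim_lt[OF f2(3), of ?N] dim f1(5) f2(5) by auto
    then have F: "F1 = F2" by simp
    have "unit_normal T2 F1 = - unit_normal T1 F1"
      using 1 2 T12 F by (intro fine.shared_facet_normals) auto
    moreover have "unit_normal T1 F1 = unit_normal T E" "unit_normal T2 F1 = unit_normal T E"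
      using unit_normal_descendant[OF T(1) 1(1,2) T(2) 1(3,4)] unit_normal_descendant[OF T(1) 2(1,2) T(2) 2(3,4)] F by auto
    ultimately have "unit_normal T E = 0" by (intro eq_minus_self_imp_0) simp
    then show False using norm_unit_normal[OF coarse.simplices[OF T(1)] T(2)] by simp
  qed
  then show ?thesis by (rule surface_measure_face_null[OF fine.simplices[OF 1(1)] face1])
qed

text \<open>Each pair of a descendant and one of its facets with nonzero residual is assigned to the facet \<open>E\<close> of \<open>T\<close> that contains it. The pieces
that are assigned to \<open>E\<close> overlap in null sets.\<close>
lemma sum_descendant_residuals_le:
  assumes T: "T \<in> \<K>" and A: "A \<subseteq> {T' \<in> \<K>'. T' \<subseteq> T}" and \<Gamma>D: "closed \<Gamma>D"
    and g: "square_integrable (restrict_space surface_measure (frontier \<Omega> - \<Gamma>D)) g"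
    and s: "\<And>T. T \<in> \<K> \<Longrightarrow> ae_constant_on T (stress \<Omega> \<C> z)"
  shows "(\<Sum>T'\<in>A. fine.residual_sum \<Gamma>D g \<C> z T')
    \<le> coarse.residual_sum \<Gamma>D g \<C> z T"
proof -
  define P where "P = (SIGMA T':A. {F. F facet_of T'})"
  define I where "I = (\<lambda>E (p :: (real^'n) set \<times> (real^'n) set). \<integral>x. indicator (snd p) x * coarse.facet_density \<Gamma>D g \<C> z T E x \<partial>surface_measure)"
  have finA: "finite A" using A fine.finite_mesh by (auto intro: finite_subset)
  have finF: "finite {F. F facet_of T'}" if "T' \<in> A" for T' using that A fine.finite_facets by auto
  have finP: "finite P" unfolding P_def using finA finF by auto
  have finE: "finite {E. E facet_of T}" by (rule coarse.finite_facets[OF T])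
  have I0: "0 \<le> I E p" for E p unfolding I_def
    by (intro Bochner_Integration.integral_nonneg mult_nonneg_nonneg coarse.facet_density_nonneg) auto
  have "(\<Sum>T'\<in>A. fine.residual_sum \<Gamma>D g \<C> z T')
     = (\<Sum>p\<in>P. (facet_residual \<Omega> \<Gamma>D g \<C> \<K>' z (snd p))\<^sup>2)"
    unfolding P_def using finA finF by (simp add: sum.Sigma split_beta)
  also have "\<dots> \<le> (\<Sum>p\<in>P. \<Sum>E | E facet_of T. if snd p \<subseteq> E then I E p else 0)"
  proof (rule sum_mono)
    fix p assume "p \<in> P"
    then obtain T' F where p: "p = (T', F)" "T' \<in> \<K>'" "T' \<subseteq> T" "F facet_of T'" using A by (auto simp: P_def)
    have nonneg: "0 \<le> (\<Sum>E | E facet_of T. if snd p \<subseteq> E then I E p else 0)" using I0 by (intro sum_nonneg) auto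
    have "facet_residual \<Omega> \<Gamma>D g \<C> \<K>' z F = 0 \<or>
      (\<exists>E. E facet_of T \<and> F \<subseteq> E \<and> (facet_residual \<Omega> \<Gamma>D g \<C> \<K>' z F)\<^sup>2
       = (\<integral>x. indicator F x * coarse.facet_density \<Gamma>D g \<C> z T E x \<partial>surface_measure))"
      by (rule descendant_facet_residual[OF T p(2-4) \<Gamma>D s])
    then show "(facet_residual \<Omega> \<Gamma>D g \<C> \<K>' z (snd p))\<^sup>2 \<le> (\<Sum>E | E facet_of T. if snd p \<subseteq> E then I E p else 0)"
    proof (elim disjE exE conjE)
      fix E assume E: "E facet_of T" "F \<subseteq> E" "(facet_residual \<Omega> \<Gamma>D g \<C> \<K>' z F)\<^sup>2
         = (\<integral>x. indicator F x * coarse.facet_density \<Gamma>D g \<C> z T E x \<partial>surface_measure)"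
      then have "(facet_residual \<Omega> \<Gamma>D g \<C> \<K>' z (snd p))\<^sup>2 = (if snd p \<subseteq> E then I E p else 0)"
        by (simp add: p I_def)
      also have "\<dots> \<le> (\<Sum>E | E facet_of T. if snd p \<subseteq> E then I E p else 0)"
        using E(1) finE I0 by (intro member_le_sum[of E _ "\<lambda>E. if snd p \<subseteq> E then I E p else 0"]) auto
      finally show ?thesis .
    qed (use nonneg p in simp)
  qed
  also have "\<dots> = (\<Sum>E | E facet_of T. \<Sum>p\<in>P. if snd p \<subseteq> E then I E p else 0)" by (rule sum.swap)
  also have "\<dots> = (\<Sum>E | E facet_of T. \<Sum>p\<in>{p \<in> P. snd p \<subseteq> E}. I E p)"
    using finP by (simp add: sum.inter_filter)
  also have "\<dots> \<le> coarse.residual_sum \<Gamma>D g \<C> z T"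
  proof (rule sum_mono)
    fix E assume "E \<in> {E. E facet_of T}"
    then have E: "E facet_of T" by simp
    show "(\<Sum>p\<in>{p \<in> P. snd p \<subseteq> E}. I E p) \<le> (facet_residual \<Omega> \<Gamma>D g \<C> \<K> z E)\<^sup>2"
      unfolding I_def coarse.facet_residual_density[OF T E \<Gamma>D]
    proof (rule sum_integral_null_overlap)
      show "finite {p \<in> P. snd p \<subseteq> E}" using finP by simp
      show "snd p \<in> sets surface_measure" if "p \<in> {p \<in> P. snd p \<subseteq> E}" for p
        using that A by (auto simp: P_def intro: fine.facet_sets)
      show "snd p \<inter> snd q \<in> null_sets surface_measure"
        if "p \<in> {p \<in> P. snd p \<subseteq> E}" "q \<in> {p \<in> P. snd p \<subseteq> E}" "p \<noteq> q" for p q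
      proof -
        obtain T1 F1 T2 F2 where pq: "p = (T1, F1)" "q = (T2, F2)" by (cases p, cases q)
        have "T1 \<in> \<K>'" "T1 \<subseteq> T" "F1 facet_of T1" "F1 \<subseteq> E" "T2 \<in> \<K>'" "T2 \<subseteq> T" "F2 facet_of T2" "F2 \<subseteq> E"
          using that(1,2) A by (auto simp: P_def pq)
        moreover have "(T1, F1) \<noteq> (T2, F2)" using that(3) by (simp only: pq not_False_eq_True)
        ultimately show ?thesis unfolding pq snd_conv by (rule descendant_facets_overlap_null[OF T E])
      qed
      show "integrable surface_measure (\<lambda>x. indicator E x * coarse.facet_density \<Gamma>D g \<C> z T E x)"
        by (rule coarse.integrable_facet_density[OF T E \<Gamma>D g])
    qed (auto simp: coarse.facet_density_nonneg)
  qed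
  finally show ?thesis .
qed

lemma sum_descendant_loads_le:
  assumes T: "T \<in> \<K>" and A: "A \<subseteq> {T' \<in> \<K>'. T' \<subseteq> T}" and f: "square_integrable (lebesgue_on \<Omega>) f"
  shows "(\<Sum>T'\<in>A. (L2_norm (lebesgue_on T') f)\<^sup>2) \<le> (L2_norm (lebesgue_on T) f)\<^sup>2"
proof -
  have finA: "finite A" using A fine.finite_mesh by (auto intro: finite_subset)
  have "(\<Sum>T'\<in>A. (L2_norm (lebesgue_on T') f)\<^sup>2) = (\<Sum>T'\<in>A. \<integral>x. indicator (interior T') x * (norm (f x))\<^sup>2 \<partial>lebesgue)"
    using A fine.L2_norm_element_power2(1)[OF _ f] by (intro sum.cong) auto
  also have "\<dots> \<le> (\<integral>x. indicator (interior T) x * (norm (f x))\<^sup>2 \<partial>lebesgue)"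
  proof (rule sum_integral_null_overlap[OF finA])
    show "interior T' \<subseteq> interior T" if "T' \<in> A" for T' using that A by (intro interior_mono) auto
    show "interior p \<inter> interior q \<in> null_sets lebesgue" if "p \<in> A" "q \<in> A" "p \<noteq> q" for p q
    proof -
      have "interior (p \<inter> q) = {}" using that(1,2) A by (intro fine.interiors_disjoint that(3)) auto
      then show ?thesis by simp
    qed
    show "integrable lebesgue (\<lambda>x. indicator (interior T) x * (norm (f x))\<^sup>2)"
      by (rule coarse.L2_norm_element_power2(2)[OF T f])
  qed auto
  also have "\<dots> = (L2_norm (lebesgue_on T) f)\<^sup>2" by (rule coarse.L2_norm_element_power2(1)[OF T f, symmetric])
  finally show ?thesis .
qed

text \<open>Group the new elements by the coarse elements from which they stem; the residuals and loads do not increase,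
and the weights decrease. The facet terms have the weight \<open>sqrt |T|\<close> and decide the factor.\<close>
lemma eta_reduction_fixed_state:
  assumes q: "0 \<le> q" "q \<le> 1"
    and parent: "\<And>T'. T' \<in> \<K>' - \<K> \<Longrightarrow> \<exists>T\<in>\<K> - \<K>'. T' \<subseteq> T \<and> volume T' \<le> q * volume T"
    and \<Gamma>D: "closed \<Gamma>D" and f: "square_integrable (lebesgue_on \<Omega>) f"
    and g: "square_integrable (restrict_space surface_measure (frontier \<Omega> - \<Gamma>D)) g"
    and s: "\<And>T. T \<in> \<K> \<Longrightarrow> ae_constant_on T (stress \<Omega> \<C> z)"
  shows "(\<Sum>T'\<in>\<K>' - \<K>. (eta \<Omega> \<Gamma>D f g \<C> \<K>' z T')\<^sup>2) \<le> sqrt q * (\<Sum>T\<in>\<K> - \<K>'. (eta \<Omega> \<Gamma>D f g \<C> \<K> z T)\<^sup>2)"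
proof -
  obtain par where par: "\<And>T'. T' \<in> \<K>' - \<K> \<Longrightarrow> par T' \<in> \<K> - \<K>'"
    "\<And>T'. T' \<in> \<K>' - \<K> \<Longrightarrow> T' \<subseteq> par T'" "\<And>T'. T' \<in> \<K>' - \<K> \<Longrightarrow> volume T' \<le> q * volume (par T')"
    using parent by metis
  define A where "A = (\<lambda>T. {T' \<in> \<K>' - \<K>. par T' = T})"
  have fin: "finite (\<K>' - \<K>)" "finite (\<K> - \<K>')" using fine.finite_mesh coarse.finite_mesh by auto
  have qs: "q \<le> sqrt q"
  proof -
    have "q * q \<le> q * 1" using q by (intro mult_left_mono)
    then show ?thesis using q by (intro real_le_rsqrt) (simp add: power2_eq_square)
  qed
  have "(\<Sum>T'\<in>\<K>' - \<K>. (eta \<Omega> \<Gamma>D f g \<C> \<K>' z T')\<^sup>2) = (\<Sum>T\<in>\<K> - \<K>'. \<Sum>T'\<in>A T. (eta \<Omega> \<Gamma>D f g \<C> \<K>' z T')\<^sup>2)"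
    unfolding A_def using fin par(1) by (intro sum.group[symmetric]) auto
  also have "\<dots> \<le> (\<Sum>T\<in>\<K> - \<K>'. sqrt q * (eta \<Omega> \<Gamma>D f g \<C> \<K> z T)\<^sup>2)"
  proof (rule sum_mono)
    fix T assume "T \<in> \<K> - \<K>'"
    then have T: "T \<in> \<K>" by simp
    have AT: "A T \<subseteq> {T' \<in> \<K>'. T' \<subseteq> T}" using par by (auto simp: A_def)
    have m: "volume T' \<le> q * volume T" if "T' \<in> A T" for T'
      using par(3)[of T'] that by (auto simp: A_def)
    have sm: "sqrt (volume T') \<le> sqrt q * sqrt (volume T)" if "T' \<in> A T" for T'
      using m[OF that] by (simp flip: real_sqrt_mult)
    have "(\<Sum>T'\<in>A T. (eta \<Omega> \<Gamma>D f g \<C> \<K>' z T')\<^sup>2)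
      \<le> (\<Sum>T'\<in>A T. q * volume T * (L2_norm (lebesgue_on T') f)\<^sup>2
        + sqrt q * sqrt (volume T) * fine.residual_sum \<Gamma>D g \<C> z T')"
      unfolding fine.eta_power2 using m sm by (intro sum_mono add_mono mult_right_mono sum_nonneg) auto
    also have "\<dots> = q * volume T * (\<Sum>T'\<in>A T. (L2_norm (lebesgue_on T') f)\<^sup>2)
       + sqrt q * sqrt (volume T) * (\<Sum>T'\<in>A T. fine.residual_sum \<Gamma>D g \<C> z T')"
      by (simp only: sum.distrib sum_distrib_left)
    also have "\<dots> \<le> sqrt q * volume T * (L2_norm (lebesgue_on T) f)\<^sup>2
       + sqrt q * sqrt (volume T) * coarse.residual_sum \<Gamma>D g \<C> z T"
      using qs q sum_descendant_loads_le[OF T AT f] sum_descendant_residuals_le[OF T AT \<Gamma>D g s]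
      by (intro add_mono mult_mono mult_nonneg_nonneg sum_nonneg) auto
    also have "\<dots> = sqrt q * (eta \<Omega> \<Gamma>D f g \<C> \<K> z T)\<^sup>2"
      unfolding coarse.eta_power2 by (simp add: algebra_simps)
    finally show "(\<Sum>T'\<in>A T. (eta \<Omega> \<Gamma>D f g \<C> \<K>' z T')\<^sup>2) \<le> sqrt q * (eta \<Omega> \<Gamma>D f g \<C> \<K> z T)\<^sup>2" .
  qed
  also have "\<dots> = sqrt q * (\<Sum>T\<in>\<K> - \<K>'. (eta \<Omega> \<Gamma>D f g \<C> \<K> z T)\<^sup>2)" by (simp add: sum_distrib_left)
  finally show ?thesis .
qed

end

context conforming_mesh
begin

text \<open>The sum of \<open>facet_residual_perturbation\<close> over all facets of the elements of \<open>A\<close>, with the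
weights \<open>sqrt |T|\<close>. The load terms do not depend on the state.\<close>
lemma eta_perturbation:
  assumes dim: "2 \<le> CARD('n)" and c: "0 < c" "\<And>T. T \<in> \<K> \<Longrightarrow> diameter T \<le> c * inradius T"
    and A: "A \<subseteq> \<K>" and \<delta>: "0 < \<delta>" and \<Gamma>D: "closed \<Gamma>D"
    and g: "square_integrable (restrict_space surface_measure (frontier \<Omega> - \<Gamma>D)) g"
    and s: "\<And>T. T \<in> \<K> \<Longrightarrow> ae_constant_on T (stress \<Omega> \<C> z)"
    and s': "\<And>T. T \<in> \<K> \<Longrightarrow> ae_constant_on T (stress \<Omega> \<C> z')"
  shows "(\<Sum>T\<in>A. (eta \<Omega> \<Gamma>D f g \<C> \<K> z' T)\<^sup>2) \<le> (1 + \<delta>) * (\<Sum>T\<in>A. (eta \<Omega> \<Gamma>D f g \<C> \<K> z T)\<^sup>2)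
     + 4 * (1 + 1 / \<delta>) * (real CARD('n) + 1) * scaling_const \<Omega> c * (stress_dist \<Omega> \<C> z' z)\<^sup>2"
proof -
  define e where "e = (\<lambda>S. (stress_diff \<C> z z' S)\<^sup>2)"
  define N where "N = (\<lambda>T. sqrt (volume T) *
      (\<Sum>E | E facet_of T. area E * (\<Sum>S\<in>elements_at E. e S)))"
  have "(\<Sum>T\<in>A. (eta \<Omega> \<Gamma>D f g \<C> \<K> z' T)\<^sup>2) \<le> (\<Sum>T\<in>A. (1 + \<delta>) * (eta \<Omega> \<Gamma>D f g \<C> \<K> z T)\<^sup>2 + 2 * (1 + 1 / \<delta>) * N T)"
  proof (rule sum_mono)
    fix T assume "T \<in> A"
    then have T: "T \<in> \<K>" using A by auto
    let ?L = "volume T * (L2_norm (lebesgue_on T) f)\<^sup>2" and ?m = "sqrt (volume T)"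
    have "residual_sum \<Gamma>D g \<C> z' T
      \<le> (\<Sum>E | E facet_of T. (1 + \<delta>) * (facet_residual \<Omega> \<Gamma>D g \<C> \<K> z E)\<^sup>2
          + 2 * (1 + 1 / \<delta>) * (area E * (\<Sum>S\<in>elements_at E. e S)))"
      using facet_residual_perturbation[OF T _ \<delta> \<Gamma>D g] unfolding e_def by (intro sum_mono) (simp add: mult.assoc)
    also have "\<dots> = (1 + \<delta>) * residual_sum \<Gamma>D g \<C> z T
          + 2 * (1 + 1 / \<delta>) * (\<Sum>E | E facet_of T. area E * (\<Sum>S\<in>elements_at E. e S))"
      by (simp only: sum.distrib sum_distrib_left)
    finally have "?m * residual_sum \<Gamma>D g \<C> z' T
      \<le> ?m * ((1 + \<delta>) * residual_sum \<Gamma>D g \<C> z T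
          + 2 * (1 + 1 / \<delta>) * (\<Sum>E | E facet_of T. area E * (\<Sum>S\<in>elements_at E. e S)))"
      by (intro mult_left_mono) auto
    also have "\<dots> = (1 + \<delta>) * (?m * residual_sum \<Gamma>D g \<C> z T) + 2 * (1 + 1 / \<delta>) * N T"
      unfolding N_def by (simp only: distrib_left ac_simps)
    moreover have "1 * ?L \<le> (1 + \<delta>) * ?L" using \<delta> by (intro mult_right_mono) auto
    ultimately have "?L + ?m * residual_sum \<Gamma>D g \<C> z' T
       \<le> (1 + \<delta>) * ?L + ((1 + \<delta>) * (?m * residual_sum \<Gamma>D g \<C> z T) + 2 * (1 + 1 / \<delta>) * N T)"
      by (simp only: mult_1 add_mono)
    then show "(eta \<Omega> \<Gamma>D f g \<C> \<K> z' T)\<^sup>2 \<le> (1 + \<delta>) * (eta \<Omega> \<Gamma>D f g \<C> \<K> z T)\<^sup>2 + 2 * (1 + 1 / \<delta>) * N T"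
      unfolding eta_power2 by (simp only: distrib_left add.assoc)
  qed
  also have "\<dots> = (1 + \<delta>) * (\<Sum>T\<in>A. (eta \<Omega> \<Gamma>D f g \<C> \<K> z T)\<^sup>2) + 2 * (1 + 1 / \<delta>) * (\<Sum>T\<in>A. N T)"
    by (simp only: sum.distrib sum_distrib_left)
  also have "\<dots> \<le> (1 + \<delta>) * (\<Sum>T\<in>A. (eta \<Omega> \<Gamma>D f g \<C> \<K> z T)\<^sup>2)
     + 2 * (1 + 1 / \<delta>) * (2 * (real CARD('n) + 1) * scaling_const \<Omega> c * (\<Sum>S\<in>\<K>. volume S * e S))"
    unfolding N_def using \<delta> by (intro add_left_mono mult_left_mono sum_facet_neighbours_le[OF dim c A]) (auto simp: e_def)
  also have "(\<Sum>S\<in>\<K>. volume S * e S) = (stress_dist \<Omega> \<C> z' z)\<^sup>2"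
    unfolding e_def by (rule stress_dist_power2[OF s s'])
  finally have *: "(\<Sum>T\<in>A. (eta \<Omega> \<Gamma>D f g \<C> \<K> z' T)\<^sup>2) \<le> (1 + \<delta>) * (\<Sum>T\<in>A. (eta \<Omega> \<Gamma>D f g \<C> \<K> z T)\<^sup>2)
     + 2 * (1 + 1 / \<delta>) * (2 * (real CARD('n) + 1) * scaling_const \<Omega> c * (stress_dist \<Omega> \<C> z' z)\<^sup>2)" .
  have "2 * k * (2 * a * b * x) = 4 * k * a * b * x" for k a b x :: real by simp
  then show ?thesis using * by (simp only:)
qed

end


section \<open>The estimator reduction\<close>

lemma mesh_conforming:
  fixes \<T> :: "'n::finite tagged set"
  assumes "mesh \<Omega> \<T>" "lipschitz_domain \<Omega>"
  shows "conforming_mesh \<Omega> (elements \<T>)"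
proof
  show "finite (elements \<T>)" using assms(1) by (auto simp: mesh_def triangulation_def)
  show "CARD('n) simplex T" if "T \<in> elements \<T>" for T
  proof -
    obtain t where t: "t \<in> \<T>" "T = element t" using \<open>T \<in> elements \<T>\<close> by blast
    have "tagged_simplex t" using assms(1) t(1) by (simp add: mesh_def)
    from simplex_element[OF this] show ?thesis by (simp add: t(2))
  qed
  show "T \<inter> T' face_of T" if "T \<in> elements \<T>" "T' \<in> elements \<T>" for T T'
    using that assms(1) unfolding mesh_def triangulation_def by blast
  show "\<Union>(elements \<T>) = closure \<Omega>" using assms(1) by (simp add: mesh_def)
  show "open \<Omega>" using assms(2) by (simp add: lipschitz_domain_def)
  show "interior (closure \<Omega>) \<subseteq> \<Omega>" using lipschitz_domain_interior_closure[OF assms(2)] by simp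
qed

lemma refinement_refined_mesh:
  fixes \<T> :: "'n::finite tagged set"
  assumes \<T>: "mesh \<Omega> \<T>" "\<T>' \<in> refinements \<Omega> \<T>" and \<Omega>: "lipschitz_domain \<Omega>"
  shows "refined_mesh \<Omega> (elements \<T>) (elements \<T>')"
    and "\<And>T'. T' \<in> elements \<T>' - elements \<T> \<Longrightarrow> \<exists>T\<in>elements \<T> - elements \<T>'. T' \<subseteq> T \<and>
      volume T' \<le> (1 - (1/2) ^ CARD('n)) * volume T"
proof -
  note d = refinements_descend[OF \<T>]
  interpret coarse: conforming_mesh \<Omega> "elements \<T>" by (rule mesh_conforming[OF \<T>(1) \<Omega>])
  interpret fine: conforming_mesh \<Omega> "elements \<T>'" by (rule mesh_conforming[OF d(1) \<Omega>])
  have desc: "T' \<in> elements \<T> \<or> (\<exists>T\<in>elements \<T>. T' \<subseteq> T \<and>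
      volume T' \<le> (1 - (1/2) ^ CARD('n)) * volume T)" if "T' \<in> elements \<T>'" for T'
  proof -
    obtain s where s: "s \<in> \<T>'" "T' = element s" using \<open>T' \<in> elements \<T>'\<close> by blast
    have "descends_from \<T> s" using d(2) s(1) by blast
    then consider "s \<in> \<T>" | t where "t \<in> \<T>" "element s \<subseteq> element t"
      "volume (element s) \<le> (1 - (1/2) ^ CARD('n)) * volume (element t)"
      unfolding descends_from_def by blast
    then show ?thesis
    proof cases
      case 1
      then show ?thesis unfolding s(2) by (intro disjI1 imageI)
    next
      case 2
      then show ?thesis unfolding s(2) by (intro disjI2 bexI[of _ "element t"] conjI imageI)
    qed
  qed
  have ancestor: "\<exists>T\<in>elements \<T>. T' \<subseteq> T" if "T' \<in> elements \<T>'" for T'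
    using desc[OF that]
  proof (elim disjE bexE conjE)
    assume "T' \<in> elements \<T>"
    then show ?thesis by (rule rev_bexI) (rule order_refl)
  next
    fix T assume "T \<in> elements \<T>" "T' \<subseteq> T"
    then show ?thesis by (rule rev_bexI)
  qed
  show "refined_mesh \<Omega> (elements \<T>) (elements \<T>')"
    by (intro refined_mesh.intro coarse.conforming_mesh_axioms fine.conforming_mesh_axioms
        refined_mesh_axioms.intro ancestor)
  fix T' assume T': "T' \<in> elements \<T>' - elements \<T>"
  then have "T' \<in> elements \<T>' \<and> T' \<notin> elements \<T>" by (simp only: Diff_iff not_False_eq_True)
  note mem = conjunct1[OF this] conjunct2[OF this]
  have "\<exists>T\<in>elements \<T>. T' \<subseteq> T \<and>
      volume T' \<le> (1 - (1/2) ^ CARD('n)) * volume T"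
    by (rule disjE[OF desc[OF mem(1)]]; (assumption | erule notE[OF mem(2)]))
  then obtain T where T: "T \<in> elements \<T>" "T' \<subseteq> T"
    "volume T' \<le> (1 - (1/2) ^ CARD('n)) * volume T" by (elim bexE conjE)
  have "T \<notin> elements \<T>'"
  proof
    assume "T \<in> elements \<T>'"
    moreover have "T' \<noteq> T" using mem(2) T(1) by metis
    ultimately have "T' \<inter> T \<noteq> T'" using mem(1) by (intro fine.element_not_subset)
    then show False using T(2) by (simp add: Int_absorb2)
  qed
  then show "\<exists>T\<in>elements \<T> - elements \<T>'. T' \<subseteq> T \<and>
      volume T' \<le> (1 - (1/2) ^ CARD('n)) * volume T"
    using T by (intro bexI[of _ T] conjI DiffI)
qed

theorem lemma2:
  fixes \<Omega> \<Gamma>D :: "(real^'n::finite) set"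
    and f g :: "real^'n \<Rightarrow> real^'n"
    and \<C> :: "real^'n^'n \<Rightarrow> real^'n^'n"
    and \<H> :: "real^'n \<Rightarrow> real^'n^'n \<Rightarrow> real^'n^'n"
    and \<kappa>C \<kappa>H H \<sigma>y :: real
    and \<T>0 :: "'n tagged set"
  assumes dim: "CARD('n) = 2 \<or> CARD('n) = 3"
    and domain: "lipschitz_domain \<Omega>"
    and dirichlet: "closed \<Gamma>D" "\<Gamma>D \<noteq> {}" "\<Gamma>D \<subseteq> frontier \<Omega>" "0 < emeasure surface_measure \<Gamma>D"
    and forces: "square_integrable (lebesgue_on \<Omega>) f"
      "square_integrable (restrict_space surface_measure (frontier \<Omega> - \<Gamma>D)) g"
    and elasticity: "symmetric_tensor \<C>" "isotropic \<C>" "0 < \<kappa>C" "coercive_tensor \<Omega> \<kappa>C (\<lambda>x. \<C>)"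
    and hardening: "\<And>x. x \<in> \<Omega> \<Longrightarrow> symmetric_tensor (\<H> x)" "0 < \<kappa>H" "coercive_tensor \<Omega> \<kappa>H \<H>"
      "\<And>\<tau>. \<tau> \<in> L2_sym \<Omega> \<Longrightarrow> (\<lambda>x. \<H> x (\<tau> x)) \<in> L2_sym \<Omega>"
    and moduli: "0 < H" "0 < \<sigma>y"
    and initial_mesh: "mesh \<Omega> \<T>0"
    and shape_regular: "\<exists>c>0. \<forall>\<T>\<in>refinements \<Omega> \<T>0. \<forall>T\<in>elements \<T>. diameter T \<le> c * inradius T"
  shows "\<exists>\<rho>2 C2. 0 < \<rho>2 \<and> \<rho>2 < 1 \<and> 0 < C2 \<and>
    (\<forall>\<T>\<in>refinements \<Omega> \<T>0. \<forall>\<T>'\<in>refinements \<Omega> \<T>. \<forall>U U'.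
       discrete_solution \<Omega> \<Gamma>D f g \<C> \<H> H \<sigma>y (elements \<T>) U \<longrightarrow>
       discrete_solution \<Omega> \<Gamma>D f g \<C> \<H> H \<sigma>y (elements \<T>') U' \<longrightarrow>
       (\<Sum>T\<in>elements \<T>' - elements \<T>. (eta \<Omega> \<Gamma>D f g \<C> (elements \<T>') U' T)\<^sup>2)
         \<le> \<rho>2 * (\<Sum>T\<in>elements \<T> - elements \<T>'. (eta \<Omega> \<Gamma>D f g \<C> (elements \<T>) U T)\<^sup>2)
            + C2 * (stress_dist \<Omega> \<C> U' U)\<^sup>2)"
proof -
  obtain c where c: "0 < c" "\<And>\<T> T. \<T> \<in> refinements \<Omega> \<T>0 \<Longrightarrow> T \<in> elements \<T> \<Longrightarrow> diameter T \<le> c * inradius T"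
    using shape_regular by blast
  have d2: "2 \<le> CARD('n)" using dim by auto
  define q :: real where "q = 1 - (1/2) ^ CARD('n)"
  have half: "(1/2 :: real) ^ CARD('n) \<le> 1/2"
    using power_decreasing[of 1 "CARD('n)" "1/2 :: real"] d2 by simp
  have q: "0 < q" "q < 1" using half by (simp_all add: q_def)
  define r where "r = sqrt q"
  have r: "0 < r" "r < 1" using q by (simp_all add: r_def)
  \<comment> \<open>\<open>(1 + \<delta>) r < 1\<close> for this \<open>\<delta>\<close> amounts to \<open>(1 - r) (2 - r) > 0\<close>\<close>
  define \<delta> where "\<delta> = (1 - r) / 2"
  have \<delta>: "0 < \<delta>" using r by (simp add: \<delta>_def)
  have "0 < (1 - r) * (2 - r)" using r by simp
  then have \<rho>1: "(1 + \<delta>) * r < 1" by (simp add: \<delta>_def field_simps)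
  have \<rho>0: "0 < (1 + \<delta>) * r" using r \<delta> by simp
  interpret init: conforming_mesh \<Omega> "elements \<T>0" by (rule mesh_conforming[OF initial_mesh domain])
  \<comment> \<open>the constant depends on no mesh; the initial mesh serves to see that it is nonnegative\<close>
  define C where "C = 4 * (1 + 1 / \<delta>) * (real CARD('n) + 1) * scaling_const \<Omega> c"
  have C0: "0 \<le> C" unfolding C_def using \<delta> init.scaling_const_nonneg[OF c(1)] by (intro mult_nonneg_nonneg) auto
  have "(\<Sum>T\<in>elements \<T>' - elements \<T>. (eta \<Omega> \<Gamma>D f g \<C> (elements \<T>') U' T)\<^sup>2)
         \<le> ((1 + \<delta>) * r) * (\<Sum>T\<in>elements \<T> - elements \<T>'. (eta \<Omega> \<Gamma>D f g \<C> (elements \<T>) U T)\<^sup>2)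
            + (C + 1) * (stress_dist \<Omega> \<C> U' U)\<^sup>2"
    if \<T>: "\<T> \<in> refinements \<Omega> \<T>0" "\<T>' \<in> refinements \<Omega> \<T>"
      and U: "discrete_solution \<Omega> \<Gamma>D f g \<C> \<H> H \<sigma>y (elements \<T>) U"
      and U': "discrete_solution \<Omega> \<Gamma>D f g \<C> \<H> H \<sigma>y (elements \<T>') U'" for \<T> \<T>' U U'
  proof -
    have mesh: "mesh \<Omega> \<T>" using refinements_descend(1)[OF initial_mesh \<T>(1)] .
    interpret refined_mesh \<Omega> "elements \<T>" "elements \<T>'" by (rule refinement_refined_mesh(1)[OF mesh \<T>(2) domain])
    have sU: "ae_constant_on T (stress \<Omega> \<C> U)" if "T \<in> elements \<T>" for T
      using U that by (intro coarse.stress_constant[of U \<Gamma>D]) (simp_all add: discrete_solution_def)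
    have sU': "ae_constant_on T (stress \<Omega> \<C> U')" if "T \<in> elements \<T>'" for T
      using U' that by (intro fine.stress_constant[of U' \<Gamma>D]) (simp_all add: discrete_solution_def)
    have sU_fine: "ae_constant_on T' (stress \<Omega> \<C> U)" if T': "T' \<in> elements \<T>'" for T'
    proof -
      obtain T where T: "T \<in> elements \<T>" "T' \<subseteq> T" using refines[OF T'] by auto
      obtain s where s: "AE x in lebesgue. x \<in> T \<longrightarrow> stress \<Omega> \<C> U x = s" using sU[OF T(1)] by auto
      have "AE x in lebesgue. x \<in> T' \<longrightarrow> stress \<Omega> \<C> U x = s" using s by eventually_elim (use T(2) in auto)
      then show ?thesis by blast
    qed
    have shape: "diameter T \<le> c * inradius T" if "T \<in> elements \<T>'" for T
      using c(2)[OF refinements_trans[OF \<T>] that] .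
    let ?E' = "\<Sum>T\<in>elements \<T>' - elements \<T>. (eta \<Omega> \<Gamma>D f g \<C> (elements \<T>') U T)\<^sup>2"
    let ?E = "\<Sum>T\<in>elements \<T> - elements \<T>'. (eta \<Omega> \<Gamma>D f g \<C> (elements \<T>) U T)\<^sup>2"
    have "(\<Sum>T\<in>elements \<T>' - elements \<T>. (eta \<Omega> \<Gamma>D f g \<C> (elements \<T>') U' T)\<^sup>2)
       \<le> (1 + \<delta>) * ?E' + C * (stress_dist \<Omega> \<C> U' U)\<^sup>2"
      unfolding C_def
      by (rule fine.eta_perturbation[OF d2 c(1) shape _ \<delta> dirichlet(1) forces(2) sU_fine sU']) auto
    also have "?E' \<le> r * ?E"
      unfolding r_def
    proof (rule eta_reduction_fixed_state[OF _ _ _ dirichlet(1) forces sU])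
      show "\<exists>T\<in>elements \<T> - elements \<T>'. T' \<subseteq> T \<and> volume T' \<le> q * volume T"
        if "T' \<in> elements \<T>' - elements \<T>" for T'
        unfolding q_def using refinement_refined_mesh(2)[OF mesh \<T>(2) domain that] .
    qed (use q in auto)
    also have "C * (stress_dist \<Omega> \<C> U' U)\<^sup>2 \<le> (C + 1) * (stress_dist \<Omega> \<C> U' U)\<^sup>2"
      by (intro mult_right_mono) auto
    finally show ?thesis using \<delta> by (simp add: mult.assoc)
  qed
  then show ?thesis
    using \<rho>0 \<rho>1 C0 by (intro exI[of _ "(1 + \<delta>) * r"] exI[of _ "C + 1"]) auto
qed


end
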